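(* Let $d\ge 1$ and $s>0$ with $2s>d$. There is a constant $C=C(d,s)>0$ such that for every $N\ge 1$ and every $\Psi_N\in\mathcal{H}^{s,N}(\mathbb{R}^d)$ with $\|\Psi_N\|_{L^2(\mathbb{R}^{dN})}=1$, $$\Big\langle \Psi_N, \sum_{i=1}^N (-\Delta_{\mathbf{x}_i})^s\Psi_N\Big\rangle \ge C\int_{\mathbb{R}^d}\varrho_{\Psi_N}(\mathbf{x})^{1+2s/d}\,d\mathbf{x}.$$
   Context: For $s>0$, $(-\Delta)^s$ on $L^2(\mathbb{R}^d)$ is the Fourier multiplier $|\mathbf{p}|^{2s}$, and $(-\Delta_{\mathbf{x}_i})^s$ acts on the $i$-th variable $\mathbf{x}_i\in\mathbb{R}^d$ of a function on $(\mathbb{R}^d)^N$; the left side is the quadratic form (finite for $\Psi_N\in H^s(\mathbb{R}^{dN})$). The one-body density of $\Psi_N$ is $\varrho_{\Psi_N}(\mathbf{x})=\sum_{j=1}^N\int_{\mathbb{R}^{d(N-1)}}|\Psi_N(\mathbf{x}_1,\dots,\mathbf{x}_{j-1},\mathbf{x},\mathbf{x}_{j+1},\dots,\mathbf{x}_N)|^2\prod_{i\neq j}d\mathbf{x}_i$. The diagonal set is $\triangle=\{(\mathbf{x}_1,\dots,\mathbf{x}_N)\in(\mathbb{R}^d)^N:\mathbf{x}_i=\mathbf{x}_j\text{ for some }i\ne j\}$, and $\mathcal{H}^{s,N}(\mathbb{R}^d)$ is the closure in $H^s(\mathbb{R}^{dN})$ of $\{\Psi\in C_c^\infty(\mathbb{R}^{dN}):\Psi|_{\triangle}=0\}$.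 No symmetry assumption is imposed on $\Psi_N$. *)

theory Defs
  imports "HOL-Analysis.Analysis"
begin

text \<open>Configurations (x_1,...,x_N) in (R^d)^N are functions nat => real^'d,
  extensional outside {..<N}; the measure on (R^d)^N is the product of Lebesgue measures.\<close>

definition cfg :: "nat \<Rightarrow> (nat \<Rightarrow> real^'d) measure" where
  "cfg N = PiM {..<N} (\<lambda>_. lborel)"

abbreviation cfg_space :: "nat \<Rightarrow> (nat \<Rightarrow> real^'d) set" where
  "cfg_space N \<equiv> PiE {..<N} (\<lambda>_. UNIV)"

definition cont_cfg :: "nat \<Rightarrow> ((nat \<Rightarrow> real^'d) \<Rightarrow> complex) \<Rightarrow> bool" where
  "cont_cfg N f \<longleftrightarrow> (\<forall>x\<in>cfg_space N. \<forall>e>0. \<exists>\<delta>>0. \<forall>y\<in>cfg_space N.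
      (\<forall>i<N. dist (y i) (x i) < \<delta>) \<longrightarrow> dist (f y) (f x) < e)"

coinductive smooth_cfg :: "nat \<Rightarrow> ((nat \<Rightarrow> real^'d) \<Rightarrow> complex) \<Rightarrow> bool" for N where
  "cont_cfg N f \<Longrightarrow>
   (\<forall>i<N. \<forall>k::'d. \<exists>g. smooth_cfg N g \<and>
      (\<forall>x\<in>cfg_space N. ((\<lambda>t::real. f (x(i := x i + t *\<^sub>R axis k 1))) has_vector_derivative g x) (at 0)))
   \<Longrightarrow> smooth_cfg N f"

definition test_fn :: "nat \<Rightarrow> ((nat \<Rightarrow> real^'d) \<Rightarrow> complex) \<Rightarrow> bool" where
  "test_fn N f \<longleftrightarrow> smooth_cfg N f
     \<and> (\<exists>R. \<forall>x\<in>cfg_space N. (\<exists>i<N. norm (x i) > R) \<longrightarrow> f x = 0)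
     \<and> (\<forall>x\<in>cfg_space N. (\<exists>i<N. \<exists>j<N. i \<noteq> j \<and> x i = x j) \<longrightarrow> f x = 0)"

definition FT :: "nat \<Rightarrow> ((nat \<Rightarrow> real^'d) \<Rightarrow> complex) \<Rightarrow> (nat \<Rightarrow> real^'d) \<Rightarrow> complex" where
  "FT N f p = complex_of_real ((2*pi) powr (- real (CARD('d) * N) / 2)) *
     (\<integral>x. exp (- \<i> * complex_of_real (\<Sum>i<N. p i \<bullet> x i)) * f x \<partial>cfg N)"

definition hs_norm2 :: "real \<Rightarrow> nat \<Rightarrow> ((nat \<Rightarrow> real^'d) \<Rightarrow> complex) \<Rightarrow> real" where
  "hs_norm2 s N f = (\<integral>p. ((1 + (\<Sum>i<N. (norm (p i))\<^sup>2)) powr s) * (cmod (FT N f p))\<^sup>2 \<partial>cfg N)"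

definition kin_form :: "real \<Rightarrow> nat \<Rightarrow> ((nat \<Rightarrow> real^'d) \<Rightarrow> complex) \<Rightarrow> real" where
  "kin_form s N f = (\<integral>p. (\<Sum>i<N. (norm (p i)) powr (2 * s)) * (cmod (FT N f p))\<^sup>2 \<partial>cfg N)"

definition L2_cfg :: "nat \<Rightarrow> ((nat \<Rightarrow> real^'d) \<Rightarrow> complex) \<Rightarrow> bool" where
  "L2_cfg N f \<longleftrightarrow> f \<in> borel_measurable (cfg N) \<and> integrable (cfg N) (\<lambda>x. (cmod (f x))\<^sup>2)"

definition hs_approx :: "real \<Rightarrow> nat \<Rightarrow> ((nat \<Rightarrow> real^'d) \<Rightarrow> complex)
     \<Rightarrow> (nat \<Rightarrow> (nat \<Rightarrow> real^'d) \<Rightarrow> complex) \<Rightarrow> bool" where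
  "hs_approx s N \<Psi> \<phi> \<longleftrightarrow> (\<forall>n. test_fn N (\<phi> n))
     \<and> (\<forall>e>0. \<exists>M. \<forall>n\<ge>M. \<forall>m\<ge>M. hs_norm2 s N (\<lambda>x. \<phi> n x - \<phi> m x) < e)
     \<and> ((\<lambda>n. \<integral>x. (cmod (\<phi> n x - \<Psi> x))\<^sup>2 \<partial>cfg N) \<longlonglongrightarrow> 0)"

definition in_HsN :: "real \<Rightarrow> nat \<Rightarrow> ((nat \<Rightarrow> real^'d) \<Rightarrow> complex) \<Rightarrow> bool" where
  "in_HsN s N \<Psi> \<longleftrightarrow> L2_cfg N \<Psi> \<and> (\<exists>\<phi>. hs_approx s N \<Psi> \<phi>)"

text \<open>The quadratic form < Psi, sum_i (-Delta_i)^s Psi >, extended by continuity.\<close>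
definition kinetic :: "real \<Rightarrow> nat \<Rightarrow> ((nat \<Rightarrow> real^'d) \<Rightarrow> complex) \<Rightarrow> real" where
  "kinetic s N \<Psi> = lim (\<lambda>n. kin_form s N ((SOME \<phi>. hs_approx s N \<Psi> \<phi>) n))"

definition rho :: "nat \<Rightarrow> ((nat \<Rightarrow> real^'d) \<Rightarrow> complex) \<Rightarrow> real^'d \<Rightarrow> real" where
  "rho N \<Psi> x = (\<Sum>j<N. \<integral>y. (cmod (\<Psi> (y(j := x))))\<^sup>2 \<partial>(PiM ({..<N} - {j}) (\<lambda>_. lborel)))"

end

theory Submission
  imports Defs "HOL-Probability.Probability"
begin

text \<open>
  Rumin's method, with the diagonal condition in the role of the Pauli principle. Fix d/2 < sg < s and
  a band-limited profile zeta with zeta(0) = 1 and polynomial decay. Localise a slice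
  z \<mapsto> \<phi>(X(i := z)) by zeta((z - x) / l) and split its value at x by Fourier inversion into
  frequencies below and above 2d/l. The high frequencies contribute a density G(l, x) such that the
  integral of l powr (- 2 s - 1) * G(l, x) over l and x is, by Plancherel, at most a constant times the kinetic energy.
  For the low frequencies, suppose some other particle j is within \<epsilon> l of x. Since \<phi> vanishes
  at coinciding particles, the localised value at X j may be subtracted, and the low frequencies then contribute only
  a fraction \<epsilon>^2 of the density averaged over scale l, which is absorbed. In the remaining configurations
  particle i is isolated, and a packing argument bounds their averaged density by
  C l^(-d) times the squared norm. Altogether the density satisfies, for every l > 0,
  \<rho>(x) \<le> C l^(-d) + H(l, x) with H controlled like G. Integrating against
  l powr (- 2 s - 1) over l \<ge> (2C / \<rho>(x))^(1/d) gives the power 1 + 2s/d of the density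
  at x. The closure is reached by Fatou's lemma along an almost everywhere convergent subsequence.
\<close>

subsection \<open>Fourier inversion and Plancherel by Gaussian regularisation\<close>

text \<open>Without antisymmetry the one-body density matrix has no operator bound uniform in N, so
  the usual input of Rumin's method is missing. What replaces it is that a slice in one variable
  vanishes at the positions of the other particles; such point conditions survive in H^s because 2 s
  > d. They control a slice only through an average of its square over scale l. Hence the estimate
  is first closed for the averaged density, where the low-frequency term can be absorbed, and only
  then carried back to a point. Absorbing means averaging an average, so the weight must be
  reproduced by convolution up to a constant: a product of Cauchy weights is, a Gaussian is not. The
  profile is band-limited so that high frequencies of a localised slice can only come from
  comparably high frequencies of the function itself. The auxiliary exponent needs 2 sg > d to make
  |q|^(-2 sg) integrable at infinity, and sg < s to make the integral over large l converge. The
  constants do not depend on N because the packing count is made separately in each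
  configuration.\<close>

lemma borel_measurable_cis [measurable]: "cis \<in> borel_measurable borel"
  unfolding cis_conv_exp by measurable

lemma borel_measurable_cnj [measurable]: "cnj \<in> borel_measurable borel"
  by (intro borel_measurable_continuous_onI continuous_intros)

lemma norm_integral_le:
  fixes f :: "'a \<Rightarrow> 'b::{banach, second_countable_topology}"
  assumes g: "integrable M g" and le: "\<And>x. x \<in> space M \<Longrightarrow> norm (f x) \<le> g x"
  shows "norm (\<integral>x. f x \<partial>M) \<le> (\<integral>x. g x \<partial>M)"
  using le by (intro order_trans[OF integral_norm_bound integral_mono'[OF g]])
    (auto intro: order_trans[OF norm_ge_zero])

lemma (in pair_sigma_finite) integrable_prod_bound:
  fixes f :: "'a \<times> 'b \<Rightarrow> 'c::{banach, second_countable_topology}"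
    and a :: "'a \<Rightarrow> real" and b :: "'b \<Rightarrow> real"
  assumes a: "integrable M1 a" and b: "integrable M2 b"
    and f: "f \<in> borel_measurable (M1 \<Otimes>\<^sub>M M2)"
    and bound: "\<And>x y. x \<in> space M1 \<Longrightarrow> y \<in> space M2 \<Longrightarrow> norm (f (x, y)) \<le> a x * b y"
  shows "integrable (M1 \<Otimes>\<^sub>M M2) f"
proof (rule Bochner_Integration.integrable_bound)
  have [measurable]: "a \<in> borel_measurable M1" "b \<in> borel_measurable M2"
    using a b by auto
  show "integrable (M1 \<Otimes>\<^sub>M M2) (\<lambda>z. a (fst z) * b (snd z))"
  proof (rule Fubini_integrable)
    show "integrable M1 (\<lambda>x. \<integral>y. norm (a (fst (x, y)) * b (snd (x, y))) \<partial>M2)"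
      using a b by (simp add: abs_mult)
    show "AE x in M1. integrable M2 (\<lambda>y. a (fst (x, y)) * b (snd (x, y)))"
      using b by simp
  qed simp
  show "AE x in M1 \<Otimes>\<^sub>M M2. norm (f x) \<le> norm (a (fst x) * b (snd x))"
    using bound by (intro AE_I2) (force simp: space_pair_measure intro: order_trans[OF _ abs_ge_self])
qed (use f in simp)

text \<open>An abstract space with pairing B and dilated translation sh r x z = x + r z, instantiated both
  by a Euclidean space and by the configuration space, which is not an instance of any vector space class.\<close>
locale fourier_space = sigma_finite_measure M for M :: "'a measure" +
  fixes B :: "'a \<Rightarrow> 'a \<Rightarrow> real" and sh :: "real \<Rightarrow> 'a \<Rightarrow> 'a \<Rightarrow> 'a" and n :: nat
  assumes B_measurable: "(\<lambda>(p, x). B p x) \<in> borel_measurable (M \<Otimes>\<^sub>M M)"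
    and B_nonneg: "B p p \<ge> 0"
    and B_sh: "B p (sh r x z) = B p x + r * B p z"
    and sh_measurable: "x \<in> space M \<Longrightarrow> sh r x \<in> measurable M M"
    and sh_distr: "x \<in> space M \<Longrightarrow> r > 0 \<Longrightarrow> M = density (distr M M (sh r x)) (\<lambda>_. ennreal (r ^ n))"
    and gauss_integrable: "t > 0 \<Longrightarrow> integrable M (\<lambda>p. exp (- t * B p p / 2))"
    and gauss_ft: "t > 0 \<Longrightarrow> z \<in> space M \<Longrightarrow> (\<integral>p. cis (- sqrt t * B p z) * exp (- t * B p p / 2) \<partial>M)
        = complex_of_real (sqrt (2 * pi / t) ^ n * exp (- B z z / 2))"
    and B_zero: "\<exists>z\<in>space M. \<forall>p. B p z = 0"
begin

lemma B_measurable' [measurable (raw)]: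
  assumes "f \<in> measurable N M" "g \<in> measurable N M"
  shows "(\<lambda>x. B (f x) (g x)) \<in> borel_measurable N"
  using measurable_compose[OF measurable_Pair[OF assms] B_measurable] by simp

text \<open>Standard Gaussian probability measure of the abstract space. The kernel of the
  regularised inversion formula is this measure moved to \<open>x\<close> and dilated by
  \<open>sqrt t\<close>, so it concentrates at \<open>x\<close> as \<open>t\<close> tends to
  0.\<close>

definition \<gamma> :: "'a measure" where
  "\<gamma> = density M (\<lambda>z. ennreal (exp (- B z z / 2) / sqrt (2 * pi) ^ n))"

abbreviation c :: real where "c \<equiv> (2 * pi) ^ n"

lemma sets_\<gamma> [measurable_cong]: "sets \<gamma> = sets M"
  by (simp add: \<gamma>_def)

lemma space_\<gamma>: "space \<gamma> = space M"
  by (simp add: \<gamma>_def)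

lemma c_pos: "c > 0" by simp

lemma gauss_integral: "(\<integral>p. exp (- B p p / 2) \<partial>M) = sqrt (2 * pi) ^ n"
proof -
  obtain z where z: "z \<in> space M" "B p z = 0" for p using B_zero by auto
  have "complex_of_real (\<integral>p. exp (- B p p / 2) \<partial>M) = (\<integral>p. complex_of_real (exp (- B p p / 2)) \<partial>M)"
    by (rule integral_complex_of_real[symmetric])
  also have "\<dots> = complex_of_real (sqrt (2 * pi) ^ n)"
    using gauss_ft[OF zero_less_one z(1)] by (simp add: z(2))
  finally show ?thesis using of_real_eq_iff by blast
qed

sublocale gauss: prob_space \<gamma>
proof
  have "emeasure \<gamma> (space \<gamma>) = (\<integral>\<^sup>+z. ennreal (exp (- B z z / 2) / sqrt (2 * pi) ^ n) \<partial>M)"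
    by (simp add: \<gamma>_def emeasure_density cong: nn_integral_cong)
  also have "\<dots> = ennreal (\<integral>z. exp (- B z z / 2) / sqrt (2 * pi) ^ n \<partial>M)"
    using gauss_integrable[of 1] by (intro nn_integral_eq_integral) auto
  also have "\<dots> = ennreal ((\<integral>z. exp (- B z z / 2) \<partial>M) / sqrt (2 * pi) ^ n)" by simp
  also have "\<dots> = 1" unfolding gauss_integral by simp
  finally show "emeasure \<gamma> (space \<gamma>) = 1" .
qed

text \<open>Substituting \<open>y = sh (sqrt t) x z\<close> turns the phase into
  \<open>- sqrt t * B p z\<close>, the form evaluated by \<open>gauss_ft\<close>. The abstract space
  has no subtraction, so the substitution must come before the kernel is evaluated. The Jacobian
  \<open>sqrt t ^ n\<close> cancels the power of \<open>t\<close> in the Gaussian integral; the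
  normalisation of \<open>\<gamma>\<close> turns the remaining \<open>sqrt (2 * pi) ^ n\<close> into
  \<open>c\<close>.\<close>

lemma gauss_kernel_integral:
  assumes x: "x \<in> space M" and t: "t > 0" and [measurable]: "g \<in> borel_measurable M"
  shows "(\<integral>y. g y * (\<integral>p. cis (B p x - B p y) * exp (- t * B p p / 2) \<partial>M) \<partial>M)
        = complex_of_real c * (\<integral>z. g (sh (sqrt t) x z) \<partial>\<gamma>)"
proof -
  note [measurable] = sh_measurable[OF x] x
  have t': "sqrt t > 0" using t by simp
  let ?k = "\<lambda>y. (\<integral>p. cis (B p x - B p y) * complex_of_real (exp (- t * B p p / 2)) \<partial>M)"
  have "(\<integral>y. g y * ?k y \<partial>M)
     = (\<integral>y. g y * ?k y \<partial>density (distr M M (sh (sqrt t) x)) (\<lambda>_. ennreal (sqrt t ^ n)))"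
    using sh_distr[OF x t'] by simp
  also have "\<dots> = (\<integral>z. sqrt t ^ n *\<^sub>R (g (sh (sqrt t) x z) * ?k (sh (sqrt t) x z)) \<partial>M)"
    using t by (subst integral_density, simp_all, subst integral_distr, simp_all)
  also have "\<dots> = (\<integral>z. complex_of_real c * ((exp (- B z z / 2) / sqrt (2 * pi) ^ n) *\<^sub>R g (sh (sqrt t) x z)) \<partial>M)"
  proof (intro Bochner_Integration.integral_cong refl)
    fix z assume z: "z \<in> space M"
    have k: "?k (sh (sqrt t) x z) = complex_of_real (sqrt (2 * pi / t) ^ n * exp (- B z z / 2))"
      using gauss_ft[OF t z] by (simp add: B_sh)
    have c: "c = sqrt (2 * pi) ^ n * sqrt (2 * pi) ^ n"
      unfolding power_mult_distrib[symmetric] by simp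
    have "sqrt t ^ n * sqrt (2 * pi / t) ^ n = sqrt (2 * pi) ^ n"
      using t by (simp add: power_mult_distrib[symmetric] real_sqrt_mult[symmetric])
    then have "sqrt t ^ n * (sqrt (2 * pi / t) ^ n * e) = c * (e / sqrt (2 * pi) ^ n)" for e
      unfolding c by (simp add: mult.assoc[symmetric])
    then have *: "complex_of_real (sqrt t ^ n) * complex_of_real (sqrt (2 * pi / t) ^ n * exp (- B z z / 2))
       = complex_of_real c * complex_of_real (exp (- B z z / 2) / sqrt (2 * pi) ^ n)"
      unfolding of_real_mult[symmetric] by simp
    have "a * (G * b') = c' * (d' * G)" if "a * b' = c' * d'" for a b' c' d' G :: complex
      using arg_cong[OF that, of "\<lambda>u. u * G"] by (simp add: mult_ac)
    from this[OF *] show "sqrt t ^ n *\<^sub>R (g (sh (sqrt t) x z) * ?k (sh (sqrt t) x z))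
       = complex_of_real c * ((exp (- B z z / 2) / sqrt (2 * pi) ^ n) *\<^sub>R g (sh (sqrt t) x z))"
      unfolding k scaleR_conv_of_real .
  qed
  also have "\<dots> = complex_of_real c * (\<integral>z. (exp (- B z z / 2) / sqrt (2 * pi) ^ n) *\<^sub>R g (sh (sqrt t) x z) \<partial>M)"
    by (rule Bochner_Integration.integral_mult_right_zero)
  also have "(\<integral>z. (exp (- B z z / 2) / sqrt (2 * pi) ^ n) *\<^sub>R g (sh (sqrt t) x z) \<partial>M) = (\<integral>z. g (sh (sqrt t) x z) \<partial>\<gamma>)"
    unfolding \<gamma>_def by (subst integral_density) simp_all
  finally show ?thesis .
qed

sublocale MM: pair_sigma_finite M M ..

text \<open>Unnormalised transform, so inversion and Plancherel carry the factor \<open>c\<close>.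
  The unitary normalisation comes back only in \<open>FT_eq\<close>, which keeps the abstract theory
  free of real powers of \<open>2 * pi\<close>.\<close>

definition ft :: "('a \<Rightarrow> complex) \<Rightarrow> 'a \<Rightarrow> complex" where
  "ft g p = (\<integral>y. cis (- B p y) * g y \<partial>M)"

lemma ft_measurable [measurable]:
  assumes [measurable]: "g \<in> borel_measurable M"
  shows "ft g \<in> borel_measurable M"
  unfolding ft_def by measurable

lemma norm_ft_le:
  assumes "integrable M g"
  shows "cmod (ft g p) \<le> (\<integral>y. cmod (g y) \<partial>M)"
proof -
  have "cmod (ft g p) \<le> (\<integral>y. cmod (cis (- B p y) * g y) \<partial>M)"
    unfolding ft_def by (rule integral_norm_bound)
  then show ?thesis by (simp add: norm_mult)
qed

text \<open>The Gaussian factor makes the double integral over \<open>p\<close> and \<open>y\<close>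
  absolutely convergent and so justifies exchanging the integrals; the inner integral over
  \<open>p\<close> is then the kernel of \<open>gauss_kernel_integral\<close>.\<close>

lemma ft_gauss_inversion:
  assumes g: "integrable M g" and x: "x \<in> space M" and t: "t > 0"
  shows "(\<integral>p. ft g p * cis (B p x) * exp (- t * B p p / 2) \<partial>M)
     = complex_of_real c * (\<integral>z. g (sh (sqrt t) x z) \<partial>\<gamma>)"
proof -
  have [measurable]: "g \<in> borel_measurable M" using g by auto
  note [measurable] = x
  let ?e = "\<lambda>p. exp (- t * B p p / 2)"
  have int: "integrable (M \<Otimes>\<^sub>M M) (\<lambda>(p, y). g y * (cis (B p x - B p y) * complex_of_real (?e p)))"
    by (rule MM.integrable_prod_bound[OF gauss_integrable[OF t] integrable_norm[OF g]])
       (simp_all add: norm_mult, measurable)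
  have "(\<integral>p. ft g p * cis (B p x) * ?e p \<partial>M)
      = (\<integral>p. (\<integral>y. g y * (cis (B p x - B p y) * complex_of_real (?e p)) \<partial>M) \<partial>M)"
    unfolding ft_def
  proof (intro Bochner_Integration.integral_cong refl)
    fix p
    have "(\<integral>y. g y * (cis (B p x - B p y) * complex_of_real (?e p)) \<partial>M)
        = (\<integral>y. (cis (- B p y) * g y) * (cis (B p x) * complex_of_real (?e p)) \<partial>M)"
      by (intro Bochner_Integration.integral_cong refl)
         (simp add: cis_mult[symmetric] diff_conv_add_uminus mult_ac del: add_uminus_conv_diff)
    then show "(\<integral>y. cis (- B p y) * g y \<partial>M) * cis (B p x) * complex_of_real (?e p)
        = (\<integral>y. g y * (cis (B p x - B p y) * complex_of_real (?e p)) \<partial>M)"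
      by (simp only: Bochner_Integration.integral_mult_left_zero mult.assoc[of _ "cis (B p x)"])
  qed
  also have "\<dots> = (\<integral>y. (\<integral>p. g y * (cis (B p x - B p y) * complex_of_real (?e p)) \<partial>M) \<partial>M)"
    using MM.Fubini_integral[OF int] by simp
  also have "\<dots> = (\<integral>y. g y * (\<integral>p. cis (B p x - B p y) * complex_of_real (?e p) \<partial>M) \<partial>M)"
    by simp
  also have "\<dots> = complex_of_real c * (\<integral>z. g (sh (sqrt t) x z) \<partial>\<gamma>)"
    using gauss_kernel_integral[OF x t, of g] by simp
  finally show ?thesis .
qed

text \<open>The form of continuity that Gaussian regularisation needs: along the dilations only.\<close>
definition radial_cont :: "('a \<Rightarrow> complex) \<Rightarrow> 'a \<Rightarrow> bool" where
  "radial_cont g x \<longleftrightarrow> (\<forall>z\<in>space M. (\<lambda>n. g (sh (sqrt (1 / real (Suc n))) x z)) \<longlonglongrightarrow> g x)"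

text \<open>On a probability measure a constant bound is integrable, so convergence for each fixed
  \<open>z\<close>, which is what \<open>radial_cont\<close> provides, suffices for dominated
  convergence.\<close>

lemma gauss_average_tendsto:
  assumes [measurable]: "g \<in> borel_measurable M" and x: "x \<in> space M"
    and bd: "\<And>y. y \<in> space M \<Longrightarrow> cmod (g y) \<le> b"
    and cont: "radial_cont g x"
  shows "(\<lambda>n. \<integral>z. g (sh (sqrt (1 / real (Suc n))) x z) \<partial>\<gamma>) \<longlonglongrightarrow> g x"
proof -
  note [measurable] = sh_measurable[OF x]
  have "(\<lambda>n. \<integral>z. g (sh (sqrt (1 / real (Suc n))) x z) \<partial>\<gamma>) \<longlonglongrightarrow> (\<integral>z. g x \<partial>\<gamma>)"
  proof (rule integral_dominated_convergence[where w="\<lambda>_. b"])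
    show "AE z in \<gamma>. (\<lambda>n. g (sh (sqrt (1 / real (Suc n))) x z)) \<longlonglongrightarrow> g x"
      using cont unfolding radial_cont_def by (auto simp: space_\<gamma>)
    show "AE z in \<gamma>. cmod (g (sh (sqrt (1 / real (Suc n))) x z)) \<le> b" for n
      using measurable_space[OF sh_measurable[OF x]] by (intro AE_I2 bd) (simp add: space_\<gamma>)
  qed (simp_all del: of_nat_Suc)
  then show ?thesis by (simp add: gauss.prob_space)
qed

lemma exp_gauss_tendsto: "(\<lambda>n. exp (- (1 / real (Suc n)) * a / 2)) \<longlonglongrightarrow> (1::real)"
proof -
  have "(\<lambda>n. - (1 / real (Suc n)) * a / 2) \<longlonglongrightarrow> - 0 * a / 2"
    by (intro tendsto_intros LIMSEQ_Suc lim_1_over_n) auto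
  from tendsto_exp[OF this] show ?thesis by simp
qed

text \<open>The regularised formula is followed along \<open>t = 1 / (n + 1)\<close>: the left side
  is dominated by \<open>cmod (ft g p)\<close>, the right side is a concentrating Gaussian average
  of a bounded function.\<close>

lemma ft_inversion:
  assumes g: "integrable M g" and gh: "integrable M (ft g)" and x: "x \<in> space M"
    and bd: "\<And>y. y \<in> space M \<Longrightarrow> cmod (g y) \<le> b" and cont: "radial_cont g x"
  shows "(\<integral>p. ft g p * cis (B p x) \<partial>M) = complex_of_real c * g x"
proof -
  have [measurable]: "g \<in> borel_measurable M" using g by auto
  note [measurable] = x
  have "(\<lambda>n. \<integral>p. ft g p * cis (B p x) * complex_of_real (exp (- (1 / real (Suc n)) * B p p / 2)) \<partial>M)
     \<longlonglongrightarrow> (\<integral>p. ft g p * cis (B p x) \<partial>M)"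
  proof (rule integral_dominated_convergence[where w="\<lambda>p. cmod (ft g p)"])
    show "AE p in M. (\<lambda>n. ft g p * cis (B p x) * complex_of_real (exp (- (1 / real (Suc n)) * B p p / 2)))
        \<longlonglongrightarrow> ft g p * cis (B p x)"
    proof (rule AE_I2)
      fix p
      have "(\<lambda>n. ft g p * cis (B p x) * complex_of_real (exp (- (1 / real (Suc n)) * B p p / 2)))
        \<longlonglongrightarrow> ft g p * cis (B p x) * complex_of_real 1"
        by (intro tendsto_intros exp_gauss_tendsto)
      then show "(\<lambda>n. ft g p * cis (B p x) * complex_of_real (exp (- (1 / real (Suc n)) * B p p / 2)))
        \<longlonglongrightarrow> ft g p * cis (B p x)" by simp
    qed
    show "AE p in M. cmod (ft g p * cis (B p x) * complex_of_real (exp (- (1 / real (Suc n)) * B p p / 2)))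
        \<le> cmod (ft g p)" for n
      using B_nonneg by (intro AE_I2) (simp add: norm_mult mult_left_le)
  qed (use gh in \<open>simp_all, measurable\<close>)
  moreover have "(\<lambda>n. \<integral>p. ft g p * cis (B p x) * complex_of_real (exp (- (1 / real (Suc n)) * B p p / 2)) \<partial>M)
     \<longlonglongrightarrow> complex_of_real c * g x"
    using tendsto_mult_left[OF gauss_average_tendsto[OF _ x bd cont], of "complex_of_real c"]
    by (subst ft_gauss_inversion[OF g x]) simp_all
  ultimately show ?thesis by (rule LIMSEQ_unique)
qed

text \<open>Pairing the regularised inversion formula with \<open>cnj g\<close> yields a damped
  square integral of \<open>ft g\<close>. As the damping is removed this side increases
  monotonically, while the other converges by domination. In terms of nonnegative integrals, square
  integrability of \<open>ft g\<close> is part of the outcome.\<close>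

lemma ft_plancherel:
  assumes g: "integrable M g"
    and bd: "\<And>y. y \<in> space M \<Longrightarrow> cmod (g y) \<le> b"
    and cont: "\<And>x. x \<in> space M \<Longrightarrow> radial_cont g x"
  shows "(\<integral>\<^sup>+p. ennreal ((cmod (ft g p))\<^sup>2) \<partial>M) = ennreal c * (\<integral>\<^sup>+x. ennreal ((cmod (g x))\<^sup>2) \<partial>M)"
proof -
  have gm[measurable]: "g \<in> borel_measurable M" using g by auto
  define T where "T n = 1 / real (Suc n)" for n
  have T: "T n > 0" for n by (simp add: T_def)
  let ?e = "\<lambda>n p. exp (- T n * B p p / 2)"
  let ?a = "\<integral>y. cmod (g y) \<partial>M"
  have Tt: "(\<lambda>n. ?e n p) \<longlonglongrightarrow> 1" for p
    using exp_gauss_tendsto unfolding T_def .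
  have e1: "?e n p \<le> 1" for n p
    using B_nonneg[of p] T[of n] by simp
  have reg: "integrable M (\<lambda>p. (cmod (ft g p))\<^sup>2 * ?e n p)" for n
  proof (rule Bochner_Integration.integrable_bound[OF integrable_mult_right[OF gauss_integrable[OF T[of n]], of "?a\<^sup>2"]])
    show "AE p in M. norm ((cmod (ft g p))\<^sup>2 * ?e n p) \<le> norm (?a\<^sup>2 * ?e n p)"
      using norm_ft_le[OF g] by (intro AE_I2) (auto simp: abs_mult intro!: mult_right_mono power_mono)
  qed measurable
  have step: "complex_of_real (\<integral>p. (cmod (ft g p))\<^sup>2 * ?e n p \<partial>M)
      = (\<integral>x. cnj (g x) * (complex_of_real c * (\<integral>z. g (sh (sqrt (T n)) x z) \<partial>\<gamma>)) \<partial>M)" for n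
  proof -
    have int: "integrable (M \<Otimes>\<^sub>M M) (\<lambda>(p, x). cnj (g x) * (ft g p * cis (B p x) * complex_of_real (?e n p)))"
    proof (rule MM.integrable_prod_bound[OF integrable_mult_right[OF gauss_integrable[OF T[of n]], of "?a"] integrable_norm[OF g]])
      fix p x assume "p \<in> space M" "x \<in> space M"
      show "norm (case (p, x) of (p, x) \<Rightarrow> cnj (g x) * (ft g p * cis (B p x) * complex_of_real (?e n p)))
          \<le> ?a * ?e n p * norm (g x)"
        using mult_right_mono[OF norm_ft_le[OF g, of p], of "?e n p * norm (g x)"]
        by (simp add: norm_mult mult_ac)
    qed measurable
    have "complex_of_real (\<integral>p. (cmod (ft g p))\<^sup>2 * ?e n p \<partial>M)
       = (\<integral>p. complex_of_real ((cmod (ft g p))\<^sup>2 * ?e n p) \<partial>M)"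
      by (rule integral_complex_of_real[symmetric])
    also have "\<dots> = (\<integral>p. (\<integral>x. cnj (g x) * (ft g p * cis (B p x) * complex_of_real (?e n p)) \<partial>M) \<partial>M)"
    proof (intro Bochner_Integration.integral_cong refl)
      fix p
      have "(\<integral>x. cnj (g x) * (ft g p * cis (B p x) * complex_of_real (?e n p)) \<partial>M)
          = (\<integral>x. (ft g p * complex_of_real (?e n p)) * cnj (cis (- B p x) * g x) \<partial>M)"
        by (intro Bochner_Integration.integral_cong refl) (simp add: cis_cnj)
      also have "\<dots> = ft g p * complex_of_real (?e n p) * cnj (ft g p)"
        unfolding ft_def by (simp only: Bochner_Integration.integral_mult_right_zero Bochner_Integration.integral_cnj)
      also have "\<dots> = complex_of_real ((cmod (ft g p))\<^sup>2 * ?e n p)"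
        using complex_norm_square[of "ft g p"] by (simp add: mult_ac)
      finally show "complex_of_real ((cmod (ft g p))\<^sup>2 * ?e n p)
          = (\<integral>x. cnj (g x) * (ft g p * cis (B p x) * complex_of_real (?e n p)) \<partial>M)" ..
    qed
    also have "\<dots> = (\<integral>x. (\<integral>p. cnj (g x) * (ft g p * cis (B p x) * complex_of_real (?e n p)) \<partial>M) \<partial>M)"
      using MM.Fubini_integral[OF int] by simp
    also have "\<dots> = (\<integral>x. cnj (g x) * (complex_of_real c * (\<integral>z. g (sh (sqrt (T n)) x z) \<partial>\<gamma>)) \<partial>M)"
      using ft_gauss_inversion[OF g _ T[of n]] by (intro Bochner_Integration.integral_cong refl) simp
    finally show ?thesis .
  qed
  have "(\<lambda>n. \<integral>x. cnj (g x) * (complex_of_real c * (\<integral>z. g (sh (sqrt (T n)) x z) \<partial>\<gamma>)) \<partial>M)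
     \<longlonglongrightarrow> (\<integral>x. cnj (g x) * (complex_of_real c * g x) \<partial>M)"
  proof (rule integral_dominated_convergence[where w="\<lambda>x. cmod (g x) * (c * b)"])
    \<comment> \<open>Each single map \<open>sh r x\<close> is known to be measurable, but not its
      dependence on \<open>x\<close>. Measurability in \<open>x\<close> is therefore read off from
      the equivalent integral over \<open>p\<close>.\<close>
    show "(\<lambda>x. cnj (g x) * (complex_of_real c * (\<integral>z. g (sh (sqrt (T n)) x z) \<partial>\<gamma>))) \<in> borel_measurable M" for n
    proof (subst measurable_cong)
      show "cnj (g x) * (complex_of_real c * (\<integral>z. g (sh (sqrt (T n)) x z) \<partial>\<gamma>))
         = cnj (g x) * (\<integral>p. ft g p * cis (B p x) * complex_of_real (?e n p) \<partial>M)" if "x \<in> space M" for x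
        using ft_gauss_inversion[OF g that T[of n]] by simp
      show "(\<lambda>x. cnj (g x) * (\<integral>p. ft g p * cis (B p x) * complex_of_real (?e n p) \<partial>M)) \<in> borel_measurable M"
        by measurable
    qed
    show "AE x in M. (\<lambda>n. cnj (g x) * (complex_of_real c * (\<integral>z. g (sh (sqrt (T n)) x z) \<partial>\<gamma>)))
        \<longlonglongrightarrow> cnj (g x) * (complex_of_real c * g x)"
      unfolding T_def
      by (intro AE_I2 tendsto_mult tendsto_const gauss_average_tendsto[OF _ _ bd] cont gm)
    show "AE x in M. cmod (cnj (g x) * (complex_of_real c * (\<integral>z. g (sh (sqrt (T n)) x z) \<partial>\<gamma>))) \<le> cmod (g x) * (c * b)" for n
    proof (rule AE_I2)
      fix x assume x: "x \<in> space M"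
      have sm: "sh (sqrt (T n)) x \<in> measurable \<gamma> M"
        using sh_measurable[OF x] by simp
      have "cmod (\<integral>z. g (sh (sqrt (T n)) x z) \<partial>\<gamma>) \<le> (\<integral>z. b \<partial>\<gamma>)"
        by (intro norm_integral_le bd measurable_space[OF sm]) simp_all
      then have "cmod (\<integral>z. g (sh (sqrt (T n)) x z) \<partial>\<gamma>) \<le> b" by (simp add: gauss.prob_space)
      then show "cmod (cnj (g x) * (complex_of_real c * (\<integral>z. g (sh (sqrt (T n)) x z) \<partial>\<gamma>))) \<le> cmod (g x) * (c * b)"
        using c_pos by (auto simp: norm_mult norm_power simp del: of_real_power intro!: mult_left_mono)
    qed
    show "integrable M (\<lambda>x. cmod (g x) * (c * b))"
      using g by simp
  qed measurable
  moreover have "(\<integral>x. cnj (g x) * (complex_of_real c * g x) \<partial>M) = complex_of_real (\<integral>x. c * (cmod (g x))\<^sup>2 \<partial>M)"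
    unfolding integral_complex_of_real[symmetric]
    by (intro Bochner_Integration.integral_cong refl) (simp add: complex_norm_square mult_ac del: of_real_power)
  ultimately have "(\<lambda>n. \<integral>p. (cmod (ft g p))\<^sup>2 * ?e n p \<partial>M) \<longlonglongrightarrow> (\<integral>x. c * (cmod (g x))\<^sup>2 \<partial>M)"
    unfolding step[symmetric] by (simp add: tendsto_of_real_iff del: Bochner_Integration.integral_mult_right_zero)
  then have lim1: "(\<lambda>n. ennreal (\<integral>p. (cmod (ft g p))\<^sup>2 * ?e n p \<partial>M)) \<longlonglongrightarrow> ennreal (\<integral>x. c * (cmod (g x))\<^sup>2 \<partial>M)"
    by (rule tendsto_ennrealI)
  have eq: "ennreal (\<integral>p. (cmod (ft g p))\<^sup>2 * ?e n p \<partial>M) = (\<integral>\<^sup>+p. ennreal ((cmod (ft g p))\<^sup>2 * ?e n p) \<partial>M)" for n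
    by (intro nn_integral_eq_integral[symmetric] reg) auto
  have lim2: "(\<lambda>n. \<integral>\<^sup>+p. ennreal ((cmod (ft g p))\<^sup>2 * ?e n p) \<partial>M) \<longlonglongrightarrow> (\<integral>\<^sup>+p. ennreal ((cmod (ft g p))\<^sup>2) \<partial>M)"
  proof (rule nn_integral_LIMSEQ)
    show "incseq (\<lambda>n p. ennreal ((cmod (ft g p))\<^sup>2 * ?e n p))"
    proof (intro incseq_SucI le_funI ennreal_leI mult_left_mono)
      fix n p
      have "T (Suc n) \<le> T n" by (simp add: T_def field_simps)
      then show "?e n p \<le> ?e (Suc n) p"
        using B_nonneg[of p] by (simp add: mult_right_mono)
    qed simp
    show "(\<lambda>n. ennreal ((cmod (ft g p))\<^sup>2 * ?e n p)) \<longlonglongrightarrow> ennreal ((cmod (ft g p))\<^sup>2)" for p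
      using tendsto_mult_left[OF Tt, of "(cmod (ft g p))\<^sup>2" p] by (intro tendsto_ennrealI) simp
  qed measurable
  have "(\<integral>\<^sup>+p. ennreal ((cmod (ft g p))\<^sup>2) \<partial>M) = ennreal (\<integral>x. c * (cmod (g x))\<^sup>2 \<partial>M)"
    by (rule LIMSEQ_unique[OF lim2 lim1[unfolded eq]])
  also have "\<dots> = (\<integral>\<^sup>+x. ennreal (c * (cmod (g x))\<^sup>2) \<partial>M)"
  proof (rule nn_integral_eq_integral[symmetric])
    show "integrable M (\<lambda>x. c * (cmod (g x))\<^sup>2)"
    proof (rule Bochner_Integration.integrable_bound[OF integrable_mult_right[OF integrable_norm[OF g], of "c * b"]])
      show "AE x in M. norm (c * (cmod (g x))\<^sup>2) \<le> norm (c * b * norm (g x))"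
        using bd c_pos by (intro AE_I2) (fastforce simp: power2_eq_square abs_mult intro!: mult_right_mono order_trans[OF bd abs_ge_self])
    qed measurable
  qed (use c_pos in auto)
  also have "\<dots> = ennreal c * (\<integral>\<^sup>+x. ennreal ((cmod (g x))\<^sup>2) \<partial>M)"
    using c_pos by (simp add: ennreal_mult nn_integral_cmult)
  finally show ?thesis .
qed

end

subsection \<open>The two Fourier transforms and the Sobolev norm\<close>

interpretation lb: product_sigma_finite "\<lambda>_::'i. lborel :: 'a::euclidean_space measure" ..

lemma lborel_integral_prod:
  fixes f :: "'a::euclidean_space \<Rightarrow> real \<Rightarrow> complex"
  assumes f: "\<And>b. b \<in> Basis \<Longrightarrow> integrable lborel (f b)"
  shows "integrable lborel (\<lambda>x::'a. \<Prod>b\<in>Basis. f b (x \<bullet> b))"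
    and "(\<integral>x. (\<Prod>b\<in>Basis. f b ((x::'a) \<bullet> b)) \<partial>lborel) = (\<Prod>b\<in>Basis. (\<integral>t. f b t \<partial>lborel))"
proof -
  have [measurable]: "f b \<in> borel_measurable borel" if "b \<in> Basis" for b
    using f[OF that] by auto
  let ?g = "\<lambda>y :: 'a \<Rightarrow> real. \<Sum>b\<in>Basis. y b *\<^sub>R b"
  have coord: "(\<Prod>b\<in>Basis. f b (?g y \<bullet> b)) = (\<Prod>b\<in>Basis. f b (y b))" for y
    by (intro prod.cong refl arg_cong2[where f=f])
       (simp add: inner_sum_left inner_Basis if_distrib[of "(*) _"] cong: if_cong)
  have [measurable]: "(\<lambda>x::'a. \<Prod>b\<in>Basis. f b (x \<bullet> b)) \<in> borel_measurable borel"
    by measurable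
  have [measurable]: "?g \<in> measurable (Pi\<^sub>M Basis (\<lambda>_. lborel)) borel" by measurable
  have "integrable (distr (Pi\<^sub>M Basis (\<lambda>_. lborel)) borel ?g) (\<lambda>x::'a. \<Prod>b\<in>Basis. f b (x \<bullet> b))
      \<longleftrightarrow> integrable (Pi\<^sub>M Basis (\<lambda>_. lborel)) (\<lambda>y. \<Prod>b\<in>Basis. f b (?g y \<bullet> b))"
    by (rule integrable_distr_eq) measurable
  also have "\<dots>"
    unfolding coord by (rule lb.product_integrable_prod) (use f in auto)
  finally show "integrable lborel (\<lambda>x::'a. \<Prod>b\<in>Basis. f b (x \<bullet> b))"
    unfolding lborel_eq[where 'a='a] by simp
  have "(\<integral>x. (\<Prod>b\<in>Basis. f b ((x::'a) \<bullet> b)) \<partial>distr (Pi\<^sub>M Basis (\<lambda>_. lborel)) borel ?g)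
      = (\<integral>y. (\<Prod>b\<in>Basis. f b (?g y \<bullet> b)) \<partial>Pi\<^sub>M Basis (\<lambda>_. lborel))"
    by (rule integral_distr) measurable
  also have "\<dots> = (\<Prod>b\<in>Basis. (\<integral>t. f b t \<partial>lborel))"
    unfolding coord by (rule lb.product_integral_prod) (use f in auto)
  finally show "(\<integral>x. (\<Prod>b\<in>Basis. f b ((x::'a) \<bullet> b)) \<partial>lborel) = (\<Prod>b\<in>Basis. (\<integral>t. f b t \<partial>lborel))"
    unfolding lborel_eq[where 'a='a] .
qed

text \<open>This is the characteristic function of the standard normal law at
  \<open>k / sqrt t\<close>, with the integration variable rescaled by
  \<open>sqrt t\<close>.\<close>

lemma gauss_ft_real:
  fixes k t :: real
  assumes t: "t > 0"
  shows "integrable lborel (\<lambda>y::real. cis (k * y) * complex_of_real (exp (- t * y\<^sup>2 / 2)))"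
    and "(\<integral>y. cis (k * y) * complex_of_real (exp (- t * y\<^sup>2 / 2)) \<partial>lborel)
       = complex_of_real (sqrt (2 * pi / t) * exp (- k\<^sup>2 / (2 * t)))"
proof -
  have int1: "integrable lborel (\<lambda>y::real. exp (- y\<^sup>2 / 2))"
    using integrable_mult_right[OF integrable_normal_density[of 1 0], of "sqrt (2 * pi)"]
    unfolding std_normal_density_def by simp
  have "integrable lborel (\<lambda>y::real. exp (- (0 + sqrt t * y)\<^sup>2 / 2))"
    using t by (intro lborel_integrable_real_affine[OF int1]) simp
  then have int: "integrable lborel (\<lambda>y::real. exp (- t * y\<^sup>2 / 2))"
    using t by (simp add: power_mult_distrib)
  show "integrable lborel (\<lambda>y::real. cis (k * y) * complex_of_real (exp (- t * y\<^sup>2 / 2)))"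
    by (rule Bochner_Integration.integrable_bound[OF int]) (auto simp: norm_mult)
  have "complex_of_real (exp (- ((k / sqrt t)\<^sup>2) / 2)) = char std_normal_distribution (k / sqrt t)"
    by (simp add: char_std_normal_distribution)
  also have "\<dots> = (\<integral>x. complex_of_real (std_normal_density x) * cis (k / sqrt t * x) \<partial>lborel)"
    unfolding char_def by (subst integral_density) (auto simp: cis_conv_exp scaleR_conv_of_real)
  also have "\<dots> = sqrt t *\<^sub>R (\<integral>x. complex_of_real (std_normal_density (0 + sqrt t * x)) * cis (k / sqrt t * (0 + sqrt t * x)) \<partial>lborel)"
    using t by (subst lborel_integral_real_affine[where c="sqrt t" and t=0]) simp_all
  also have "\<dots> = sqrt t *\<^sub>R (\<integral>x. complex_of_real (1 / sqrt (2 * pi)) * (cis (k * x) * complex_of_real (exp (- t * x\<^sup>2 / 2))) \<partial>lborel)"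
    using t by (intro arg_cong[where f="scaleR _"] Bochner_Integration.integral_cong refl)
      (simp add: std_normal_density_def power_mult_distrib mult_ac)
  also have "\<dots> = complex_of_real (sqrt t / sqrt (2 * pi)) * (\<integral>x. cis (k * x) * complex_of_real (exp (- t * x\<^sup>2 / 2)) \<partial>lborel)"
    by (simp add: scaleR_conv_of_real)
  finally have *: "complex_of_real (exp (- ((k / sqrt t)\<^sup>2) / 2)) = complex_of_real (sqrt t / sqrt (2 * pi)) *
    (\<integral>x. cis (k * x) * complex_of_real (exp (- t * x\<^sup>2 / 2)) \<partial>lborel)" (is "_ = _ * ?I") .
  have "complex_of_real (sqrt (2 * pi / t) * (sqrt t / sqrt (2 * pi))) * ?I
      = complex_of_real (sqrt (2 * pi / t) * exp (- ((k / sqrt t)\<^sup>2) / 2))"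
    unfolding of_real_mult[of "sqrt (2 * pi / t)"] * by (simp only: mult.assoc)
  moreover have "sqrt (2 * pi / t) * (sqrt t / sqrt (2 * pi)) = 1"
    using t by (simp add: real_sqrt_divide real_sqrt_mult)
  ultimately show "?I = complex_of_real (sqrt (2 * pi / t) * exp (- k\<^sup>2 / (2 * t)))"
    using t by (simp add: power_divide)
qed

lemma gauss_ft_euclidean:
  fixes k :: "'a::euclidean_space"
  assumes t: "t > 0"
  shows "integrable lborel (\<lambda>p::'a. cis (k \<bullet> p) * complex_of_real (exp (- t * (p \<bullet> p) / 2)))"
    and "(\<integral>p. cis (k \<bullet> p) * complex_of_real (exp (- t * (p \<bullet> p) / 2)) \<partial>lborel)
       = complex_of_real (sqrt (2 * pi / t) ^ DIM('a) * exp (- (k \<bullet> k) / (2 * t)))"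
proof -
  let ?f = "\<lambda>b y. cis ((k \<bullet> b) * y) * complex_of_real (exp (- t * y\<^sup>2 / 2))"
  have exp_prod: "(\<Prod>b\<in>Basis. exp (a * (p \<bullet> b)\<^sup>2)) = exp (a * (p \<bullet> p))" for a and p :: 'a
    by (simp add: exp_sum[symmetric] sum_distrib_left[symmetric] euclidean_inner[of p p] power2_eq_square)
  have cis_prod: "(\<Prod>b\<in>A. cis (a b)) = cis (\<Sum>b\<in>A. a b)" if "finite A" for a and A :: "'a set"
    using that by (induction A) (auto simp: cis_mult)
  have split: "(\<Prod>b\<in>Basis. ?f b (p \<bullet> b)) = cis (k \<bullet> p) * complex_of_real (exp (- t * (p \<bullet> p) / 2))" for p
    using exp_prod[of "- t / 2" p]
    by (simp add: prod.distrib cis_prod euclidean_inner[of k p] of_real_prod[symmetric] del: of_real_prod)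
  show "integrable lborel (\<lambda>p::'a. cis (k \<bullet> p) * complex_of_real (exp (- t * (p \<bullet> p) / 2)))"
    using lborel_integral_prod(1)[of ?f, OF gauss_ft_real(1)[OF t]] unfolding split .
  have "(\<integral>p. cis (k \<bullet> p) * complex_of_real (exp (- t * (p \<bullet> p) / 2)) \<partial>lborel)
      = (\<Prod>b\<in>(Basis::'a set). complex_of_real (sqrt (2 * pi / t) * exp (- (k \<bullet> b)\<^sup>2 / (2 * t))))"
    using lborel_integral_prod(2)[of ?f, OF gauss_ft_real(1)[OF t]] unfolding split gauss_ft_real(2)[OF t] .
  also have "\<dots> = complex_of_real (sqrt (2 * pi / t) ^ DIM('a) * exp (- (k \<bullet> k) / (2 * t)))"
    using exp_prod[of "- 1 / (2 * t)" k] unfolding of_real_prod[symmetric] prod.distrib by simp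
  finally show "(\<integral>p. cis (k \<bullet> p) * complex_of_real (exp (- t * (p \<bullet> p) / 2)) \<partial>lborel)
       = complex_of_real (sqrt (2 * pi / t) ^ DIM('a) * exp (- (k \<bullet> k) / (2 * t)))" .
qed

interpretation R: fourier_space "lborel :: 'a::euclidean_space measure" "(\<bullet>)" "\<lambda>r x z. x + r *\<^sub>R z" "DIM('a)"
proof
  show "(\<lambda>(p, x). p \<bullet> x) \<in> borel_measurable (lborel \<Otimes>\<^sub>M (lborel :: 'a measure))" by measurable
  show "(lborel::'a measure) = density (distr lborel lborel (\<lambda>z. x + r *\<^sub>R z)) (\<lambda>_. ennreal (r ^ DIM('a)))"
    if "r > 0" for r and x :: 'a
    using lborel_affine[of r x] that by (simp add: ennreal_power cong: distr_cong)
  show "integrable lborel (\<lambda>p::'a. exp (- t * (p \<bullet> p) / 2))" if "t > 0" for t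
    using integrable_norm[OF gauss_ft_euclidean(1)[OF that, of 0]] by simp
  show "(\<integral>p. cis (- sqrt t * (p \<bullet> z)) * complex_of_real (exp (- t * (p \<bullet> p) / 2)) \<partial>lborel)
        = complex_of_real (sqrt (2 * pi / t) ^ DIM('a) * exp (- (z \<bullet> z) / 2))" if "t > 0" for t and z :: 'a
  proof -
    have "sqrt t * (sqrt t * w) / t = w" for w
      using that by (simp add: mult.assoc[symmetric])
    then show ?thesis
      using gauss_ft_euclidean(2)[OF that, of "- sqrt t *\<^sub>R z"] that by (simp add: inner_commute)
  qed
  show "\<exists>z\<in>space lborel. \<forall>p::'a. p \<bullet> z = 0" by (intro bexI[of _ 0]) auto
qed (auto simp: inner_add_right)

section \<open>Configuration space as an instance of the abstract Fourier space\<close>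

definition cB :: "nat \<Rightarrow> (nat \<Rightarrow> real^'d) \<Rightarrow> (nat \<Rightarrow> real^'d) \<Rightarrow> real" where
  "cB N p x = (\<Sum>i<N. p i \<bullet> x i)"

text \<open>The restriction makes the result extensional, hence a point of the configuration space,
  even if \<open>x\<close> and \<open>z\<close> are arbitrary functions on \<open>nat\<close>;
  \<open>cfg_shift_distr\<close> uses this with a vector that is 0 away from
  \<open>i\<close>.\<close>

definition csh :: "nat \<Rightarrow> real \<Rightarrow> (nat \<Rightarrow> real^'d) \<Rightarrow> (nat \<Rightarrow> real^'d) \<Rightarrow> (nat \<Rightarrow> real^'d)" where
  "csh N r x z = (\<lambda>i\<in>{..<N}. x i + r *\<^sub>R z i)"

lemma space_cfg: "space (cfg N) = cfg_space N"
  by (simp add: cfg_def space_PiM)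

lemma sets_cfg [measurable_cong]: "sets (cfg N) = sets (PiM {..<N} (\<lambda>_. lborel))"
  by (simp add: cfg_def)

lemma measurable_cfg_coord [measurable]: "i < N \<Longrightarrow> (\<lambda>x. x i) \<in> measurable (cfg N) borel"
  using measurable_component_singleton[of i "{..<N}" "\<lambda>_. lborel"] by (simp add: cfg_def)

lemma csh_measurable [measurable]: "csh N r x \<in> measurable (cfg N) (cfg N)"
  unfolding csh_def cfg_def by measurable

text \<open>A product measure is determined by its values on boxes, and the preimage of a box under
  \<open>csh\<close> is a box. Each of the \<open>N\<close> factors contributes its own
  \<open>r ^ CARD('d)\<close>.\<close>

lemma csh_distr:
  assumes "r > 0"
  shows "cfg N = density (distr (cfg N) (cfg N) (csh N r (x :: nat \<Rightarrow> real^'d))) (\<lambda>_. ennreal (r ^ (CARD('d) * N)))"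
    (is "_ = ?P")
proof -
  have "?P = PiM {..<N} (\<lambda>_. lborel)"
  proof (rule lb.PiM_eqI)
    fix A :: "nat \<Rightarrow> (real^'d) set" assume A: "\<And>i. i \<in> {..<N} \<Longrightarrow> A i \<in> sets lborel"
    let ?A = "\<lambda>i. (\<lambda>z. x i + r *\<^sub>R z) -` A i"
    have A': "?A i \<in> sets lborel" if "i \<in> {..<N}" for i
      using measurable_sets[of "\<lambda>z. x i + r *\<^sub>R z" lborel borel "A i"] A[OF that] by simp
    have m: "PiE {..<N} A \<in> sets (cfg N)" unfolding cfg_def using A by (intro sets_PiM_I_finite) auto
    have em: "emeasure lborel (A i) = ennreal (r ^ CARD('d)) * emeasure lborel (?A i)" if "i \<in> {..<N}" for i
    proof -
      have "emeasure lborel (A i)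
          = emeasure (density (distr lborel borel (\<lambda>z. x i + r *\<^sub>R z)) (\<lambda>_. ennreal (r ^ CARD('d)))) (A i)"
        using lborel_affine[of r "x i"] assms by simp
      also have "\<dots> = ennreal (r ^ CARD('d)) * emeasure (distr lborel borel (\<lambda>z. x i + r *\<^sub>R z)) (A i)"
        using A[OF that] by (subst emeasure_density_const) auto
      also have "emeasure (distr lborel borel (\<lambda>z. x i + r *\<^sub>R z)) (A i) = emeasure lborel (?A i)"
        using A[OF that] by (subst emeasure_distr) auto
      finally show ?thesis .
    qed
    have "emeasure ?P (PiE {..<N} A) = ennreal (r ^ (CARD('d) * N)) * emeasure (cfg N) (csh N r x -` PiE {..<N} A \<inter> space (cfg N))"
      using m by (simp add: emeasure_density_const emeasure_distr csh_measurable)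
    also have "csh N r x -` PiE {..<N} A \<inter> space (cfg N) = PiE {..<N} ?A"
      by (auto simp: csh_def space_cfg PiE_iff)
    also have "emeasure (cfg N) (PiE {..<N} ?A) = (\<Prod>i<N. emeasure lborel (?A i))"
      unfolding cfg_def using A' by (intro lb.emeasure_PiM) auto
    also have "ennreal (r ^ (CARD('d) * N)) * (\<Prod>i<N. emeasure lborel (?A i)) = (\<Prod>i<N. emeasure lborel (A i))"
      using em assms by (simp add: prod.distrib power_mult ennreal_power)
    finally show "emeasure ?P (PiE {..<N} A) = (\<Prod>i<N. emeasure lborel (A i))" .
  qed (simp_all add: cfg_def)
  then show ?thesis by (simp add: cfg_def)
qed

lemma gauss_ft_cfg:
  fixes k :: "nat \<Rightarrow> real^'d"
  assumes t: "t > 0"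
  shows "integrable (cfg N) (\<lambda>p. cis (cB N k p) * complex_of_real (exp (- t * cB N p p / 2)))"
    and "(\<integral>p. cis (cB N k p) * complex_of_real (exp (- t * cB N p p / 2)) \<partial>cfg N)
       = complex_of_real (sqrt (2 * pi / t) ^ (CARD('d) * N) * exp (- cB N k k / (2 * t)))"
proof -
  let ?f = "\<lambda>i y. cis (k i \<bullet> y) * complex_of_real (exp (- t * (y \<bullet> y) / 2))"
  have exp_prod: "(\<Prod>i<N. exp (a * (p i \<bullet> p i))) = exp (a * cB N p p)" for a and p :: "nat \<Rightarrow> real^'d"
    by (simp add: exp_sum[symmetric] sum_distrib_left[symmetric] cB_def)
  have cis_prod: "(\<Prod>b\<in>A. cis (a b)) = cis (\<Sum>b\<in>A. a b)" if "finite A" for a and A :: "nat set"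
    using that by (induction A) (auto simp: cis_mult)
  have split: "(\<Prod>i<N. ?f i (p i)) = cis (cB N k p) * complex_of_real (exp (- t * cB N p p / 2))" for p
    using exp_prod[where a="- t / 2" and p=p]
    by (simp add: prod.distrib cis_prod cB_def[of N k p] of_real_prod[symmetric] del: of_real_prod)
  show "integrable (cfg N) (\<lambda>p. cis (cB N k p) * complex_of_real (exp (- t * cB N p p / 2)))"
    unfolding split[symmetric] cfg_def
    by (rule lb.product_integrable_prod) (simp_all only: finite_lessThan gauss_ft_euclidean(1)[OF t])
  have "(\<integral>p. cis (cB N k p) * complex_of_real (exp (- t * cB N p p / 2)) \<partial>cfg N)
      = (\<Prod>i<N. complex_of_real (sqrt (2 * pi / t) ^ CARD('d) * exp (- (k i \<bullet> k i) / (2 * t))))"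
  proof -
    have "(\<Prod>i<N. complex_of_real (sqrt (2 * pi / t) ^ CARD('d) * exp (- (k i \<bullet> k i) / (2 * t))))
        = (\<Prod>i<N. (\<integral>y. ?f i y \<partial>lborel))"
      unfolding gauss_ft_euclidean(2)[OF t] by simp
    then show ?thesis
      unfolding split[symmetric] cfg_def
      by (simp only:) (rule lb.product_integral_prod; simp only: finite_lessThan gauss_ft_euclidean(1)[OF t])
  qed
  also have "\<dots> = complex_of_real (sqrt (2 * pi / t) ^ (CARD('d) * N) * exp (- cB N k k / (2 * t)))"
    using exp_prod[where a="- 1 / (2 * t)" and p=k] unfolding of_real_prod[symmetric] prod.distrib by (simp add: power_mult)
  finally show "(\<integral>p. cis (cB N k p) * complex_of_real (exp (- t * cB N p p / 2)) \<partial>cfg N)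
       = complex_of_real (sqrt (2 * pi / t) ^ (CARD('d) * N) * exp (- cB N k k / (2 * t)))" .
qed

lemma sigma_finite_cfg: "sigma_finite_measure (cfg N)"
  unfolding cfg_def by (rule lb.sigma_finite) simp

interpretation C: fourier_space "cfg N :: (nat \<Rightarrow> real^'d) measure" "cB N" "csh N" "CARD('d) * N" for N
proof (rule fourier_space.intro[OF sigma_finite_cfg], unfold_locales)
  show "(\<lambda>(p, x). cB N p x) \<in> borel_measurable (cfg N \<Otimes>\<^sub>M (cfg N :: (nat \<Rightarrow> real^'d) measure))"
    unfolding cB_def by measurable
  show "cB N p p \<ge> 0" for p :: "nat \<Rightarrow> real^'d" unfolding cB_def by (intro sum_nonneg) simp
  show "cB N p (csh N r x z) = cB N p x + r * cB N p z" for p r x and z :: "nat \<Rightarrow> real^'d"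
    by (simp add: cB_def csh_def inner_add_right sum.distrib sum_distrib_left)
  show "cfg N = density (distr (cfg N) (cfg N) (csh N r (x :: nat \<Rightarrow> real^'d))) (\<lambda>_. ennreal (r ^ (CARD('d) * N)))"
    if "r > 0" for r x using csh_distr[OF that] .
  show "integrable (cfg N) (\<lambda>p :: nat \<Rightarrow> real^'d. exp (- t * cB N p p / 2))" if "t > 0" for t
    using integrable_norm[OF gauss_ft_cfg(1)[OF that, of N "\<lambda>_. 0"]] by (simp add: norm_mult)
  show "(\<integral>p. cis (- sqrt t * cB N p z) * complex_of_real (exp (- t * cB N p p / 2)) \<partial>cfg N)
        = complex_of_real (sqrt (2 * pi / t) ^ (CARD('d) * N) * exp (- cB N z z / 2))" if "t > 0" for t and z :: "nat \<Rightarrow> real^'d"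
  proof -
    have "cB N (\<lambda>i. - sqrt t *\<^sub>R z i) p = - sqrt t * cB N p z" for p
      by (simp add: cB_def inner_commute sum_distrib_left sum_negf)
    moreover have "sqrt t * (sqrt t * w) / t = w" for w
      using that by (simp add: mult.assoc[symmetric])
    ultimately show ?thesis
      using gauss_ft_cfg(2)[OF that, of N "\<lambda>i. - sqrt t *\<^sub>R z i"] that by simp
  qed
  show "\<exists>z\<in>space (cfg N). \<forall>p::nat \<Rightarrow> real^'d. cB N p z = 0"
    by (intro bexI[of _ "\<lambda>i\<in>{..<N}. 0"]) (auto simp: cB_def space_cfg)
qed (auto simp: space_cfg intro: csh_measurable)

lemma FT_eq: "FT N f p = complex_of_real ((2*pi) powr (- real (CARD('d) * N) / 2)) * C.ft N f (p :: nat \<Rightarrow> real^'d)"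
  unfolding FT_def C.ft_def cB_def by (simp add: cis_conv_exp)

section \<open>Continuous functions of bounded support on configuration space\<close>

definition supp_in :: "nat \<Rightarrow> real \<Rightarrow> ((nat \<Rightarrow> real^'d) \<Rightarrow> complex) \<Rightarrow> bool" where
  "supp_in N R f \<longleftrightarrow> (\<forall>x\<in>cfg_space N. (\<exists>i<N. norm (x i) > R) \<longrightarrow> f x = 0)"

text \<open>Precomposing with the restriction gives a function on all of
  \<open>nat \<Rightarrow> real^'d\<close> that depends on finitely many coordinates. There the
  product topology of the library applies, which opens the way to Borel measurability and to
  compactness.\<close>

lemma cont_cfg_continuous:
  fixes f :: "(nat \<Rightarrow> real^'d) \<Rightarrow> complex"
  assumes "cont_cfg N f"
  shows "continuous_on UNIV (\<lambda>x. f (restrict x {..<N}))"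
  unfolding continuous_on_topological
proof (intro ballI allI impI)
  fix x :: "nat \<Rightarrow> real^'d" and U :: "complex set"
  assume U: "open U" "f (restrict x {..<N}) \<in> U"
  then obtain e where e: "e > 0" "ball (f (restrict x {..<N})) e \<subseteq> U"
    using open_contains_ball by blast
  have "\<forall>e>0. \<exists>\<delta>>0. \<forall>y\<in>cfg_space N. (\<forall>i<N. dist (y i) (restrict x {..<N} i) < \<delta>) \<longrightarrow>
      dist (f y) (f (restrict x {..<N})) < e"
    using assms unfolding cont_cfg_def by (rule bspec) (rule restrict_PiE_iff[THEN iffD2], simp)
  from mp[OF spec[OF this] e(1)] obtain \<delta> where \<delta>: "\<delta> > 0" and **: "\<forall>y\<in>cfg_space N.
      (\<forall>i<N. dist (y i) (restrict x {..<N} i) < \<delta>) \<longrightarrow> dist (f y) (f (restrict x {..<N})) < e"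
    by (elim exE conjE)
  note * = mp[OF bspec[OF **]]
  let ?A = "\<Inter>i\<in>{..<N}. (\<lambda>y. y i) -` ball (x i) \<delta>"
  have "open ?A"
    by (intro open_INT ballI finite_lessThan open_vimage open_ball continuous_on_product_coordinates)
  moreover have "f (restrict y {..<N}) \<in> U" if "y \<in> ?A" for y
    using *[of "restrict y {..<N}"] e(2) that by (auto simp: dist_commute subset_eq)
  ultimately show "\<exists>A. open A \<and> x \<in> A \<and> (\<forall>y\<in>UNIV. y \<in> A \<longrightarrow> f (restrict y {..<N}) \<in> U)"
    using \<delta> by (intro exI[of _ ?A]) auto
qed

text \<open>The inclusion of \<open>cfg N\<close> into the full countable product is measurable,
  because coordinates beyond \<open>N\<close> are constantly \<open>undefined\<close>. On a
  countable product the Borel sets of the product topology agree with the product sigma-algebra, so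
  continuity is enough.\<close>

lemma cont_cfg_measurable:
  fixes f :: "(nat \<Rightarrow> real^'d) \<Rightarrow> complex"
  assumes "cont_cfg N f"
  shows "f \<in> borel_measurable (cfg N)"
proof -
  have "(\<lambda>x. x) \<in> measurable (cfg N) (PiM UNIV (\<lambda>_. borel :: (real^'d) measure))"
  proof (rule measurable_PiM_single')
    fix i :: nat
    show "(\<lambda>x. x i) \<in> measurable (cfg N) (borel :: (real^'d) measure)"
    proof (cases "i < N")
      case False
      then have "(\<lambda>x. x i) \<in> measurable (cfg N) (borel :: (real^'d) measure)
          \<longleftrightarrow> (\<lambda>x::nat \<Rightarrow> real^'d. undefined) \<in> measurable (cfg N) (borel :: (real^'d) measure)"
        by (intro measurable_cong) (auto simp: space_cfg PiE_def extensional_def)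
      then show ?thesis by simp
    qed measurable
  qed auto
  then have id: "(\<lambda>x. x) \<in> measurable (cfg N) (borel :: (nat \<Rightarrow> real^'d) measure)"
    by (simp cong: measurable_cong_sets add: sets_PiM_equal_borel)
  have "(\<lambda>x. f (restrict x {..<N})) \<in> borel_measurable (cfg N)"
    using measurable_compose[OF id borel_measurable_continuous_onI[OF cont_cfg_continuous[OF assms]]] .
  moreover have "(\<lambda>x. f (restrict x {..<N})) \<in> borel_measurable (cfg N) \<longleftrightarrow> f \<in> borel_measurable (cfg N)"
    by (intro measurable_cong) (auto simp: space_cfg)
  ultimately show ?thesis by simp
qed

text \<open>By Tychonoff the product of closed balls, with the singleton \<open>{undefined}\<close>
  in each coordinate beyond \<open>N\<close>, is compact; the continuous extension is bounded on it,
  and outside it \<open>f\<close> vanishes.\<close>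

lemma cont_supp_bounded:
  fixes f :: "(nat \<Rightarrow> real^'d) \<Rightarrow> complex"
  assumes f: "cont_cfg N f" "supp_in N R f"
  obtains b where "b \<ge> 0" "\<And>x. x \<in> cfg_space N \<Longrightarrow> cmod (f x) \<le> b"
proof -
  let ?S = "PiE UNIV (\<lambda>i. if i < N then cball (0 :: real^'d) R else {undefined})"
  have "compactin (product_topology (\<lambda>_. euclidean) UNIV) ?S"
    unfolding compactin_PiE by (auto simp: compactin_euclidean_iff)
  then have "compact ?S" unfolding euclidean_product_topology compactin_euclidean_iff .
  then have "compact ((\<lambda>x. f (restrict x {..<N})) ` ?S)"
    by (intro compact_continuous_image continuous_on_subset[OF cont_cfg_continuous[OF f(1)]]) auto
  then obtain b where b: "b > 0" "\<And>x. x \<in> ?S \<Longrightarrow> cmod (f (restrict x {..<N})) \<le> b"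
    using bounded_pos[of "(\<lambda>x. f (restrict x {..<N})) ` ?S"] compact_imp_bounded by auto
  have "cmod (f x) \<le> b" if x: "x \<in> cfg_space N" for x
  proof (cases "\<exists>i<N. norm (x i) > R")
    case True
    then show ?thesis using f(2) x b(1) by (auto simp: supp_in_def)
  next
    case False
    then have "x \<in> ?S" using x by (auto simp: PiE_def extensional_def not_less) (meson not_le)
    from b(2)[OF this] show ?thesis using x by simp
  qed
  with b(1) show ?thesis using that[of b] by simp
qed

lemma box_finite: "emeasure (cfg N) (PiE {..<N} (\<lambda>_. cball (0 :: real^'d) R)) < \<infinity>"
proof -
  have "emeasure (cfg N) (PiE {..<N} (\<lambda>_. cball (0 :: real^'d) R)) = (\<Prod>i<N. emeasure lborel (cball (0 :: real^'d) R))"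
    unfolding cfg_def by (intro lb.emeasure_PiM) auto
  also have "\<dots> < \<infinity>"
    using emeasure_lborel_cball_finite[of "0 :: real^'d" R]
    by (simp add: power_less_top_ennreal less_top)
  finally show ?thesis .
qed

lemma box_sets [measurable]: "PiE {..<N} (\<lambda>_. cball (0 :: real^'d) R) \<in> sets (cfg N)"
  unfolding cfg_def by (intro sets_PiM_I_finite) auto

lemma bounded_supp_integrable:
  fixes f :: "(nat \<Rightarrow> real^'d) \<Rightarrow> 'b::{banach, second_countable_topology}"
  assumes [measurable]: "f \<in> borel_measurable (cfg N)"
    and bd: "\<And>x. x \<in> cfg_space N \<Longrightarrow> norm (f x) \<le> b"
    and supp: "\<And>x. x \<in> cfg_space N \<Longrightarrow> \<exists>i<N. norm (x i) > R \<Longrightarrow> f x = 0"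
  shows "integrable (cfg N) f"
proof (rule Bochner_Integration.integrable_bound)
  let ?S = "PiE {..<N} (\<lambda>_. cball (0 :: real^'d) R)"
  show "integrable (cfg N) (\<lambda>x. b * indicator ?S x :: real)"
    using box_finite[of N R] by (intro integrable_mult_right integrable_real_indicator) auto
  show "AE x in cfg N. norm (f x) \<le> norm (b * indicator ?S x :: real)"
  proof (rule AE_I2)
    fix x :: "nat \<Rightarrow> real^'d" assume x: "x \<in> space (cfg N)"
    show "norm (f x) \<le> norm (b * indicator ?S x :: real)"
    proof (cases "x \<in> ?S")
      case True
      then show ?thesis using bd[of x] x by (auto simp: space_cfg)
    next
      case False
      then have "\<exists>i<N. norm (x i) > R" using x by (auto simp: space_cfg PiE_iff not_le)
      then show ?thesis using supp x by (simp add: space_cfg)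
    qed
  qed
qed simp

lemma cont_supp_integrable:
  assumes f: "cont_cfg N f" "supp_in N R f"
  shows "integrable (cfg N) f" and "integrable (cfg N) (\<lambda>x. (cmod (f x))\<^sup>2)"
proof -
  note [measurable] = cont_cfg_measurable[OF f(1)]
  obtain b where b: "b \<ge> 0" "\<And>x. x \<in> cfg_space N \<Longrightarrow> cmod (f x) \<le> b"
    using cont_supp_bounded[OF f] by blast
  show "integrable (cfg N) f"
    using f(2) b by (intro bounded_supp_integrable[where b=b and R=R]) (auto simp: supp_in_def)
  show "integrable (cfg N) (\<lambda>x. (cmod (f x))\<^sup>2)"
    using f(2) b by (intro bounded_supp_integrable[where b="b\<^sup>2" and R=R]) (auto simp: supp_in_def intro!: power_mono)
qed

lemma cfg_radial_tendsto:
  assumes f: "cont_cfg N f" and x: "x \<in> cfg_space N"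
    and y: "\<And>n. y n \<in> cfg_space N" "\<And>i. i < N \<Longrightarrow> (\<lambda>n. y n i) \<longlonglongrightarrow> x i"
  shows "(\<lambda>n. f (y n)) \<longlonglongrightarrow> f (x :: nat \<Rightarrow> real^'d)"
proof (rule tendstoI)
  fix e :: real assume e: "e > 0"
  have "\<forall>e>0. \<exists>\<delta>>0. \<forall>y\<in>cfg_space N. (\<forall>i<N. dist (y i) (x i) < \<delta>) \<longrightarrow> dist (f y) (f x) < e"
    using f unfolding cont_cfg_def by (rule bspec[OF _ x])
  from mp[OF spec[OF this] e] obtain \<delta> where \<delta>: "\<delta> > 0" and **: "\<forall>y\<in>cfg_space N.
      (\<forall>i<N. dist (y i) (x i) < \<delta>) \<longrightarrow> dist (f y) (f x) < e"
    by (elim exE conjE)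
  note * = mp[OF bspec[OF **]]
  have "\<forall>\<^sub>F n in sequentially. \<forall>i\<in>{..<N}. dist (y n i) (x i) < \<delta>"
    using y(2) \<delta> by (intro eventually_ball_finite) (auto intro: tendstoD)
  then show "\<forall>\<^sub>F n in sequentially. dist (f (y n)) (f x) < e"
    by eventually_elim (use * y(1) in auto)
qed

lemma csh_tendsto:
  assumes "i < N"
  shows "(\<lambda>n. csh N (sqrt (1 / real (Suc n))) x z i) \<longlonglongrightarrow> x i"
proof -
  have "(\<lambda>n. x i + sqrt (1 / real (Suc n)) *\<^sub>R z i) \<longlonglongrightarrow> x i + sqrt 0 *\<^sub>R z i"
    by (intro tendsto_intros LIMSEQ_Suc lim_1_over_n)
  then show ?thesis using assms by (simp add: csh_def)
qed

lemma csh_space: "csh N r x z \<in> cfg_space N"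
  by (simp add: csh_def restrict_PiE_iff)

lemma cont_radial: "cont_cfg N f \<Longrightarrow> x \<in> space (cfg N) \<Longrightarrow> C.radial_cont N f x"
  unfolding C.radial_cont_def space_cfg
proof (intro ballI)
  fix z assume "cont_cfg N f" and x: "x \<in> cfg_space N"
  then show "(\<lambda>n. f (csh N (sqrt (1 / real (Suc n))) x z)) \<longlonglongrightarrow> f x"
    by (rule cfg_radial_tendsto) (rule csh_space, rule csh_tendsto)
qed

lemma cont_plancherel:
  fixes f :: "(nat \<Rightarrow> real^'d) \<Rightarrow> complex"
  assumes f: "cont_cfg N f" "supp_in N R f"
  shows "(\<integral>\<^sup>+p. ennreal ((cmod (C.ft N f p))\<^sup>2) \<partial>cfg N)
     = ennreal ((2 * pi) ^ (CARD('d) * N)) * (\<integral>\<^sup>+x. ennreal ((cmod (f x))\<^sup>2) \<partial>cfg N)"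
proof -
  obtain b where "b \<ge> 0" "\<And>x. x \<in> cfg_space N \<Longrightarrow> cmod (f x) \<le> b"
    using cont_supp_bounded[OF f] by blast
  then show ?thesis
    by (intro C.ft_plancherel[OF cont_supp_integrable(1)[OF f], of b] cont_radial f(1)) (auto simp: space_cfg)
qed

section \<open>One-particle shifts, derivatives and moments of the transform\<close>

lemma cfg_shift_distr:
  assumes i: "i < N"
  shows "distr (cfg N) (cfg N) (\<lambda>x. x(i := x i + a)) = (cfg N :: (nat \<Rightarrow> real^'d) measure)"
proof -
  let ?v = "\<lambda>j. if j = i then a else 0"
  have "distr (cfg N) (cfg N) (\<lambda>x. x(i := x i + a)) = distr (cfg N) (cfg N) (csh N 1 ?v)"
    using i by (intro distr_cong refl) (auto simp: space_cfg csh_def PiE_def extensional_def fun_eq_iff)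
  also have "\<dots> = density (distr (cfg N) (cfg N) (csh N 1 ?v)) (\<lambda>_. ennreal (1 ^ (CARD('d) * N)))"
    by (simp add: density_1)
  also have "\<dots> = cfg N" by (rule csh_distr[symmetric]) simp
  finally show ?thesis .
qed

lemma cfg_shift_measurable: "i < N \<Longrightarrow> (\<lambda>x. x(i := x i + a)) \<in> measurable (cfg N) (cfg N)"
proof -
  assume i: "i < N"
  have "(\<lambda>x. x(i := x i + a)) \<in> measurable (cfg N) (cfg N) \<longleftrightarrow>
      csh N 1 (\<lambda>j. if j = i then a else 0) \<in> measurable (cfg N) (cfg N)"
    using i by (intro measurable_cong) (auto simp: space_cfg csh_def PiE_def extensional_def fun_eq_iff)
  then show ?thesis by simp
qed

lemma integral_cfg_shift:
  fixes f :: "(nat \<Rightarrow> real^'d) \<Rightarrow> 'b::{banach, second_countable_topology}"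
  assumes "i < N" "f \<in> borel_measurable (cfg N)"
  shows "(\<integral>x. f (x(i := x i + a)) \<partial>cfg N) = (\<integral>x. f x \<partial>cfg N)"
  using integral_distr[OF cfg_shift_measurable[OF assms(1), of a] assms(2)]
  by (simp add: cfg_shift_distr[OF assms(1)])

lemma integrable_cfg_shift:
  fixes f :: "(nat \<Rightarrow> real^'d) \<Rightarrow> 'b::{banach, second_countable_topology}"
  assumes "i < N" "integrable (cfg N) f"
  shows "integrable (cfg N) (\<lambda>x. f (x(i := x i + a)))"
  using integrable_distr_eq[OF cfg_shift_measurable[OF assms(1), of a], of f] assms(2)
  by (simp add: cfg_shift_distr[OF assms(1)])

lemma ft_shift:
  fixes f :: "(nat \<Rightarrow> real^'d) \<Rightarrow> complex"
  assumes i: "i < N" and [measurable]: "f \<in> borel_measurable (cfg N)"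
  shows "C.ft N (\<lambda>x. f (x(i := x i + a))) p = cis (p i \<bullet> a) * C.ft N f p"
proof -
  have B: "cB N p (x(i := x i + a)) = cB N p x + p i \<bullet> a" for x :: "nat \<Rightarrow> real^'d"
  proof -
    have "cB N p (x(i := x i + a)) = (\<Sum>j<N. p j \<bullet> x j + (if j = i then p i \<bullet> a else 0))"
      unfolding cB_def by (intro sum.cong refl) (auto simp: inner_add_right)
    then show ?thesis using i by (simp add: sum.distrib cB_def)
  qed
  have [measurable]: "(\<lambda>x. cB N p x) \<in> borel_measurable (cfg N)"
    unfolding cB_def by measurable
  have "C.ft N (\<lambda>x. f (x(i := x i + a))) p
      = (\<integral>x. cis (p i \<bullet> a) * (cis (- cB N p (x(i := x i + a))) * f (x(i := x i + a))) \<partial>cfg N)"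
    unfolding C.ft_def B
    by (intro Bochner_Integration.integral_cong refl) (simp add: mult.assoc[symmetric] cis_mult)
  also have "\<dots> = cis (p i \<bullet> a) * (\<integral>x. cis (- cB N p (x(i := x i + a))) * f (x(i := x i + a)) \<partial>cfg N)"
    by simp
  also have "(\<integral>x. cis (- cB N p (x(i := x i + a))) * f (x(i := x i + a)) \<partial>cfg N) = C.ft N f p"
    unfolding C.ft_def by (rule integral_cfg_shift[OF i]) measurable
  finally show ?thesis .
qed

lemma smooth_cfg_cont: "smooth_cfg N f \<Longrightarrow> cont_cfg N f"
  by (erule smooth_cfg.cases) simp

lemma smooth_cfg_deriv:
  assumes "smooth_cfg N f" "i < N"
  shows "\<exists>g. smooth_cfg N g \<and> (\<forall>x\<in>cfg_space N.
    ((\<lambda>t::real. f (x(i := x i + t *\<^sub>R axis k 1))) has_vector_derivative g x) (at 0))"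
proof -
  from assms(1) have "\<forall>i<N. \<forall>k. \<exists>g. smooth_cfg N g \<and> (\<forall>x\<in>cfg_space N.
    ((\<lambda>t::real. f (x(i := x i + t *\<^sub>R axis k 1))) has_vector_derivative g x) (at 0))"
    by (rule smooth_cfg.cases) (erule ssubst, assumption)
  then show ?thesis by (rule allE[where x=i]) (use assms(2) in simp)
qed

lemma deriv_difference_quotient:
  fixes h :: "real \<Rightarrow> complex"
  assumes "(h has_vector_derivative v) (at 0)"
  shows "(\<lambda>n. (h (1 / real (Suc n)) - h 0) / complex_of_real (1 / real (Suc n))) \<longlonglongrightarrow> v"
proof -
  have "((\<lambda>t. (h t - h 0) /\<^sub>R t) \<longlongrightarrow> v) (at 0)"
  proof -
    have "((\<lambda>t. norm (h (0 + t) - h 0 - t *\<^sub>R v) / norm t) \<longlongrightarrow> 0) (at 0)"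
      using assms unfolding has_vector_derivative_def has_derivative_at by simp
    then have "((\<lambda>t. norm ((h t - h 0) /\<^sub>R t - v)) \<longlongrightarrow> 0) (at 0)"
    proof (rule Lim_transform_eventually)
      show "\<forall>\<^sub>F t in at 0. norm (h (0 + t) - h 0 - t *\<^sub>R v) / norm t = norm ((h t - h 0) /\<^sub>R t - v)"
      proof (rule eventually_at_filter[THEN iffD2], intro always_eventually allI impI)
        fix t :: real assume "t \<noteq> 0"
        then have "(h t - h 0) /\<^sub>R t - v = (h t - h 0 - t *\<^sub>R v) /\<^sub>R t"
          by (simp add: scaleR_diff_right)
        then show "norm (h (0 + t) - h 0 - t *\<^sub>R v) / norm t = norm ((h t - h 0) /\<^sub>R t - v)"
          by (simp add: divide_inverse mult.commute)
      qed
    qed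
    then show ?thesis using LIM_zero_iff tendsto_norm_zero_iff by blast
  qed
  moreover have "filterlim (\<lambda>n. 1 / real (Suc n)) (at 0) sequentially"
    unfolding filterlim_at using LIMSEQ_Suc[OF lim_1_over_n] by (auto simp del: of_nat_Suc)
  ultimately have "(\<lambda>n. (h (1 / real (Suc n)) - h 0) /\<^sub>R (1 / real (Suc n))) \<longlonglongrightarrow> v"
    by (rule filterlim_compose)
  then show ?thesis by (simp add: scaleR_conv_of_real divide_inverse mult.commute)
qed

text \<open>Partial derivatives in \<open>smooth_cfg\<close> are given only at parameter 0 of the
  line through each point. Moving the base point along the line gives the derivative at every
  parameter, as the mean value bound in \<open>ft_deriv\<close> requires.\<close>

lemma has_vector_derivative_translate:
  fixes h :: "real \<Rightarrow> complex"
  assumes "((\<lambda>s. h (t + s)) has_vector_derivative v) (at 0)"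
  shows "(h has_vector_derivative v) (at t)"
proof -
  have "((\<lambda>u. u - t) has_vector_derivative 1) (at t)"
    by (auto intro!: derivative_eq_intros)
  moreover have "((\<lambda>s. h (t + s)) has_vector_derivative v) (at (t - t))"
    using assms by simp
  ultimately have "((\<lambda>s. h (t + s)) \<circ> (\<lambda>u. u - t) has_vector_derivative (1 *\<^sub>R v)) (at t)"
    by (rule vector_diff_chain_at)
  then show ?thesis by (simp add: o_def)
qed

text \<open>If \<open>norm (x j)\<close> exceeds \<open>R\<close>, a displacement of length less
  than \<open>norm (x j) - R\<close> leaves the configuration in the region where \<open>f\<close>
  is 0, so \<open>f\<close> is locally constant along the line.\<close>

lemma supp_in_deriv:
  fixes f g :: "(nat \<Rightarrow> real^'d) \<Rightarrow> complex"
  assumes i: "i < N" and supp: "supp_in N R f"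
    and d: "\<And>x. x \<in> cfg_space N \<Longrightarrow> ((\<lambda>t::real. f (x(i := x i + t *\<^sub>R axis k 1))) has_vector_derivative g x) (at 0)"
  shows "supp_in N R g"
  unfolding supp_in_def
proof (intro ballI impI)
  fix x :: "nat \<Rightarrow> real^'d" assume x: "x \<in> cfg_space N" and "\<exists>j<N. R < norm (x j)"
  then obtain j where j: "j < N" "R < norm (x j)" by auto
  have "((\<lambda>t::real. f (x(i := x i + t *\<^sub>R axis k 1))) has_vector_derivative 0) (at 0)"
  proof (rule has_vector_derivative_transform_within)
    show "((\<lambda>t::real. 0 :: complex) has_vector_derivative 0) (at 0)" by simp
    show "norm (x j) - R > 0" using j by simp
    fix t :: real assume "dist t 0 < norm (x j) - R"
    then have t: "\<bar>t\<bar> < norm (x j) - R" by simp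
    have "norm ((x(i := x i + t *\<^sub>R axis k 1)) j) > R"
    proof (cases "j = i")
      case True
      have "norm (x i) \<le> norm (x i + t *\<^sub>R axis k 1) + norm (t *\<^sub>R axis k (1::real))"
        using norm_triangle_ineq4[of "x i + t *\<^sub>R axis k 1" "t *\<^sub>R axis k 1"] by simp
      then show ?thesis using True t by (simp add: norm_axis_1)
    qed (use j in simp)
    then show "0 = f (x(i := x i + t *\<^sub>R axis k 1))"
      using supp x i j(1) unfolding supp_in_def
      by (metis PiE_fun_upd UNIV_I insert_absorb lessThan_iff)
  qed simp
  then show "g x = 0" using vector_derivative_unique_at d[OF x] by blast
qed

text \<open>Difference quotients replace integration by parts. By \<open>ft_shift\<close> the
  transform of a quotient is an explicit multiple of that of \<open>f\<close>, and the quotients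
  converge to \<open>g\<close> boundedly, by the mean value inequality, on a common bounded
  support.\<close>

lemma ft_deriv:
  fixes f g :: "(nat \<Rightarrow> real^'d) \<Rightarrow> complex"
  assumes i: "i < N" and f: "cont_cfg N f" "supp_in N R f" and g: "cont_cfg N g"
    and d: "\<And>x. x \<in> cfg_space N \<Longrightarrow> ((\<lambda>t::real. f (x(i := x i + t *\<^sub>R axis k 1))) has_vector_derivative g x) (at 0)"
  shows "C.ft N g p = \<i> * complex_of_real (p i $ k) * C.ft N f p"
proof -
  let ?e = "axis k 1 :: real^'d"
  define t where "t n = 1 / real (Suc n)" for n
  have t: "0 < t n" "t n \<le> 1" for n by (auto simp: t_def)
  have sg: "supp_in N R g" using supp_in_deriv[OF i f(2) d] .
  have up: "x(i := x i + a) \<in> cfg_space N" if "x \<in> cfg_space N" for x :: "nat \<Rightarrow> real^'d" and a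
    using that i by (auto simp: PiE_def extensional_def)
  obtain b where b: "b \<ge> 0" "\<And>x. x \<in> cfg_space N \<Longrightarrow> cmod (g x) \<le> b"
    using cont_supp_bounded[OF g sg] by blast
  note [measurable] = cont_cfg_measurable[OF f(1)] cont_cfg_measurable[OF g]
  define D where "D n x = (f (x(i := x i + t n *\<^sub>R ?e)) - f x) / complex_of_real (t n)" for n x
  have [measurable]: "D n \<in> borel_measurable (cfg N)" for n
    unfolding D_def using measurable_compose[OF cfg_shift_measurable[OF i] cont_cfg_measurable[OF f(1)]] by measurable
  have Dlim: "(\<lambda>n. D n x) \<longlonglongrightarrow> g x" if "x \<in> cfg_space N" for x
    using deriv_difference_quotient[OF d[OF that]] by (simp add: D_def t_def del: of_nat_Suc)
  have Dbd: "cmod (D n x) \<le> b" if x: "x \<in> cfg_space N" for n x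
  proof -
    let ?h = "\<lambda>s. f (x(i := x i + s *\<^sub>R ?e))"
    have hd: "(?h has_vector_derivative g (x(i := x i + s *\<^sub>R ?e))) (at s)" for s
    proof (rule has_vector_derivative_translate)
      have "?h (s + u) = f ((x(i := x i + s *\<^sub>R ?e))(i := (x(i := x i + s *\<^sub>R ?e)) i + u *\<^sub>R ?e))" for u
        by (simp only: fun_upd_upd fun_upd_same scaleR_add_left add.assoc)
      then show "((\<lambda>u. ?h (s + u)) has_vector_derivative g (x(i := x i + s *\<^sub>R ?e))) (at 0)"
        using d[OF up[OF x, of "s *\<^sub>R ?e"]] by simp
    qed
    have "continuous_on {0..t n} ?h"
      by (intro continuous_at_imp_continuous_on ballI has_vector_derivative_continuous[OF hd])
    then obtain s where "norm (?h (t n) - ?h 0) \<le> norm ((t n - 0) *\<^sub>R g (x(i := x i + s *\<^sub>R ?e)))"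
      using mvt_general[OF t(1)[of n], of ?h "\<lambda>s u. u *\<^sub>R g (x(i := x i + s *\<^sub>R ?e))"] hd
      unfolding has_vector_derivative_def by auto
    also have "\<dots> \<le> t n * b" using t[of n] b(2)[OF up[OF x]] by (simp add: mult_left_mono)
    finally show ?thesis using t[of n] by (simp add: D_def norm_divide field_simps)
  qed
  \<comment> \<open>A step has length at most 1, so enlarging the radius from \<open>R\<close> to
    \<open>R + 1\<close> covers all quotients at once.\<close>
  have Dsupp: "D n x = 0" if x: "x \<in> cfg_space N" and ex: "\<exists>j<N. norm (x j) > R + 1" for n x
  proof -
    obtain j where j: "j < N" "norm (x j) > R + 1" using ex by blast
    have "norm (x i) \<le> norm (x i + t n *\<^sub>R ?e) + norm (t n *\<^sub>R ?e)"
      using norm_triangle_ineq4[of "x i + t n *\<^sub>R ?e" "t n *\<^sub>R ?e"] by simp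
    then have "norm ((x(i := x i + t n *\<^sub>R ?e)) j) > R"
      using j t[of n] by (auto simp: norm_axis_1)
    then have "f (x(i := x i + t n *\<^sub>R ?e)) = 0" "f x = 0"
      using f(2) up[OF x] x j unfolding supp_in_def by (blast, force)
    then show ?thesis by (simp add: D_def)
  qed
  have "(\<lambda>n. C.ft N (D n) p) \<longlonglongrightarrow> C.ft N g p"
    unfolding C.ft_def
  proof (rule integral_dominated_convergence)
    let ?S = "PiE {..<N} (\<lambda>_. cball (0 :: real^'d) (R + 1))"
    have [measurable]: "(\<lambda>x. cB N p x) \<in> borel_measurable (cfg N)"
      unfolding cB_def by measurable
    show "integrable (cfg N) (\<lambda>x. b * indicator ?S x :: real)"
      using box_finite[of N "R + 1"] by (intro integrable_mult_right integrable_real_indicator) auto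
    show "(\<lambda>x. cis (- cB N p x) * g x) \<in> borel_measurable (cfg N)"
       "(\<lambda>x. cis (- cB N p x) * D n x) \<in> borel_measurable (cfg N)" for n by measurable
    show "AE x in cfg N. (\<lambda>n. cis (- cB N p x) * D n x) \<longlonglongrightarrow> cis (- cB N p x) * g x"
      by (intro AE_I2 tendsto_intros Dlim) (simp add: space_cfg)
    show "AE x in cfg N. norm (cis (- cB N p x) * D n x) \<le> b * indicator ?S x" for n
    proof (rule AE_I2)
      fix x :: "nat \<Rightarrow> real^'d" assume "x \<in> space (cfg N)"
      then have x: "x \<in> cfg_space N" by (simp add: space_cfg)
      show "norm (cis (- cB N p x) * D n x) \<le> b * indicator ?S x"
      proof (cases "x \<in> ?S")
        case False
        then have "\<exists>i<N. norm (x i) > R + 1" using x by (auto simp: PiE_iff not_le)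
        then show ?thesis using Dsupp x False by simp
      qed (use Dbd x in \<open>simp add: norm_mult\<close>)
    qed
  qed
  moreover have "C.ft N (D n) p = (cis (p i $ k * t n) - 1) / complex_of_real (t n) * C.ft N f p" for n
  proof -
    have int: "integrable (cfg N) (\<lambda>x. cis (- cB N p x) * h x)" if h: "integrable (cfg N) h" for h :: "(nat \<Rightarrow> real^'d) \<Rightarrow> complex"
    proof (rule Bochner_Integration.integrable_bound[OF integrable_norm[OF h]])
      have [measurable]: "(\<lambda>x. cB N p x) \<in> borel_measurable (cfg N)"
        unfolding cB_def by measurable
      show "(\<lambda>x. cis (- cB N p x) * h x) \<in> borel_measurable (cfg N)"
        using h by measurable
    qed (simp add: norm_mult)
    have "C.ft N (D n) p = (C.ft N (\<lambda>x. f (x(i := x i + t n *\<^sub>R ?e))) p - C.ft N f p) / complex_of_real (t n)"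
      unfolding C.ft_def D_def
      using int[OF integrable_cfg_shift[OF i cont_supp_integrable(1)[OF f]], of "t n *\<^sub>R ?e"]
        int[OF cont_supp_integrable(1)[OF f]]
      by (simp add: right_diff_distrib[symmetric] Bochner_Integration.integral_diff[symmetric] del: Bochner_Integration.integral_diff)
    also have "\<dots> = (cis (p i $ k * t n) - 1) / complex_of_real (t n) * C.ft N f p"
      unfolding ft_shift[OF i cont_cfg_measurable[OF f(1)]]
      by (simp add: inner_axis algebra_simps)
    finally show ?thesis .
  qed
  moreover have "(\<lambda>n. (cis (p i $ k * t n) - 1) / complex_of_real (t n) * C.ft N f p)
      \<longlonglongrightarrow> \<i> * complex_of_real (p i $ k) * C.ft N f p"
  proof -
    have "((\<lambda>s. cis (p i $ k * s)) has_vector_derivative (\<i> * complex_of_real (p i $ k))) (at 0)"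
      unfolding cis_conv_exp of_real_mult
      by (auto intro!: derivative_eq_intros has_vector_derivative_real_field)
    from deriv_difference_quotient[OF this]
    show ?thesis unfolding t_def by (intro tendsto_mult_right) simp
  qed
  ultimately show ?thesis using LIMSEQ_unique by simp
qed

text \<open>Smoothness is coinductive: every derivative arrives with its own smoothness, so the
  induction on \<open>m\<close> can differentiate again along the same coordinate.\<close>

lemma smooth_iterated_ft:
  fixes f :: "(nat \<Rightarrow> real^'d) \<Rightarrow> complex"
  assumes f: "smooth_cfg N f" "supp_in N R f" and i: "i < N"
  shows "\<exists>g. smooth_cfg N g \<and> supp_in N R g \<and> (\<forall>p. C.ft N g p = (\<i> * complex_of_real (p i $ k)) ^ m * C.ft N f p)"
proof (induction m)
  case 0
  then show ?case using f by auto
next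
  case (Suc m)
  then obtain g where g: "smooth_cfg N g" "supp_in N R g" "\<And>p. C.ft N g p = (\<i> * complex_of_real (p i $ k)) ^ m * C.ft N f p"
    by auto
  from smooth_cfg_deriv[OF g(1) i, of k] obtain h where h: "smooth_cfg N h"
    "\<And>x. x \<in> cfg_space N \<Longrightarrow> ((\<lambda>t::real. g (x(i := x i + t *\<^sub>R axis k 1))) has_vector_derivative h x) (at 0)"
    by (elim exE conjE) (rule that, assumption, erule (1) bspec)
  have "C.ft N h p = (\<i> * complex_of_real (p i $ k)) ^ Suc m * C.ft N f p" for p
    using ft_deriv[OF i smooth_cfg_cont[OF g(1)] g(2) smooth_cfg_cont[OF h(1)] h(2)] g(3) by (simp add: mult.assoc)
  then show ?case using h(1) supp_in_deriv[OF i g(2) h(2)] by blast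
qed

text \<open>A moment of the transform is the squared norm of an iterated derivative, which is again
  continuous of bounded support; Plancherel makes it finite.\<close>

lemma smooth_ft_moment:
  fixes f :: "(nat \<Rightarrow> real^'d) \<Rightarrow> complex"
  assumes f: "smooth_cfg N f" "supp_in N R f" and i: "i < N"
  shows "(\<integral>\<^sup>+p. ennreal ((p i $ k) ^ (2 * m) * (cmod (C.ft N f p))\<^sup>2) \<partial>cfg N) < \<infinity>"
proof -
  obtain g where g: "smooth_cfg N g" "supp_in N R g" "\<And>p. C.ft N g p = (\<i> * complex_of_real (p i $ k)) ^ m * C.ft N f p"
    using smooth_iterated_ft[OF f i] by blast
  have "(p i $ k) ^ (2 * m) * (cmod (C.ft N f p))\<^sup>2 = (cmod (C.ft N g p))\<^sup>2" for p
    by (simp add: g(3) norm_mult norm_power power_mult_distrib power_mult[symmetric] mult.commute[of m] power_even_abs)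
  then have "(\<integral>\<^sup>+p. ennreal ((p i $ k) ^ (2 * m) * (cmod (C.ft N f p))\<^sup>2) \<partial>cfg N)
      = ennreal ((2 * pi) ^ (CARD('d) * N)) * (\<integral>\<^sup>+x. ennreal ((cmod (g x))\<^sup>2) \<partial>cfg N)"
    using cont_plancherel[OF smooth_cfg_cont[OF g(1)] g(2)] by simp
  also have "\<dots> < \<infinity>"
    using cont_supp_integrable(2)[OF smooth_cfg_cont[OF g(1)] g(2)]
    by (simp add: ennreal_mult_less_top nn_integral_eq_integral)
  finally show ?thesis .
qed

text \<open>The largest term replaces a multinomial expansion: if it exceeds 1, the whole bracket is
  at most \<open>card A + 1\<close> times it; otherwise the bracket is at most
  \<open>card A + 1\<close>.\<close>

lemma power_sum_bound:
  fixes t :: "'i \<Rightarrow> real"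
  assumes A: "finite A" and t: "\<And>a. a \<in> A \<Longrightarrow> t a \<ge> 0"
  shows "(1 + (\<Sum>a\<in>A. t a)) ^ m \<le> (real (card A) + 1) ^ m * (1 + (\<Sum>a\<in>A. t a ^ m))"
proof (cases "\<forall>a\<in>A. t a \<le> 1")
  case True
  then have "(\<Sum>a\<in>A. t a) \<le> real (card A)" using sum_bounded_above[of A t 1] by simp
  then have "(1 + (\<Sum>a\<in>A. t a)) ^ m \<le> (real (card A) + 1) ^ m" using t by (intro power_mono add_nonneg_nonneg sum_nonneg) auto
  also have "\<dots> \<le> (real (card A) + 1) ^ m * (1 + (\<Sum>a\<in>A. t a ^ m))"
    using t by (simp add: sum_nonneg)
  finally show ?thesis .
next
  case False
  then obtain b where b: "b \<in> A" "\<And>a. a \<in> A \<Longrightarrow> t a \<le> t b" "t b > 1"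
  proof -
    have "A \<noteq> {}" using False by auto
    then have "Max (t ` A) \<in> t ` A" using A by simp
    then obtain b where b: "b \<in> A" "t b = Max (t ` A)" by auto
    have le: "t a \<le> t b" if "a \<in> A" for a using A that b(2) by simp
    obtain a where "a \<in> A" "t a > 1" using False by (auto simp: not_le)
    then have "t b > 1" using le[of a] by simp
    then show ?thesis using b(1) le that by blast
  qed
  have "(\<Sum>a\<in>A. t a) \<le> real (card A) * t b" using sum_bounded_above[of A t "t b"] b(2) by simp
  then have "1 + (\<Sum>a\<in>A. t a) \<le> (real (card A) + 1) * t b" using b(3) by (simp add: distrib_right)
  then have "(1 + (\<Sum>a\<in>A. t a)) ^ m \<le> ((real (card A) + 1) * t b) ^ m"
    using t by (intro power_mono add_nonneg_nonneg sum_nonneg) auto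
  also have "\<dots> = (real (card A) + 1) ^ m * t b ^ m" by (simp add: power_mult_distrib)
  also have "t b ^ m \<le> (\<Sum>a\<in>A. t a ^ m)" using A b t by (intro member_le_sum) auto
  also have "\<dots> \<le> 1 + (\<Sum>a\<in>A. t a ^ m)" by simp
  finally show ?thesis by (simp add: mult_left_mono)
qed

lemma borel_measurable_vec_nth [measurable]: "(\<lambda>x::real^'d. x $ k) \<in> borel_measurable borel"
  by (intro borel_measurable_continuous_onI continuous_intros)

text \<open>The real exponent is rounded up to a natural number \<open>m\<close>, and
  \<open>power_sum_bound\<close> reduces the weight to pure powers
  \<open>(p i $ k) ^ (2 * m)\<close>. Thus derivatives along a single coordinate suffice and no
  mixed ones occur.\<close>

lemma smooth_ft_hs_integrable:
  fixes f :: "(nat \<Rightarrow> real^'d) \<Rightarrow> complex"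
  assumes f: "smooth_cfg N f" "supp_in N R f"
  shows "integrable (cfg N) (\<lambda>p. (1 + (\<Sum>i<N. (norm (p i))\<^sup>2)) powr s * (cmod (C.ft N f p))\<^sup>2)"
proof (rule integrableI_bounded)
  note [measurable] = cont_cfg_measurable[OF smooth_cfg_cont[OF f(1)]]
  show "(\<lambda>p. (1 + (\<Sum>i<N. (norm (p i))\<^sup>2)) powr s * (cmod (C.ft N f p))\<^sup>2) \<in> borel_measurable (cfg N)"
    by measurable
  define m where "m = nat \<lceil>s\<rceil>"
  let ?A = "{..<N} \<times> (UNIV :: 'd set)"
  let ?c = "(real (card ?A) + 1) ^ m"
  let ?F = "\<lambda>p. (cmod (C.ft N f p))\<^sup>2"
  have "norm ((1 + (\<Sum>i<N. (norm (p i))\<^sup>2)) powr s * ?F p)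
      \<le> ?c * (?F p + (\<Sum>(i, k)\<in>?A. (p i $ k) ^ (2 * m) * ?F p))" for p
  proof -
    let ?T = "\<Sum>i<N. (norm (p i))\<^sup>2"
    have T: "?T = (\<Sum>(i, k)\<in>?A. (p i $ k)\<^sup>2)"
      unfolding sum.cartesian_product[symmetric]
      by (intro sum.cong refl) (simp add: norm_vec_def L2_set_def sum_nonneg)
    have "0 \<le> ?T" by (intro sum_nonneg) simp
    then have "(1 + ?T) powr s \<le> (1 + ?T) powr real m"
      by (intro powr_mono) (auto simp: m_def of_nat_ceiling)
    also have "\<dots> = (1 + ?T) ^ m" using \<open>0 \<le> ?T\<close> by (intro powr_realpow) linarith
    also have "\<dots> \<le> ?c * (1 + (\<Sum>(i, k)\<in>?A. (p i $ k) ^ (2 * m)))"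
      unfolding T using power_sum_bound[of ?A "\<lambda>(i, k). (p i $ k)\<^sup>2" m]
      by (simp add: case_prod_beta power_mult)
    finally have "(1 + ?T) powr s * ?F p \<le> ?c * (1 + (\<Sum>(i, k)\<in>?A. (p i $ k) ^ (2 * m))) * ?F p"
      by (rule mult_right_mono) simp
    also have "\<dots> = ?c * (?F p + (\<Sum>(i, k)\<in>?A. (p i $ k) ^ (2 * m) * ?F p))"
      by (simp add: case_prod_beta sum_distrib_right distrib_right mult.assoc)
    finally show ?thesis by simp
  qed
  then have "(\<integral>\<^sup>+p. ennreal (norm ((1 + (\<Sum>i<N. (norm (p i))\<^sup>2)) powr s * ?F p)) \<partial>cfg N)
     \<le> (\<integral>\<^sup>+p. ennreal (?c * (?F p + (\<Sum>(i, k)\<in>?A. (p i $ k) ^ (2 * m) * ?F p))) \<partial>cfg N)"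
    by (intro nn_integral_mono ennreal_leI)
  also have "\<dots> = (\<integral>\<^sup>+p. ennreal ?c * (ennreal (?F p) + (\<Sum>a\<in>?A. ennreal ((p (fst a) $ snd a) ^ (2 * m) * ?F p))) \<partial>cfg N)"
    by (intro nn_integral_cong, subst ennreal_mult)
      (simp_all add: case_prod_beta sum_nonneg ennreal_plus sum_ennreal del: sum_ennreal[symmetric])
  also have "\<dots> = ennreal ?c * ((\<integral>\<^sup>+p. ennreal (?F p) \<partial>cfg N)
      + (\<Sum>a\<in>?A. (\<integral>\<^sup>+p. ennreal ((p (fst a) $ snd a) ^ (2 * m) * ?F p) \<partial>cfg N)))"
  proof -
    have [measurable]: "(\<lambda>p. ennreal ((p (fst a) $ snd a) ^ (2 * m) * ?F p)) \<in> borel_measurable (cfg N)"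
      if a: "a \<in> ?A" for a
    proof -
      obtain i k where ik: "a = (i, k)" and [measurable]: "i < N" using a by (cases a) auto
      show ?thesis unfolding ik fst_conv snd_conv by measurable
    qed
    show ?thesis
      by (subst nn_integral_cmult, measurable, subst nn_integral_add, measurable, subst nn_integral_sum, measurable)
  qed
  also have "\<dots> < \<infinity>"
  proof -
    have "(\<integral>\<^sup>+p. ennreal (?F p) \<partial>cfg N) < \<infinity>"
      using cont_plancherel[OF smooth_cfg_cont[OF f(1)] f(2)] cont_supp_integrable(2)[OF smooth_cfg_cont[OF f(1)] f(2)]
      by (simp add: ennreal_mult_less_top nn_integral_eq_integral)
    moreover have "(\<Sum>a\<in>?A. (\<integral>\<^sup>+p. ennreal ((p (fst a) $ snd a) ^ (2 * m) * ?F p) \<partial>cfg N)) < \<infinity>"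
      using smooth_ft_moment[OF f] by (auto simp: less_top[symmetric])
    ultimately show ?thesis by (simp add: ennreal_mult_less_top)
  qed
  finally show "(\<integral>\<^sup>+p. ennreal (norm ((1 + (\<Sum>i<N. (norm (p i))\<^sup>2)) powr s * ?F p)) \<partial>cfg N) < \<infinity>" .
qed

section \<open>Convolution in a single particle\<close>

definition cconv :: "nat \<Rightarrow> (real^'d \<Rightarrow> complex) \<Rightarrow> ((nat \<Rightarrow> real^'d) \<Rightarrow> complex) \<Rightarrow> (nat \<Rightarrow> real^'d) \<Rightarrow> complex" where
  "cconv i \<kappa> f X = (\<integral>w. \<kappa> w * f (X(i := X i - w)) \<partial>lborel)"

lemma cfg_update_measurable:
  assumes "i < N"
  shows "(\<lambda>(X, w). X(i := X i - w)) \<in> measurable (cfg N \<Otimes>\<^sub>M lborel) (cfg N :: (nat \<Rightarrow> real^'d) measure)"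
  unfolding case_prod_beta cfg_def
proof (rule measurable_fun_upd)
  show "{..<N} = {..<N} \<union> {i}" using assms by auto
  show "fst \<in> measurable (Pi\<^sub>M {..<N} (\<lambda>_. lborel) \<Otimes>\<^sub>M lborel) (Pi\<^sub>M {..<N} (\<lambda>_. lborel))" by measurable
  have "(\<lambda>x. x i) \<in> measurable (Pi\<^sub>M {..<N} (\<lambda>_. lborel)) (lborel :: (real^'d) measure)"
    using measurable_component_singleton[of i "{..<N}" "\<lambda>_. lborel"] assms by simp
  then have c: "(\<lambda>x. x i) \<in> borel_measurable (Pi\<^sub>M {..<N} (\<lambda>_. lborel :: (real^'d) measure))"
    by simp
  have [measurable]: "(\<lambda>x. fst x i) \<in> borel_measurable (Pi\<^sub>M {..<N} (\<lambda>_. lborel :: (real^'d) measure) \<Otimes>\<^sub>M (lborel :: (real^'d) measure))"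
    by (rule measurable_compose[OF measurable_fst c])
  show "(\<lambda>x. fst x i - snd x) \<in> measurable (Pi\<^sub>M {..<N} (\<lambda>_. lborel) \<Otimes>\<^sub>M lborel) (lborel :: (real^'d) measure)"
    by measurable
qed

lemma cfg_update_compose:
  assumes i: "i < N" and f: "f \<in> measurable (cfg N) L" and g: "g \<in> measurable K (cfg N)"
    and h: "h \<in> measurable K lborel"
  shows "(\<lambda>z. f ((g z)(i := g z i - h z))) \<in> measurable K L"
  using measurable_compose[OF measurable_compose[OF measurable_Pair[OF g h] cfg_update_measurable[OF i]] f]
  by simp

context
  fixes N i :: nat and \<kappa> :: "real^'d \<Rightarrow> complex" and f :: "(nat \<Rightarrow> real^'d) \<Rightarrow> complex" and R :: real
  assumes i: "i < N" and \<kappa>: "integrable lborel \<kappa>" and f: "cont_cfg N f" "supp_in N R f"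
begin

text \<open>For fixed \<open>w\<close> the shift preserves the measure, so integrating the absolute
  value gives at most the product of two L1 norms. The multiplier \<open>c\<close> serves two uses:
  it is 1 for integrability of the convolution and a phase for the exchange in
  \<open>ft_cconv\<close>.\<close>

lemma cconv_pair_integrable:
  assumes [measurable]: "c \<in> borel_measurable (cfg N)" and c: "\<And>x. x \<in> space (cfg N) \<Longrightarrow> cmod (c x) \<le> 1"
  shows "integrable (cfg N \<Otimes>\<^sub>M lborel) (\<lambda>(X, w). c X * (\<kappa> w * f (X(i := X i - w))))"
proof -
  note [measurable] = cont_cfg_measurable[OF f(1)]
  have [measurable]: "(\<lambda>z. f ((fst z)(i := fst z i - snd z))) \<in> borel_measurable (cfg N \<Otimes>\<^sub>M lborel)"
    by (rule cfg_update_compose[OF i cont_cfg_measurable[OF f(1)]]) measurable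
  have [measurable]: "\<kappa> \<in> borel_measurable borel" using \<kappa> by auto
  interpret cr: pair_sigma_finite "cfg N :: (nat \<Rightarrow> real^'d) measure" "lborel :: (real^'d) measure"
    by (intro pair_sigma_finite.intro sigma_finite_cfg lborel.sigma_finite_measure_axioms)
  let ?F = "\<lambda>(X, w). c X * (\<kappa> w * f (X(i := X i - w)))"
  have Fm: "?F \<in> borel_measurable (cfg N \<Otimes>\<^sub>M lborel)"
    unfolding case_prod_beta by measurable
  have "(\<integral>\<^sup>+z. ennreal (norm (?F z)) \<partial>(cfg N \<Otimes>\<^sub>M lborel))
      = (\<integral>\<^sup>+w. \<integral>\<^sup>+X. ennreal (norm (?F (X, w))) \<partial>cfg N \<partial>lborel)"
    using Fm by (intro cr.nn_integral_snd[symmetric]) measurable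
  also have "\<dots> \<le> (\<integral>\<^sup>+w. \<integral>\<^sup>+X. ennreal (cmod (\<kappa> w)) * ennreal (cmod (f (X(i := X i + - w)))) \<partial>cfg N \<partial>lborel)"
    using c by (intro nn_integral_mono)
      (auto simp: norm_mult ennreal_mult[symmetric] intro!: ennreal_leI mult_left_le_one_le)
  also have "\<dots> = (\<integral>\<^sup>+w. ennreal (cmod (\<kappa> w)) * (\<integral>\<^sup>+X. ennreal (cmod (f X)) \<partial>cfg N) \<partial>lborel)"
  proof (intro nn_integral_cong)
    fix w :: "real^'d"
    have "(\<integral>\<^sup>+X. ennreal (cmod (f (X(i := X i + - w)))) \<partial>cfg N)
        = (\<integral>\<^sup>+X. ennreal (cmod (f X)) \<partial>distr (cfg N) (cfg N) (\<lambda>X. X(i := X i + - w)))"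
      by (rule nn_integral_distr[OF cfg_shift_measurable[OF i], symmetric]) measurable
    also have "\<dots> = (\<integral>\<^sup>+X. ennreal (cmod (f X)) \<partial>cfg N)" by (simp only: cfg_shift_distr[OF i])
    finally have *: "(\<integral>\<^sup>+X. ennreal (cmod (f (X(i := X i + - w)))) \<partial>cfg N) = (\<integral>\<^sup>+X. ennreal (cmod (f X)) \<partial>cfg N)" .
    have "(\<lambda>X. ennreal (cmod (f (X(i := X i + - w))))) \<in> borel_measurable (cfg N)"
      using measurable_compose[OF cfg_shift_measurable[OF i, of "- w"] cont_cfg_measurable[OF f(1)]] by measurable
    then show "(\<integral>\<^sup>+X. ennreal (cmod (\<kappa> w)) * ennreal (cmod (f (X(i := X i + - w)))) \<partial>cfg N)
        = ennreal (cmod (\<kappa> w)) * (\<integral>\<^sup>+X. ennreal (cmod (f X)) \<partial>cfg N)"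
      unfolding *[symmetric] by (rule nn_integral_cmult)
  qed
  also have "\<dots> = (\<integral>\<^sup>+w. ennreal (cmod (\<kappa> w)) \<partial>lborel) * (\<integral>\<^sup>+X. ennreal (cmod (f X)) \<partial>cfg N)"
    using \<kappa> by (intro nn_integral_multc) auto
  also have "\<dots> < \<infinity>"
    using \<kappa> cont_supp_integrable(1)[OF f] by (auto simp: integrable_iff_bounded ennreal_mult_less_top)
  finally show ?thesis using Fm by (intro integrableI_bounded) auto
qed

lemma cconv_integrable: "integrable (cfg N) (cconv i \<kappa> f)"
proof -
  interpret cr: pair_sigma_finite "cfg N :: (nat \<Rightarrow> real^'d) measure" "lborel :: (real^'d) measure"
    by (intro pair_sigma_finite.intro sigma_finite_cfg lborel.sigma_finite_measure_axioms)
  show ?thesis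
    using cr.integrable_fst[OF cconv_pair_integrable[of "\<lambda>_. 1"]] unfolding cconv_def[abs_def] by simp
qed

lemma ft_cconv: "C.ft N (cconv i \<kappa> f) p = R.ft \<kappa> (p i) * C.ft N f p"
proof -
  note [measurable] = cont_cfg_measurable[OF f(1)]
  interpret cr: pair_sigma_finite "cfg N :: (nat \<Rightarrow> real^'d) measure" "lborel :: (real^'d) measure"
    by (intro pair_sigma_finite.intro sigma_finite_cfg lborel.sigma_finite_measure_axioms)
  have [measurable]: "(\<lambda>x. cB N p x) \<in> borel_measurable (cfg N)"
    unfolding cB_def by measurable
  have int: "integrable (cfg N \<Otimes>\<^sub>M lborel) (\<lambda>(X, w). cis (- cB N p X) * (\<kappa> w * f (X(i := X i - w))))"
  proof (rule cconv_pair_integrable)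
    show "(\<lambda>X. cis (- cB N p X)) \<in> borel_measurable (cfg N)" by measurable
  qed simp
  have "C.ft N (cconv i \<kappa> f) p = (\<integral>X. (\<integral>w. cis (- cB N p X) * (\<kappa> w * f (X(i := X i - w))) \<partial>lborel) \<partial>cfg N)"
    unfolding C.ft_def cconv_def by simp
  also have "\<dots> = (\<integral>w. (\<integral>X. cis (- cB N p X) * (\<kappa> w * f (X(i := X i - w))) \<partial>cfg N) \<partial>lborel)"
    using cr.Fubini_integral[OF int] by simp
  also have "\<dots> = (\<integral>w. cis (- (p i \<bullet> w)) * \<kappa> w * C.ft N f p \<partial>lborel)"
  proof (intro Bochner_Integration.integral_cong refl)
    fix w :: "real^'d"
    have "(\<integral>X. cis (- cB N p X) * (\<kappa> w * f (X(i := X i - w))) \<partial>cfg N)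
        = (\<integral>X. \<kappa> w * (cis (- cB N p X) * f (X(i := X i + - w))) \<partial>cfg N)"
      by (intro Bochner_Integration.integral_cong refl) (simp add: mult_ac)
    also have "\<dots> = \<kappa> w * C.ft N (\<lambda>X. f (X(i := X i + - w))) p"
      unfolding C.ft_def by (rule Bochner_Integration.integral_mult_right_zero)
    also have "\<dots> = cis (- (p i \<bullet> w)) * \<kappa> w * C.ft N f p"
      by (subst ft_shift[OF i cont_cfg_measurable[OF f(1)]]) simp
    finally show "(\<integral>X. cis (- cB N p X) * (\<kappa> w * f (X(i := X i - w))) \<partial>cfg N) = cis (- (p i \<bullet> w)) * \<kappa> w * C.ft N f p" .
  qed
  also have "\<dots> = R.ft \<kappa> (p i) * C.ft N f p"
    unfolding R.ft_def by (rule Bochner_Integration.integral_mult_left_zero)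
  finally show ?thesis .
qed

text \<open>The convolution loses the bounded support of \<open>f\<close>, but stays bounded,
  integrable and continuous along dilations. These are exactly the conditions of the abstract
  Plancherel identity.\<close>

lemma cconv_plancherel:
  "ennreal ((2 * pi) ^ (CARD('d) * N)) * (\<integral>\<^sup>+X. ennreal ((cmod (cconv i \<kappa> f X))\<^sup>2) \<partial>cfg N)
     = (\<integral>\<^sup>+p. ennreal ((cmod (R.ft \<kappa> (p i)))\<^sup>2 * (cmod (C.ft N f p))\<^sup>2) \<partial>cfg N)"
proof -
  obtain b where b: "b \<ge> 0" "\<And>x. x \<in> cfg_space N \<Longrightarrow> cmod (f x) \<le> b"
    using cont_supp_bounded[OF f] by blast
  have [measurable]: "\<kappa> \<in> borel_measurable borel" using \<kappa> by auto
  have up: "x(i := a) \<in> cfg_space N" if "x \<in> cfg_space N" for x :: "nat \<Rightarrow> real^'d" and a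
    using that i by (auto simp: PiE_def extensional_def)
  have fm: "(\<lambda>w. f (X(i := X i - w))) \<in> borel_measurable lborel" if X: "X \<in> cfg_space N" for X
    using X by (intro cfg_update_compose[OF i cont_cfg_measurable[OF f(1)]]) (auto simp: space_cfg)
  have bd: "cmod (\<kappa> w * f (X(i := X i - w))) \<le> b * cmod (\<kappa> w)" if "X \<in> cfg_space N" for X w
    using mult_right_mono[OF b(2)[OF up[OF that]], of "cmod (\<kappa> w)"] by (simp add: norm_mult mult.commute)
  have "(\<integral>\<^sup>+p. ennreal ((cmod (C.ft N (cconv i \<kappa> f) p))\<^sup>2) \<partial>cfg N)
     = ennreal ((2 * pi) ^ (CARD('d) * N)) * (\<integral>\<^sup>+X. ennreal ((cmod (cconv i \<kappa> f X))\<^sup>2) \<partial>cfg N)"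
  proof (rule C.ft_plancherel[OF cconv_integrable])
    fix X :: "nat \<Rightarrow> real^'d" assume X: "X \<in> space (cfg N)"
    then have X': "X \<in> cfg_space N" by (simp add: space_cfg)
    show "cmod (cconv i \<kappa> f X) \<le> (\<integral>w. b * cmod (\<kappa> w) \<partial>lborel)"
      unfolding cconv_def using \<kappa> bd[OF X'] by (intro norm_integral_le) auto
    show "C.radial_cont N (cconv i \<kappa> f) X"
      unfolding C.radial_cont_def
    proof
      fix Z :: "nat \<Rightarrow> real^'d"
      let ?Y = "\<lambda>n. csh N (sqrt (1 / real (Suc n))) X Z"
      have Y: "?Y n \<in> cfg_space N" for n by (rule csh_space)
      show "(\<lambda>n. cconv i \<kappa> f (?Y n)) \<longlonglongrightarrow> cconv i \<kappa> f X"
        unfolding cconv_def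
      proof (rule integral_dominated_convergence[where w="\<lambda>w. b * cmod (\<kappa> w)"])
        show "AE w in lborel. (\<lambda>n. \<kappa> w * f ((?Y n)(i := ?Y n i - w))) \<longlonglongrightarrow> \<kappa> w * f (X(i := X i - w))"
        proof (intro AE_I2 tendsto_mult tendsto_const cfg_radial_tendsto[OF f(1) up[OF X'] up[OF Y]])
          fix w and j assume j: "j < N"
          show "(\<lambda>n. ((?Y n)(i := ?Y n i - w)) j) \<longlonglongrightarrow> (X(i := X i - w)) j"
            using tendsto_diff[OF csh_tendsto[OF i, of X Z] tendsto_const[of w]] csh_tendsto[OF j, of X Z] by simp
        qed
        show "AE w in lborel. cmod (\<kappa> w * f ((?Y n)(i := ?Y n i - w))) \<le> b * cmod (\<kappa> w)" for n
          using bd[OF Y] by auto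
        show "integrable lborel (\<lambda>w. b * cmod (\<kappa> w))"
          by (intro integrable_mult_right integrable_norm \<kappa>)
      qed (use \<kappa> fm[OF X'] fm[OF Y] in measurable)
    qed
  qed
  then show ?thesis unfolding ft_cconv by (simp add: norm_mult power_mult_distrib)
qed

end

subsection \<open>A decaying kernel and a band-limited profile\<close>

lemma nn_integral_powr_tail:
  assumes a: "a > 0" and b: "b > 0"
  shows "(\<integral>\<^sup>+t. ennreal (t powr (- b - 1)) * indicator {a..} t \<partial>lborel) = ennreal (a powr (- b) / b)"
proof -
  have "(\<integral>\<^sup>+t. ennreal (t powr (- b - 1)) * indicator {a..} t \<partial>lborel) = ennreal (0 - (- (a powr (- b) / b)))"
  proof (rule nn_integral_FTC_atLeast)
    show "DERIV (\<lambda>t. - (t powr (- b) / b)) t :> t powr (- b - 1)" if "a \<le> t" for t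
      using that a b by (auto intro!: derivative_eq_intros)
    have "((\<lambda>t. t powr (- b)) \<longlongrightarrow> 0) at_top"
      by (intro tendsto_neg_powr filterlim_ident) (use b in auto)
    then have "((\<lambda>t. - (t powr (- b) / b)) \<longlongrightarrow> - (0 / b)) at_top"
      by (intro tendsto_intros) (use b in auto)
    then show "((\<lambda>t. - (t powr (- b) / b)) \<longlongrightarrow> 0) at_top" by simp
  qed auto
  then show ?thesis by simp
qed

lemma nn_integral_cauchy: "(\<integral>\<^sup>+t. ennreal (1 / (1 + t\<^sup>2)) \<partial>lborel) = ennreal pi"
proof -
  have half: "(\<integral>\<^sup>+t. ennreal (1 / (1 + t\<^sup>2)) * indicator {0..} t \<partial>lborel) = ennreal (pi / 2 - arctan 0)"
    by (rule nn_integral_FTC_atLeast)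
      (auto intro!: derivative_eq_intros tendsto_arctan_at_top simp: inverse_eq_divide)
  have half': "(\<integral>\<^sup>+t. ennreal (1 / (1 + t\<^sup>2)) * indicator {..0} t \<partial>lborel) = ennreal (pi / 2)"
    using half by (subst nn_integral_real_affine[where c="-1" and t=0]) (auto simp: indicator_def)
  have "(\<integral>\<^sup>+t. ennreal (1 / (1 + t\<^sup>2)) \<partial>lborel)
      = (\<integral>\<^sup>+t. ennreal (1 / (1 + t\<^sup>2)) * indicator {0..} t + ennreal (1 / (1 + t\<^sup>2)) * indicator {..0} t \<partial>lborel)"
  proof (rule nn_integral_cong_AE)
    show "AE t in lborel. ennreal (1 / (1 + t\<^sup>2))
      = ennreal (1 / (1 + t\<^sup>2)) * indicator {0..} t + ennreal (1 / (1 + t\<^sup>2)) * indicator {..0::real} t"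
      using AE_lborel_singleton[of "0::real"] by eventually_elim (auto simp: indicator_def)
  qed
  also have "\<dots> = ennreal (pi / 2) + ennreal (pi / 2)"
    using half half' by (subst nn_integral_add) auto
  also have "\<dots> = ennreal pi" by (simp add: ennreal_plus[symmetric] del: ennreal_plus)
  finally show ?thesis .
qed

text \<open>Cauchy weight. Its slow decay gives two properties that a Gaussian lacks: values at
  points within distance 1 are comparable (\<open>kk_harnack\<close>), and its convolution with
  itself is bounded by a multiple of itself (\<open>kk_conv\<close>).\<close>

definition kk :: "real \<Rightarrow> real" where "kk t = 1 / (1 + t\<^sup>2)"

lemma kk_pos: "kk t > 0" unfolding kk_def by (simp add: add_pos_nonneg)
lemma kk_le1: "kk t \<le> 1" unfolding kk_def by (simp add: add_pos_nonneg)
lemma kk_minus [simp]: "kk (- t) = kk t" unfolding kk_def by simp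
lemma kk_measurable [measurable]: "kk \<in> borel_measurable borel" unfolding kk_def by measurable

lemma kk_harnack:
  assumes "\<bar>s - t\<bar> \<le> 1" shows "kk s \<le> 3 * kk t"
proof -
  have "0 \<le> (2 * s - t)\<^sup>2" by simp
  then have "t\<^sup>2 \<le> 2 * s\<^sup>2 + 2 * (s - t)\<^sup>2" by (simp add: power2_eq_square algebra_simps)
  also have "\<dots> \<le> 2 * s\<^sup>2 + 2 * 1"
    using assms by (intro add_left_mono mult_left_mono) (auto simp: abs_square_le_1)
  finally have "1 + t\<^sup>2 \<le> 3 + 2 * s\<^sup>2" by simp
  also have "\<dots> \<le> 3 * (1 + s\<^sup>2)" by simp
  finally have "1 + t\<^sup>2 \<le> 3 * (1 + s\<^sup>2)" .
  moreover have "1 + s\<^sup>2 > 0" "1 + t\<^sup>2 > 0" by (auto simp: add_pos_nonneg)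
  ultimately show ?thesis unfolding kk_def by (simp add: field_simps)
qed

text \<open>This is \<open>1 + (s + t)\<^sup>2 \<le> 2 * ((1 + s\<^sup>2) + (1 + t\<^sup>2))\<close>
  divided by all three factors. With \<open>s + t\<close> fixed, as in a convolution, the product is
  thereby dominated by a sum, whose integral is explicit.\<close>

lemma kk_mult: "kk s * kk t \<le> 2 * kk (s + t) * (kk s + kk t)"
proof -
  have p: "1 + s\<^sup>2 > 0" "1 + t\<^sup>2 > 0" "1 + (s + t)\<^sup>2 > 0" by (auto simp: add_pos_nonneg)
  have "0 \<le> (s - t)\<^sup>2" by simp
  then have "(s + t)\<^sup>2 \<le> 2 * s\<^sup>2 + 2 * t\<^sup>2" by (simp add: power2_eq_square algebra_simps)
  then have "1 + (s + t)\<^sup>2 \<le> 2 * ((1 + s\<^sup>2) + (1 + t\<^sup>2))" by simp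
  then have "(1 + (s + t)\<^sup>2) * (kk (s + t) * kk s * kk t) \<le> 2 * ((1 + s\<^sup>2) + (1 + t\<^sup>2)) * (kk (s + t) * kk s * kk t)"
    by (rule mult_right_mono) (simp add: kk_pos less_imp_le)
  moreover have "(1 + (s + t)\<^sup>2) * (kk (s + t) * kk s * kk t) = kk s * kk t"
  proof -
    have "(1 + (s + t)\<^sup>2) * kk (s + t) = 1" using p unfolding kk_def by auto
    then show ?thesis by (simp only: mult.assoc[symmetric] mult_1_left)
  qed
  moreover have "2 * ((1 + s\<^sup>2) + (1 + t\<^sup>2)) * (kk (s + t) * kk s * kk t) = 2 * kk (s + t) * (kk s + kk t)"
  proof -
    have "(1 + s\<^sup>2) * kk s = 1" "(1 + t\<^sup>2) * kk t = 1" using p unfolding kk_def by auto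
    moreover have "2 * (a + b) * (k * x * y) = 2 * k * ((a * x) * y + (b * y) * x)" for a b k x y :: real
      by (simp add: algebra_simps)
    ultimately show ?thesis by (simp only: mult_1_left add.commute[of "kk s"])
  qed
  ultimately show ?thesis by (simp only:)
qed

lemma kk_conv: "(\<integral>\<^sup>+y. ennreal (kk y * kk (c - y)) \<partial>lborel) \<le> ennreal (4 * pi * kk c)"
proof -
  have kc: "(\<integral>\<^sup>+y. ennreal (kk (c - y)) \<partial>lborel) = ennreal pi"
    using nn_integral_real_affine[of "\<lambda>y. ennreal (kk y)" "-1" c] nn_integral_cauchy
    by (simp add: kk_def[symmetric] del: minus_diff_eq)
  have "(\<integral>\<^sup>+y. ennreal (kk y * kk (c - y)) \<partial>lborel) \<le> (\<integral>\<^sup>+y. ennreal (2 * kk c) * (ennreal (kk y) + ennreal (kk (c - y))) \<partial>lborel)"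
  proof (intro nn_integral_mono)
    fix y
    have "kk y * kk (c - y) \<le> 2 * kk c * (kk y + kk (c - y))" using kk_mult[of y "c - y"] by simp
    then show "ennreal (kk y * kk (c - y)) \<le> ennreal (2 * kk c) * (ennreal (kk y) + ennreal (kk (c - y)))"
      using kk_pos by (simp add: ennreal_mult[symmetric] ennreal_plus[symmetric] less_imp_le add_nonneg_nonneg del: ennreal_plus)
  qed
  also have "\<dots> = ennreal (2 * kk c) * (ennreal pi + ennreal pi)"
    using kc nn_integral_cauchy by (simp add: nn_integral_cmult nn_integral_add kk_def[symmetric])
  also have "\<dots> = ennreal (4 * pi * kk c)"
    using kk_pos[of c] by (simp add: ennreal_mult[symmetric] ennreal_plus[symmetric] del: ennreal_plus)
  finally show ?thesis .
qed

text \<open>A product over coordinates rather than a radial weight, so that mass, Harnack bound and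
  convolution bound follow factor by factor from dimension one.\<close>

definition KK :: "'a::euclidean_space \<Rightarrow> real" where "KK x = (\<Prod>b\<in>Basis. kk (x \<bullet> b))"

lemma KK_pos: "KK x > 0" unfolding KK_def by (intro prod_pos) (simp add: kk_pos)
lemma KK_nonneg [simp]: "KK x \<ge> 0" using KK_pos[of x] by simp
lemma KK_le1: "KK x \<le> 1" unfolding KK_def by (intro prod_le_1) (simp add: kk_pos kk_le1 less_imp_le)
lemma KK_minus [simp]: "KK (- x) = KK x" unfolding KK_def by simp
lemma KK_measurable [measurable]: "KK \<in> borel_measurable borel" unfolding KK_def by measurable

lemma KK_harnack:
  fixes x y :: "'a::euclidean_space"
  assumes "norm (x - y) \<le> 1" shows "KK x \<le> 3 ^ DIM('a) * KK y"
proof -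
  have "KK x \<le> (\<Prod>b\<in>(Basis::'a set). 3 * kk (y \<bullet> b))"
    unfolding KK_def
  proof (intro prod_mono conjI kk_harnack)
    fix b :: 'a assume "b \<in> Basis"
    then show "\<bar>x \<bullet> b - y \<bullet> b\<bar> \<le> 1"
      using Basis_le_norm[of b "x - y"] assms by (simp add: inner_diff_left)
  qed (simp add: kk_pos less_imp_le)
  then show ?thesis by (simp add: prod.distrib KK_def)
qed

lemma nn_integral_KK: "(\<integral>\<^sup>+x. ennreal (KK (x::'a::euclidean_space)) \<partial>lborel) = ennreal (pi ^ DIM('a))"
proof -
  have "(\<integral>\<^sup>+x. ennreal (KK (x::'a)) \<partial>lborel) = (\<integral>\<^sup>+x. (\<Prod>b\<in>Basis. ennreal (kk ((x::'a) \<bullet> b))) \<partial>lborel)"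
    unfolding KK_def by (simp add: prod_ennreal kk_pos less_imp_le)
  also have "\<dots> = (\<Prod>b\<in>(Basis::'a set). ennreal pi)"
    using nn_integral_cauchy by (subst nn_integral_lborel_prod) (auto simp: kk_def)
  finally show ?thesis by (simp add: ennreal_power)
qed

lemma prod_mono_ennreal_weak:
  fixes f g :: "'i \<Rightarrow> ennreal"
  assumes "finite A" "\<And>a. a \<in> A \<Longrightarrow> f a \<le> g a"
  shows "prod f A \<le> prod g A"
  using assms by (induction A) (auto intro!: mult_mono)

lemma KK_conv:
  "(\<integral>\<^sup>+y. ennreal (KK y * KK (c - y)) \<partial>lborel) \<le> ennreal ((4 * pi) ^ DIM('a) * KK (c::'a::euclidean_space))"
proof -
  have "(\<integral>\<^sup>+y. ennreal (KK y * KK (c - y)) \<partial>lborel)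
      = (\<integral>\<^sup>+y. (\<Prod>b\<in>Basis. ennreal (kk (y \<bullet> b) * kk (c \<bullet> b - y \<bullet> b))) \<partial>lborel)"
    unfolding KK_def by (simp add: prod_ennreal kk_pos less_imp_le prod.distrib inner_diff_left)
  also have "\<dots> = (\<Prod>b\<in>(Basis::'a set). (\<integral>\<^sup>+t. ennreal (kk t * kk (c \<bullet> b - t)) \<partial>lborel))"
    by (rule nn_integral_lborel_prod) auto
  also have "\<dots> \<le> (\<Prod>b\<in>(Basis::'a set). ennreal (4 * pi * kk (c \<bullet> b)))"
    by (intro prod_mono_ennreal_weak kk_conv finite_Basis)
  also have "\<dots> = ennreal ((4 * pi) ^ DIM('a) * KK c)"
    by (subst prod_ennreal) (simp_all add: kk_pos less_imp_le prod.distrib KK_def)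
  finally show ?thesis .
qed

lemma nn_integral_affine:
  fixes f :: "'a::euclidean_space \<Rightarrow> ennreal"
  assumes [measurable]: "f \<in> borel_measurable borel" and c: "c \<noteq> 0"
  shows "(\<integral>\<^sup>+x. f x \<partial>lborel) = ennreal (\<bar>c\<bar> ^ DIM('a)) * (\<integral>\<^sup>+x. f (t + c *\<^sub>R x) \<partial>lborel)"
proof -
  have "(\<integral>\<^sup>+x. f x \<partial>lborel) = (\<integral>\<^sup>+x. f x \<partial>density (distr lborel borel (\<lambda>x. t + c *\<^sub>R x)) (\<lambda>_. ennreal (\<bar>c\<bar> ^ DIM('a))))"
    using lborel_affine[OF c, of t] by (simp add: ennreal_power)
  also have "\<dots> = (\<integral>\<^sup>+x. ennreal (\<bar>c\<bar> ^ DIM('a)) * f (t + c *\<^sub>R x) \<partial>lborel)"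
    by (subst nn_integral_density) (simp_all add: nn_integral_distr)
  finally show ?thesis by (simp add: nn_integral_cmult)
qed

lemma nn_integral_KK_scaled:
  fixes w :: "'a::euclidean_space"
  assumes "l > 0"
  shows "(\<integral>\<^sup>+x. ennreal (KK ((x - w) /\<^sub>R l)) \<partial>lborel) = ennreal ((pi * l) ^ DIM('a))"
proof -
  have "(\<integral>\<^sup>+x. ennreal (KK ((x - w) /\<^sub>R l)) \<partial>lborel) = ennreal (\<bar>l\<bar> ^ DIM('a)) * (\<integral>\<^sup>+x. ennreal (KK ((w + l *\<^sub>R x - w) /\<^sub>R l)) \<partial>lborel)"
    using assms by (intro nn_integral_affine) auto
  also have "\<dots> = ennreal ((pi * l) ^ DIM('a))"
    using assms by (simp add: nn_integral_KK ennreal_mult[symmetric] power_mult_distrib mult.commute)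
  finally show ?thesis .
qed

lemma KK_conv_scaled:
  fixes w z :: "'a::euclidean_space"
  assumes "l > 0"
  shows "(\<integral>\<^sup>+x. ennreal (KK ((x - w) /\<^sub>R l) * KK ((z - x) /\<^sub>R l)) \<partial>lborel) \<le> ennreal ((4 * pi * l) ^ DIM('a) * KK ((z - w) /\<^sub>R l))"
proof -
  have "(\<integral>\<^sup>+x. ennreal (KK ((x - w) /\<^sub>R l) * KK ((z - x) /\<^sub>R l)) \<partial>lborel)
     = ennreal (\<bar>l\<bar> ^ DIM('a)) * (\<integral>\<^sup>+x. ennreal (KK ((w + l *\<^sub>R x - w) /\<^sub>R l) * KK ((z - (w + l *\<^sub>R x)) /\<^sub>R l)) \<partial>lborel)"
    using assms by (intro nn_integral_affine) auto
  also have "(\<lambda>x. KK ((w + l *\<^sub>R x - w) /\<^sub>R l) * KK ((z - (w + l *\<^sub>R x)) /\<^sub>R l)) = (\<lambda>x. KK x * KK ((z - w) /\<^sub>R l - x))"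
    using assms by (simp add: fun_eq_iff scaleR_diff_right scaleR_add_right diff_diff_eq)
  also have "ennreal (\<bar>l\<bar> ^ DIM('a)) * (\<integral>\<^sup>+x. ennreal (KK x * KK ((z - w) /\<^sub>R l - x)) \<partial>lborel)
     \<le> ennreal (\<bar>l\<bar> ^ DIM('a)) * ennreal ((4 * pi) ^ DIM('a) * KK ((z - w) /\<^sub>R l))"
    by (intro mult_left_mono KK_conv) simp
  also have "\<dots> = ennreal ((4 * pi * l) ^ DIM('a) * KK ((z - w) /\<^sub>R l))"
    using assms by (simp add: ennreal_mult[symmetric] power_mult_distrib mult_ac)
  finally show ?thesis .
qed

section \<open>The triangle function and the band-limited profile\<close>

definition tri :: "real \<Rightarrow> real" where "tri t = max 0 (1 - \<bar>t\<bar>)"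

lemma tri_measurable [measurable]: "tri \<in> borel_measurable borel" unfolding tri_def by measurable
lemma tri_nonneg [simp]: "tri t \<ge> 0" by (simp add: tri_def)
lemma tri_le1: "tri t \<le> 1" by (simp add: tri_def)

text \<open>The transform of the triangle function is 2 (1 - cos x) / x^2, so it decays like kk; its
  transform in turn has compact support.\<close>
definition triS :: "real \<Rightarrow> complex" where "triS x = (\<integral>t. cis (- (x * t)) * complex_of_real (tri t) \<partial>lborel)"

lemma cis_has_vector_derivative:
  "((\<lambda>t. cis (- (x * t))) has_vector_derivative - \<i> * complex_of_real x * cis (- (x * t))) (at t within A)"
proof -
  have "((\<lambda>t. cis (- (x * t))) has_derivative (\<lambda>h. (- (x * h)) *\<^sub>R (\<i> * cis (- (x * t))))) (at t within A)"
    by (rule has_derivative_cis) (auto intro!: derivative_eq_intros)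
  then show ?thesis
    unfolding has_vector_derivative_def by (simp add: scaleR_conv_of_real mult_ac)
qed

text \<open>The identity fails at \<open>t = 0\<close>, where both closed intervals count, hence the
  almost everywhere form.\<close>

lemma tri_split:
  "AE t in lborel. cis (- (x * t)) * complex_of_real (tri t)
     = indicator {-1..0} t *\<^sub>R (complex_of_real (1 + t) * cis (- (x * t)))
     + indicator {0..1} t *\<^sub>R (complex_of_real (1 - t) * cis (- (x * t)))"
  using AE_lborel_singleton[of "0::real"]
  by eventually_elim (auto simp: indicator_def tri_def max_def abs_if)

text \<open>The antiderivatives are parameters because they differ in kind: polynomials at
  \<open>x = 0\<close>, and expressions with \<open>x\<close> in the denominator otherwise.\<close>

lemma triS_integral:
  assumes F: "\<And>t. (F has_vector_derivative complex_of_real (1 + t) * cis (- (x * t))) (at t within {-1..0})"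
    and G: "\<And>t. (G has_vector_derivative complex_of_real (1 - t) * cis (- (x * t))) (at t within {0..1})"
  shows "integrable lborel (\<lambda>t. cis (- (x * t)) * complex_of_real (tri t))"
    and "triS x = (F 0 - F (-1)) + (G 1 - G 0)"
proof -
  have c: "continuous_on A (\<lambda>t. cis (- (x * t)))" for A
    by (intro continuous_intros)
  have "has_bochner_integral lborel (\<lambda>t. indicator {-1..0} t *\<^sub>R (complex_of_real (1 + t) * cis (- (x * t)))) (F 0 - F (-1))"
    by (rule has_bochner_integral_FTC_Icc) (simp, rule F, intro continuous_intros c)
  moreover have "has_bochner_integral lborel (\<lambda>t. indicator {0..1} t *\<^sub>R (complex_of_real (1 - t) * cis (- (x * t)))) (G 1 - G 0)"
    by (rule has_bochner_integral_FTC_Icc) (simp, rule G, intro continuous_intros c)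
  ultimately have "has_bochner_integral lborel (\<lambda>t. indicator {-1..0} t *\<^sub>R (complex_of_real (1 + t) * cis (- (x * t)))
     + indicator {0..1} t *\<^sub>R (complex_of_real (1 - t) * cis (- (x * t)))) ((F 0 - F (-1)) + (G 1 - G 0))"
    by (rule has_bochner_integral_add)
  then have *: "has_bochner_integral lborel (\<lambda>t. cis (- (x * t)) * complex_of_real (tri t)) ((F 0 - F (-1)) + (G 1 - G 0))"
    by (rule iffD2[OF has_bochner_integral_cong_AE[OF _ _ tri_split], rotated -1]) measurable
  then show "integrable lborel (\<lambda>t. cis (- (x * t)) * complex_of_real (tri t))"
    and "triS x = (F 0 - F (-1)) + (G 1 - G 0)"
    unfolding triS_def by (auto simp: has_bochner_integral_iff)
qed

lemma triS_0: "triS 0 = 1" and tri_integrable: "integrable lborel tri"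
proof -
  let ?F = "\<lambda>t::real. complex_of_real (t + t\<^sup>2 / 2)" and ?G = "\<lambda>t::real. complex_of_real (t - t\<^sup>2 / 2)"
  have F: "(?F has_vector_derivative complex_of_real (1 + t) * cis (- (0 * t))) (at t within {-1..0})" for t
  proof -
    have "((\<lambda>t. t + t\<^sup>2 / 2) has_field_derivative (1 + t)) (at t within {-1..0})"
      by (auto intro!: derivative_eq_intros)
    from has_vector_derivative_of_real[OF this, where 'a=complex] show ?thesis by simp
  qed
  have G: "(?G has_vector_derivative complex_of_real (1 - t) * cis (- (0 * t))) (at t within {0..1})" for t
  proof -
    have "((\<lambda>t. t - t\<^sup>2 / 2) has_field_derivative (1 - t)) (at t within {0..1})"
      by (auto intro!: derivative_eq_intros)
    from has_vector_derivative_of_real[OF this, where 'a=complex] show ?thesis by simp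
  qed
  show "triS 0 = 1" using triS_integral(2)[OF F G] by simp
  show "integrable lborel tri" using integrable_norm[OF triS_integral(1)[OF F G]] by simp
qed

lemma tri_cis_integrable: "integrable lborel (\<lambda>t. cis (- (x * t)) * complex_of_real (tri t))"
  by (rule Bochner_Integration.integrable_bound[OF tri_integrable]) (auto simp: norm_mult)

lemma integral_tri: "(\<integral>t. tri t \<partial>lborel) = 1"
  using triS_0 unfolding triS_def by simp

text \<open>The constant is 5 = 1 + 4: \<open>cmod (triS x)\<close> is at most the mass 1 of
  \<open>tri\<close>, and \<open>x\<^sup>2 * cmod (triS x)\<close> is the modulus of
  \<open>2 - cis x - cis (- x)\<close>, at most 4.\<close>

lemma norm_triS_le: "cmod (triS x) \<le> 5 * kk x"
proof -
  have one: "cmod (triS x) \<le> 1"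
  proof -
    have "cmod (triS x) \<le> (\<integral>t. tri t \<partial>lborel)"
      unfolding triS_def by (intro norm_integral_le tri_integrable) (simp add: norm_mult)
    then show ?thesis by (simp add: integral_tri)
  qed
  have four: "x\<^sup>2 * cmod (triS x) \<le> 4"
  proof (cases "x = 0")
    case False
    let ?x = "complex_of_real x"
    let ?F = "\<lambda>t. complex_of_real (1 + t) * (\<i> / ?x * cis (- (x * t))) + 1 / ?x\<^sup>2 * cis (- (x * t))"
    let ?G = "\<lambda>t. complex_of_real (1 - t) * (\<i> / ?x * cis (- (x * t))) - 1 / ?x\<^sup>2 * cis (- (x * t))"
    have l: "((\<lambda>t. complex_of_real (1 + t)) has_vector_derivative 1) (at t within A)"
        "((\<lambda>t. complex_of_real (1 - t)) has_vector_derivative - 1) (at t within A)" for t A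
      by (auto intro!: derivative_eq_intros)
    have F: "(?F has_vector_derivative complex_of_real (1 + t) * cis (- (x * t))) (at t within {-1..0})" for t
      by (rule has_vector_derivative_eq_rhs[OF has_vector_derivative_add[OF has_vector_derivative_mult[OF l(1)
          has_vector_derivative_mult_right[OF cis_has_vector_derivative]] has_vector_derivative_mult_right[OF cis_has_vector_derivative]]])
        (use False in \<open>simp add: field_simps power2_eq_square\<close>)
    have G: "(?G has_vector_derivative complex_of_real (1 - t) * cis (- (x * t))) (at t within {0..1})" for t
      by (rule has_vector_derivative_eq_rhs[OF has_vector_derivative_diff[OF has_vector_derivative_mult[OF l(2)
          has_vector_derivative_mult_right[OF cis_has_vector_derivative]] has_vector_derivative_mult_right[OF cis_has_vector_derivative]]])
        (use False in \<open>simp add: field_simps power2_eq_square\<close>)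
    have "triS x = (2 - cis x - cis (- x)) / ?x\<^sup>2"
      using triS_integral(2)[OF F G] by (simp add: diff_divide_distrib)
    then have "x\<^sup>2 * cmod (triS x) = cmod (2 - cis x - cis (- x))"
      using False by (simp add: norm_divide norm_power)
    also have "\<dots> \<le> cmod 2 + cmod (cis x) + cmod (cis (- x))"
      by (intro order_trans[OF norm_triangle_ineq4] add_mono order_refl)
    finally show ?thesis by simp
  qed simp
  have "(1 + x\<^sup>2) * cmod (triS x) \<le> 5" using one four by (simp add: distrib_right)
  then show ?thesis unfolding kk_def by (simp add: pos_le_divide_eq add_pos_nonneg mult.commute)
qed

text \<open>\<open>zeta\<close> gets its continuity from here, being the transform of an integrable
  function; its quotient formula would need separate care wherever a coordinate is 0.\<close>

lemma ft_isCont: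
  fixes g :: "'a::euclidean_space \<Rightarrow> complex"
  assumes g: "integrable lborel g"
  shows "isCont (R.ft g) x"
  unfolding continuous_at_sequentially comp_def
proof (intro allI impI)
  fix X assume X: "X \<longlonglongrightarrow> x"
  have [measurable]: "g \<in> borel_measurable borel" using g by auto
  have cc: "isCont cis a" for a unfolding cis_conv_exp by (intro continuous_intros)
  show "(\<lambda>n. R.ft g (X n)) \<longlonglongrightarrow> R.ft g x"
    unfolding R.ft_def
  proof (rule integral_dominated_convergence[where w="\<lambda>y. cmod (g y)"])
    show "AE y in lborel. (\<lambda>n. cis (- (X n \<bullet> y)) * g y) \<longlonglongrightarrow> cis (- (x \<bullet> y)) * g y"
      by (intro AE_I2 tendsto_mult tendsto_const isCont_tendsto_compose[OF cc] tendsto_minus tendsto_inner X)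
  qed (use g in \<open>auto simp: norm_mult\<close>)
qed

definition Tri :: "'a::euclidean_space \<Rightarrow> real" where "Tri k = (\<Prod>b\<in>Basis. tri (k \<bullet> b))"

text \<open>Product over coordinates of squared sinc functions, (sin(t/2) / (t/2))^2, in other words
  a Fejer-type kernel. It is built from the Fourier side: starting from the compactly supported
  \<open>Tri\<close> makes band limitation automatic.\<close>

definition zeta :: "'a::euclidean_space \<Rightarrow> complex" where "zeta x = (\<Prod>b\<in>Basis. triS (x \<bullet> b))"

lemma Tri_nonneg: "Tri k \<ge> 0" unfolding Tri_def by (intro prod_nonneg) simp
lemma Tri_le1: "Tri k \<le> 1" unfolding Tri_def by (intro prod_le_1) (simp add: tri_le1)

lemma isCont_Tri: "isCont Tri (k :: 'a::euclidean_space)"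
  unfolding Tri_def tri_def by (intro continuous_intros)

text \<open>Where \<open>Tri\<close> is nonzero each coordinate is below 1 in absolute value, so the
  l1 norm, and with it the Euclidean norm, is below the dimension. This is the origin of the
  frequency scales \<open>d / l\<close> and \<open>2 * d / l\<close>.\<close>

lemma Tri_support:
  assumes "norm k \<ge> real DIM('a)"
  shows "Tri (k :: 'a::euclidean_space) = 0"
proof (rule ccontr)
  assume "Tri k \<noteq> 0"
  then have "tri (k \<bullet> b) \<noteq> 0" if "b \<in> Basis" for b unfolding Tri_def using that by (simp add: prod_zero_iff)
  then have "\<bar>k \<bullet> b\<bar> < 1" if "b \<in> Basis" for b using that unfolding tri_def by (force simp: max_def split: if_splits)
  then have "(\<Sum>b\<in>Basis. \<bar>k \<bullet> b\<bar>) < (\<Sum>b\<in>(Basis::'a set). 1)" by (intro sum_strict_mono) auto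
  then show False using norm_le_l1[of k] assms by simp
qed

lemma Tri_integrable: "integrable lborel (\<lambda>k. complex_of_real (Tri (k::'a::euclidean_space)))"
  and ft_Tri: "R.ft (\<lambda>k. complex_of_real (Tri k)) x = zeta (x::'a)"
proof -
  have cis_prod: "(\<Prod>b\<in>A. cis (a b)) = cis (\<Sum>b\<in>A. a b)" if "finite A" for a and A :: "'a set"
    using that by (induction A) (auto simp: cis_mult)
  have split: "cis (- (x \<bullet> k)) * complex_of_real (Tri k) = (\<Prod>b\<in>Basis. cis (- ((x \<bullet> b) * (k \<bullet> b))) * complex_of_real (tri (k \<bullet> b)))" for x k :: 'a
    by (simp add: prod.distrib cis_prod Tri_def sum_negf[symmetric] euclidean_inner[of x k])
  have "integrable lborel (\<lambda>k::'a. cis (- (0 \<bullet> k)) * complex_of_real (Tri k))"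
    unfolding split by (rule lborel_integral_prod(1)[of "\<lambda>b t. cis (- ((0 \<bullet> b) * t)) * complex_of_real (tri t)"]) (rule tri_cis_integrable)
  then show "integrable lborel (\<lambda>k. complex_of_real (Tri (k::'a)))" by simp
  show "R.ft (\<lambda>k. complex_of_real (Tri k)) x = zeta x"
    unfolding R.ft_def split zeta_def triS_def
    by (rule lborel_integral_prod(2)[of "\<lambda>b t. cis (- ((x \<bullet> b) * t)) * complex_of_real (tri t)"]) (rule tri_cis_integrable)
qed

lemma isCont_zeta: "isCont zeta (x :: 'a::euclidean_space)"
  using ft_isCont[OF Tri_integrable, of x] unfolding ft_Tri .

lemma zeta_measurable [measurable]: "zeta \<in> borel_measurable (borel :: 'a::euclidean_space measure)"
  using isCont_zeta[where 'a='a] by (intro borel_measurable_continuous_onI) (simp add: continuous_on_eq_continuous_at)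

lemma zeta_0: "zeta (0 :: 'a::euclidean_space) = 1" unfolding zeta_def by (simp add: triS_0)

lemma norm_zeta_le: "cmod (zeta (x :: 'a::euclidean_space)) \<le> 5 ^ DIM('a) * KK x"
proof -
  have "cmod (zeta x) \<le> (\<Prod>b\<in>(Basis::'a set). 5 * kk (x \<bullet> b))"
    unfolding zeta_def prod_norm[symmetric] by (intro prod_mono) (auto intro: norm_triS_le)
  then show ?thesis by (simp add: prod.distrib KK_def)
qed

lemma norm_zeta_le': "cmod (zeta (x :: 'a::euclidean_space)) \<le> 5 ^ DIM('a)"
  by (rule order_trans[OF norm_zeta_le]) (simp add: mult_left_le KK_le1)

lemma KK_integrable: "integrable lborel (KK :: 'a::euclidean_space \<Rightarrow> real)"
  by (rule integrableI_nonneg) (auto simp: nn_integral_KK)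

lemma zeta_integrable: "integrable lborel (zeta :: 'a::euclidean_space \<Rightarrow> complex)"
  by (rule Bochner_Integration.integrable_bound[OF integrable_mult_right[OF KK_integrable, of "5 ^ DIM('a)"]])
    (auto intro!: AE_I2 norm_zeta_le)

lemma isCont_radial:
  fixes g :: "'a::euclidean_space \<Rightarrow> complex"
  assumes "isCont g x"
  shows "R.radial_cont g x"
  unfolding R.radial_cont_def
proof
  fix z :: 'a
  have "(\<lambda>n. x + sqrt (1 / real (Suc n)) *\<^sub>R z) \<longlonglongrightarrow> x + sqrt 0 *\<^sub>R z"
    by (intro tendsto_intros LIMSEQ_Suc lim_1_over_n)
  then show "(\<lambda>n. g (x + sqrt (1 / real (Suc n)) *\<^sub>R z)) \<longlonglongrightarrow> g x"
    by (intro isCont_tendsto_compose[OF assms]) simp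
qed

lemma zeta_hat: "(\<integral>v. zeta v * cis (v \<bullet> k) \<partial>lborel) = complex_of_real ((2 * pi) ^ DIM('a) * Tri (k :: 'a::euclidean_space))"
proof -
  have "(\<integral>v. R.ft (\<lambda>k. complex_of_real (Tri k)) v * cis (v \<bullet> k) \<partial>lborel) = complex_of_real ((2 * pi) ^ DIM('a)) * complex_of_real (Tri k)"
  proof (rule R.ft_inversion[OF Tri_integrable])
    show "integrable lborel (R.ft (\<lambda>k::'a. complex_of_real (Tri k)))"
      using zeta_integrable by (simp add: ft_Tri[abs_def] cong: integrable_cong)
    show "R.radial_cont (\<lambda>k. complex_of_real (Tri k)) k"
      by (intro isCont_radial continuous_intros isCont_Tri)
    show "cmod (complex_of_real (Tri y)) \<le> 1" for y :: 'a using Tri_nonneg[of y] Tri_le1[of y] by simp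
  qed simp
  then show ?thesis by (simp add: ft_Tri)
qed

text \<open>Layer-cake argument in place of polar coordinates: \<open>norm q powr (- 2 * sg)\<close>
  is written as \<open>2 * sg\<close> times a tail integral over \<open>t \<ge> norm q\<close>, and
  after the exchange only volumes of balls are needed. Enlarging the shell to the full ball makes it
  an inequality.\<close>

lemma nn_integral_norm_powr_tail:
  fixes sg a :: real
  assumes sg: "2 * sg > real DIM('a)" and a: "a > 0"
  shows "(\<integral>\<^sup>+q. (if a \<le> norm (q :: 'a::euclidean_space) then ennreal (norm q powr (- 2 * sg)) else 0) \<partial>lborel)
     \<le> ennreal (2 * sg * unit_ball_vol DIM('a) / (2 * sg - DIM('a)) * a powr (DIM('a) - 2 * sg))"
proof -
  let ?d = "real DIM('a)"
  have sg0: "sg > 0" using sg by (simp add: order_le_less_trans[of 0])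
  let ?g = "\<lambda>q t. if a \<le> norm (q :: 'a) \<and> norm q \<le> t then ennreal (t powr (- (2 * sg) - 1)) else 0"
  have "(\<integral>\<^sup>+q. (if a \<le> norm (q :: 'a) then ennreal (norm q powr (- 2 * sg)) else 0) \<partial>lborel)
     = (\<integral>\<^sup>+q. ennreal (2 * sg) * (\<integral>\<^sup>+t. ?g q t \<partial>lborel) \<partial>lborel)"
  proof (intro nn_integral_cong)
    fix q :: 'a
    show "(if a \<le> norm q then ennreal (norm q powr (- 2 * sg)) else 0) = ennreal (2 * sg) * (\<integral>\<^sup>+t. ?g q t \<partial>lborel)"
    proof (cases "a \<le> norm q")
      case True
      then have "(\<integral>\<^sup>+t. ?g q t \<partial>lborel) = (\<integral>\<^sup>+t. ennreal (t powr (- (2 * sg) - 1)) * indicator {norm q..} t \<partial>lborel)"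
        by (intro nn_integral_cong) (auto simp: indicator_def)
      also have "\<dots> = ennreal (norm q powr (- (2 * sg)) / (2 * sg))"
        using True a sg0 by (intro nn_integral_powr_tail) auto
      finally show ?thesis using True sg0 by (simp add: ennreal_mult[symmetric])
    qed simp
  qed
  also have "\<dots> = ennreal (2 * sg) * (\<integral>\<^sup>+q. (\<integral>\<^sup>+t. ?g q t \<partial>lborel) \<partial>lborel)"
    by (rule nn_integral_cmult) measurable
  also have "(\<integral>\<^sup>+q. (\<integral>\<^sup>+t. ?g q t \<partial>lborel) \<partial>lborel) = (\<integral>\<^sup>+t. (\<integral>\<^sup>+q. ?g q t \<partial>lborel) \<partial>lborel)"
    by (rule lborel_pair.Fubini'[symmetric]) measurable
  also have "\<dots> \<le> (\<integral>\<^sup>+t. ennreal (unit_ball_vol ?d) * (ennreal (t powr (- (2 * sg - ?d) - 1)) * indicator {a..} t) \<partial>lborel)"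
  proof (intro nn_integral_mono)
    fix t :: real
    show "(\<integral>\<^sup>+q. ?g q t \<partial>lborel) \<le> ennreal (unit_ball_vol ?d) * (ennreal (t powr (- (2 * sg - ?d) - 1)) * indicator {a..} t)"
    proof (cases "a \<le> t")
      case True
      have "(\<integral>\<^sup>+q. ?g q t \<partial>lborel) \<le> (\<integral>\<^sup>+q. ennreal (t powr (- (2 * sg) - 1)) * indicator (cball (0::'a) t) q \<partial>lborel)"
        by (intro nn_integral_mono) (auto simp: indicator_def)
      also have "\<dots> = ennreal (t powr (- (2 * sg) - 1)) * ennreal (unit_ball_vol ?d * t ^ DIM('a))"
        using True a by (subst nn_integral_cmult_indicator) (auto simp: emeasure_cball)
      also have "\<dots> = ennreal (unit_ball_vol ?d) * ennreal (t powr (- (2 * sg - ?d) - 1))"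
        using True a by (simp add: ennreal_mult[symmetric] powr_realpow[symmetric] powr_add[symmetric] mult_ac algebra_simps)
      finally show ?thesis using True by simp
    next
      case False
      then have "?g q t = 0" for q :: 'a by auto
      then show ?thesis by simp
    qed
  qed
  also have "\<dots> = ennreal (unit_ball_vol ?d) * ennreal (a powr (- (2 * sg - ?d)) / (2 * sg - ?d))"
    using a sg nn_integral_powr_tail[of a "2 * sg - ?d"] by (subst nn_integral_cmult) simp_all
  also have "ennreal (2 * sg) * (ennreal (unit_ball_vol ?d) * ennreal (a powr (- (2 * sg - ?d)) / (2 * sg - ?d)))
      = ennreal (2 * sg * unit_ball_vol ?d / (2 * sg - ?d) * a powr (?d - 2 * sg))"
    using sg sg0 by (simp add: ennreal_mult[symmetric])
  finally show ?thesis by (simp add: mult_left_mono)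
qed

lemma ennreal_add_power2_le: "((a::ennreal) + b)\<^sup>2 \<le> 2 * a\<^sup>2 + 2 * b\<^sup>2"
proof (cases a; cases b)
  fix x y :: real assume xy: "0 \<le> x" "a = ennreal x" "0 \<le> y" "b = ennreal y"
  have "0 \<le> (x - y)\<^sup>2" by simp
  then have "(x + y)\<^sup>2 \<le> 2 * x\<^sup>2 + 2 * y\<^sup>2" by (simp add: power2_eq_square algebra_simps)
  then have "ennreal ((x + y)\<^sup>2) \<le> ennreal (2 * x\<^sup>2 + 2 * y\<^sup>2)" by (rule ennreal_leI)
  moreover have "((a::ennreal) + b)\<^sup>2 = ennreal ((x + y)\<^sup>2)"
    using xy by (simp add: ennreal_plus[symmetric] ennreal_power del: ennreal_plus)
  moreover have "2 * a\<^sup>2 + 2 * b\<^sup>2 = ennreal (2 * x\<^sup>2 + 2 * y\<^sup>2)"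
    using xy by (simp add: ennreal_power ennreal_mult)
  ultimately show ?thesis by simp
qed (simp_all add: power2_eq_square ennreal_mult_top ennreal_top_mult)

lemma powr_power2: "(x powr t)\<^sup>2 = x powr (2 * t)" for x t :: real
  unfolding power2_eq_square powr_add[symmetric] by simp

lemma nn_integral_cball_add:
  fixes c :: ennreal
  assumes g: "g \<in> borel_measurable (borel :: 'a::euclidean_space measure)"
  shows "(\<integral>\<^sup>+q. c * indicator (cball (0::'a) a) q + g q \<partial>lborel) = c * emeasure lborel (cball (0::'a) a) + (\<integral>\<^sup>+q. g q \<partial>lborel)"
proof -
  have m: "cball (0::'a) a \<in> sets lborel" by simp
  then have "(\<lambda>q. c * indicator (cball (0::'a) a) q) \<in> borel_measurable lborel"
    by (intro borel_measurable_times_ennreal borel_measurable_indicator borel_measurable_const)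
  then show ?thesis using g nn_integral_cmult_indicator[OF m, of c] by (subst nn_integral_add) auto
qed

text \<open>Used with \<tau> = 0 and \<eta> = 1, and with \<tau> = 1 and y a particle position at which f vanishes,
  where \<eta> is small because x and y are close at the scale l.\<close>
lemma local_frequency_bound:
  fixes f :: "'a::euclidean_space \<Rightarrow> complex" and sg l :: real and x y :: 'a
  assumes sg: "2 * sg > real DIM('a)" and l: "l > 0"
    and fc: "\<And>z. isCont f z" and fb: "\<And>z. cmod (f z) \<le> b"
    and \<tau>: "\<bar>\<tau>\<bar> \<le> 1" and \<eta>: "\<eta> \<ge> 0"
    and osc: "\<And>q. norm q < 2 * real DIM('a) / l \<Longrightarrow> cmod (cis (q \<bullet> x) - complex_of_real \<tau> * cis (q \<bullet> y)) \<le> \<eta>"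
  defines "u \<equiv> \<lambda>z. zeta ((z - x) /\<^sub>R l) * f z"
    and "C1 \<equiv> 2 * (unit_ball_vol DIM('a) * (2 * real DIM('a)) ^ DIM('a))\<^sup>2 * (25 * pi) ^ DIM('a)"
    and "C2 \<equiv> 8 * (2 * sg * unit_ball_vol DIM('a) / (2 * sg - DIM('a)) * (2 * real DIM('a)) powr (DIM('a) - 2 * sg))"
  shows "ennreal ((cmod (u x - complex_of_real \<tau> * u y))\<^sup>2)
    \<le> ennreal (C1 * \<eta>\<^sup>2 / l ^ DIM('a)) * (\<integral>\<^sup>+z. ennreal (KK ((z - x) /\<^sub>R l) * (cmod (f z))\<^sup>2) \<partial>lborel)
      + ennreal (C2 * l powr (2 * sg - DIM('a))) *
        (\<integral>\<^sup>+q. (if 2 * real DIM('a) / l \<le> norm q then ennreal (norm q powr (2 * sg) * (cmod (R.ft u q))\<^sup>2) else 0) \<partial>lborel)"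
    (is "_ \<le> _ * ?Kf + _ * ?V")
proof -
  let ?d = "real DIM('a)" and ?w = "unit_ball_vol DIM('a)"
  define a where "a = 2 * ?d / l"
  have a: "a > 0" using l by (simp add: a_def)
  have sg0: "sg > 0" using sg by (simp add: order_le_less_trans[of 0])
  have w: "?w > 0" by simp
  have [measurable]: "f \<in> borel_measurable borel"
    using fc by (intro borel_measurable_continuous_onI) (simp add: continuous_on_eq_continuous_at)
  have um[measurable]: "u \<in> borel_measurable borel" unfolding u_def by measurable
  have b: "b \<ge> 0" using fb[of 0] norm_ge_zero order_trans by blast
  have KKint: "integrable lborel (\<lambda>z. KK ((z - x) /\<^sub>R l))"
    using nn_integral_KK_scaled[OF l, of x] by (intro integrableI_nonneg) auto
  have ub: "cmod (u z) \<le> (5 ^ DIM('a) * b) * KK ((z - x) /\<^sub>R l)" for z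
    unfolding u_def norm_mult using mult_mono[OF norm_zeta_le[of "(z - x) /\<^sub>R l"] fb[of z]] by (simp add: mult_ac)
  have ui: "integrable lborel u"
    by (rule Bochner_Integration.integrable_bound[OF integrable_mult_right[OF KKint, of "5 ^ DIM('a) * b"]])
      (use ub in \<open>auto intro!: AE_I2 order_trans[OF ub] abs_ge_self\<close>)
  have uc: "isCont u z" for z
    unfolding u_def by (intro continuous_intros fc isCont_o2[OF _ isCont_zeta])
  have ubd: "cmod (u z) \<le> 5 ^ DIM('a) * b" for z
    unfolding u_def norm_mult using norm_zeta_le'[of "(z - x) /\<^sub>R l"] fb[of z] by (intro mult_mono) auto
  let ?n = "\<integral>\<^sup>+z. ennreal (cmod (u z)) \<partial>lborel"
  have n: "?n = ennreal (\<integral>z. cmod (u z) \<partial>lborel)" using ui by (intro nn_integral_eq_integral) auto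
  have ftle: "ennreal (cmod (R.ft u q)) \<le> ?n" for q unfolding n by (intro ennreal_leI R.norm_ft_le ui)
  let ?t = "\<integral>\<^sup>+q. (if a \<le> norm q then ennreal (cmod (R.ft u q)) else 0) \<partial>lborel"
  \<comment> \<open>Cauchy-Schwarz with the modulus of \<open>zeta\<close> divided evenly between
    the two factors. Each factor contributes \<open>5 ^ DIM('a)\<close> from
    \<open>norm_zeta_le\<close>, and the mass of the weight is \<open>(pi * l) ^ DIM('a)\<close>,
    which explains 25.\<close>
  have nsq: "?n\<^sup>2 \<le> ennreal ((25 * pi * l) ^ DIM('a)) * ?Kf"
  proof -
    let ?z = "\<lambda>z. cmod (zeta ((z - x) /\<^sub>R l))"
    have "?n = (\<integral>\<^sup>+z. ennreal (sqrt (?z z)) * ennreal (sqrt (?z z) * cmod (f z)) \<partial>lborel)"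
      by (intro nn_integral_cong) (simp add: u_def norm_mult ennreal_mult[symmetric] mult.assoc[symmetric])
    also have "\<dots>\<^sup>2 \<le> (\<integral>\<^sup>+z. (ennreal (sqrt (?z z)))\<^sup>2 \<partial>lborel) * (\<integral>\<^sup>+z. (ennreal (sqrt (?z z) * cmod (f z)))\<^sup>2 \<partial>lborel)"
      by (rule Cauchy_Schwarz_nn_integral) measurable
    also have "\<dots> \<le> (\<integral>\<^sup>+z. ennreal (5 ^ DIM('a)) * ennreal (KK ((z - x) /\<^sub>R l)) \<partial>lborel)
        * (\<integral>\<^sup>+z. ennreal (5 ^ DIM('a)) * ennreal (KK ((z - x) /\<^sub>R l) * (cmod (f z))\<^sup>2) \<partial>lborel)"
    proof (intro mult_mono nn_integral_mono)
      fix z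
      show "(ennreal (sqrt (?z z)))\<^sup>2 \<le> ennreal (5 ^ DIM('a)) * ennreal (KK ((z - x) /\<^sub>R l))"
        using norm_zeta_le[of "(z - x) /\<^sub>R l"] by (simp add: ennreal_power ennreal_mult[symmetric] ennreal_leI)
      have "?z z * (cmod (f z))\<^sup>2 \<le> 5 ^ DIM('a) * KK ((z - x) /\<^sub>R l) * (cmod (f z))\<^sup>2"
        by (intro mult_right_mono norm_zeta_le) simp
      then show "(ennreal (sqrt (?z z) * cmod (f z)))\<^sup>2 \<le> ennreal (5 ^ DIM('a)) * ennreal (KK ((z - x) /\<^sub>R l) * (cmod (f z))\<^sup>2)"
        by (simp add: ennreal_power ennreal_mult[symmetric] power_mult_distrib mult.assoc ennreal_leI)
    qed auto
    also have "\<dots> = ennreal ((25 * pi * l) ^ DIM('a)) * ?Kf"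
    proof -
      have "5 ^ DIM('a) * (pi * l) ^ DIM('a) * 5 ^ DIM('a) = (25 * pi * l) ^ DIM('a)"
        unfolding power_mult_distrib[symmetric] by (simp add: mult_ac)
      then have "ennreal (5 ^ DIM('a)) * ennreal ((pi * l) ^ DIM('a)) * ennreal (5 ^ DIM('a)) = ennreal ((25 * pi * l) ^ DIM('a))"
        using l by (subst ennreal_mult[symmetric], simp, simp)+ simp
      then show ?thesis
        using l by (simp add: nn_integral_cmult nn_integral_KK_scaled mult.assoc[symmetric])
    qed
    finally show ?thesis .
  qed
  \<comment> \<open>Cauchy-Schwarz with weights \<open>norm q powr (- sg)\<close> and
    \<open>norm q powr sg\<close>; the first square is the tail integral, finite because
    \<open>2 * sg\<close> exceeds the dimension.\<close>
  have tsq: "?t\<^sup>2 \<le> ennreal (C2 / 8 * l powr (2 * sg - ?d)) * ?V"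
  proof -
    have "?t = (\<integral>\<^sup>+q. (if a \<le> norm q then ennreal (norm q powr (- sg)) else 0) * (if a \<le> norm q then ennreal (norm q powr sg * cmod (R.ft u q)) else 0) \<partial>lborel)"
    proof (intro nn_integral_cong)
      fix q :: 'a
      have "norm q powr (- sg) * norm q powr sg = 1" if "a \<le> norm q"
        using that a unfolding powr_add[symmetric] by auto
      then show "(if a \<le> norm q then ennreal (cmod (R.ft u q)) else 0) = (if a \<le> norm q then ennreal (norm q powr (- sg)) else 0)
          * (if a \<le> norm q then ennreal (norm q powr sg * cmod (R.ft u q)) else 0)"
        by (simp add: ennreal_mult[symmetric] mult.assoc[symmetric])
    qed
    then have cs: "?t\<^sup>2 \<le> (\<integral>\<^sup>+q. (if a \<le> norm q then ennreal (norm (q::'a) powr (- sg)) else 0)\<^sup>2 \<partial>lborel) *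
        (\<integral>\<^sup>+q. (if a \<le> norm q then ennreal (norm q powr sg * cmod (R.ft u q)) else 0)\<^sup>2 \<partial>lborel)"
      by (simp only:) (rule Cauchy_Schwarz_nn_integral; measurable)
    have e1: "(\<integral>\<^sup>+q. (if a \<le> norm q then ennreal (norm (q::'a) powr (- sg)) else 0)\<^sup>2 \<partial>lborel)
       = (\<integral>\<^sup>+q. (if a \<le> norm q then ennreal (norm (q::'a) powr (- 2 * sg)) else 0) \<partial>lborel)"
    proof (intro nn_integral_cong)
      fix q :: 'a
      have "(ennreal (norm q powr (- sg)))\<^sup>2 = ennreal (norm q powr (- 2 * sg))"
        using ennreal_power[of "norm q powr (- sg)" 2] powr_power2[of "norm q" "- sg"] by simp
      then show "(if a \<le> norm q then ennreal (norm q powr (- sg)) else 0)\<^sup>2 = (if a \<le> norm q then ennreal (norm q powr (- 2 * sg)) else 0)"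
        by (cases "a \<le> norm q") (simp_all only: if_True if_False zero_power2)
    qed
    have e2: "(\<integral>\<^sup>+q. (if a \<le> norm q then ennreal (norm q powr sg * cmod (R.ft u q)) else 0)\<^sup>2 \<partial>lborel) = ?V"
      unfolding a_def[symmetric]
    proof (intro nn_integral_cong)
      fix q :: 'a
      have "(ennreal (norm q powr sg * cmod (R.ft u q)))\<^sup>2 = ennreal (norm q powr (2 * sg) * (cmod (R.ft u q))\<^sup>2)"
        using ennreal_power[of "norm q powr sg * cmod (R.ft u q)" 2] powr_power2[of "norm q" sg]
        by (simp only: power_mult_distrib) simp
      then show "(if a \<le> norm q then ennreal (norm q powr sg * cmod (R.ft u q)) else 0)\<^sup>2
          = (if a \<le> norm q then ennreal (norm q powr (2 * sg) * (cmod (R.ft u q))\<^sup>2) else 0)"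
        by (cases "a \<le> norm q") (simp_all only: if_True if_False zero_power2)
    qed
    from cs have "?t\<^sup>2 \<le> (\<integral>\<^sup>+q. (if a \<le> norm q then ennreal (norm (q::'a) powr (- 2 * sg)) else 0) \<partial>lborel) * ?V"
      unfolding e1 e2 .
    also have "\<dots> \<le> ennreal (2 * sg * ?w / (2 * sg - ?d) * a powr (?d - 2 * sg)) * ?V"
      by (intro mult_right_mono nn_integral_norm_powr_tail sg a) simp
    also have "2 * sg * ?w / (2 * sg - ?d) * a powr (?d - 2 * sg) = C2 / 8 * l powr (2 * sg - ?d)"
    proof -
      have "a powr (?d - 2 * sg) = (2 * ?d) powr (?d - 2 * sg) * l powr (- (?d - 2 * sg))"
        unfolding a_def using l by (subst powr_divide) (simp_all add: powr_minus divide_inverse del: minus_diff_eq)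
      moreover have "C2 / 8 = 2 * sg * ?w / (2 * sg - ?d) * (2 * ?d) powr (?d - 2 * sg)"
        unfolding C2_def by (rule nonzero_mult_div_cancel_left) simp
      ultimately show ?thesis by (simp only: minus_diff_eq mult.assoc)
    qed
    finally show ?thesis .
  qed
  have C2: "C2 > 0" unfolding C2_def using sg sg0 by simp
  show ?thesis
  \<comment> \<open>A finite high-frequency energy is what makes the transform of \<open>u\<close>
    integrable, and hence inversion available: below \<open>a\<close> the transform is bounded,
    above \<open>a\<close> it is controlled by \<open>tsq\<close>. An infinite energy makes the
    bound trivial.\<close>
  proof (cases "?V = \<infinity>")
    case True
    then show ?thesis using C2 l by (simp add: ennreal_mult_eq_top_iff)
  next
    case False
    have tfin: "?t < \<infinity>"
    proof -
      have "?t\<^sup>2 < \<infinity>"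
        using False by (intro le_less_trans[OF tsq]) (auto simp: ennreal_mult_less_top less_top[symmetric] ennreal_mult_eq_top_iff)
      then show ?thesis by (simp add: power_less_top_ennreal)
    qed
    have hi: "integrable lborel (R.ft u)"
    proof (rule integrableI_bounded)
      have "(\<integral>\<^sup>+q. ennreal (norm (R.ft u q)) \<partial>lborel)
          \<le> (\<integral>\<^sup>+q. ?n * indicator (cball 0 a) q + (if a \<le> norm q then ennreal (cmod (R.ft u q)) else 0) \<partial>lborel)"
        using ftle by (intro nn_integral_mono) (auto simp: indicator_def)
      also have "\<dots> = ?n * emeasure lborel (cball (0::'a) a) + ?t"
        by (rule nn_integral_cball_add) measurable
      also have "\<dots> < \<infinity>"
        using tfin emeasure_lborel_cball_finite[of "0::'a" a] unfolding n by (simp add: ennreal_mult_less_top)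
      finally show "(\<integral>\<^sup>+q. ennreal (norm (R.ft u q)) \<partial>lborel) < \<infinity>" .
    qed measurable
    have inv: "(\<integral>q. R.ft u q * cis (q \<bullet> z) \<partial>lborel) = complex_of_real ((2 * pi) ^ DIM('a)) * u z" for z
      by (rule R.ft_inversion[OF ui hi _ ubd isCont_radial[OF uc]]) simp
    have cint: "integrable lborel (\<lambda>q. R.ft u q * cis (q \<bullet> z))" for z
      by (rule Bochner_Integration.integrable_bound[OF hi]) (auto simp: norm_mult)
    have dif: "complex_of_real ((2 * pi) ^ DIM('a)) * (u x - complex_of_real \<tau> * u y)
        = (\<integral>q. R.ft u q * (cis (q \<bullet> x) - complex_of_real \<tau> * cis (q \<bullet> y)) \<partial>lborel)"
    proof -
      have "(\<integral>q. R.ft u q * (cis (q \<bullet> x) - complex_of_real \<tau> * cis (q \<bullet> y)) \<partial>lborel)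
          = (\<integral>q. R.ft u q * cis (q \<bullet> x) - complex_of_real \<tau> * (R.ft u q * cis (q \<bullet> y)) \<partial>lborel)"
        by (intro Bochner_Integration.integral_cong refl) (simp add: algebra_simps)
      also have "\<dots> = (\<integral>q. R.ft u q * cis (q \<bullet> x) \<partial>lborel) - complex_of_real \<tau> * (\<integral>q. R.ft u q * cis (q \<bullet> y) \<partial>lborel)"
        using cint by (subst Bochner_Integration.integral_diff) auto
      finally show ?thesis unfolding inv by (simp add: algebra_simps)
    qed
    have dint: "integrable lborel (\<lambda>q. R.ft u q * (cis (q \<bullet> x) - complex_of_real \<tau> * cis (q \<bullet> y)))"
      using Bochner_Integration.integrable_diff[OF cint[of x] integrable_mult_right[OF cint[of y], of "complex_of_real \<tau>"]]
      by (simp add: algebra_simps)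
    \<comment> \<open>The factor \<open>(2 * pi) ^ DIM('a)\<close> of the inversion formula is at
      least 1 and is dropped from the smaller side.\<close>
    have pi1: "1 \<le> (2 * pi) ^ DIM('a)" using pi_gt3 by (intro one_le_power) simp
    have two: "cmod (cis (q \<bullet> x) - complex_of_real \<tau> * cis (q \<bullet> y)) \<le> 2" for q
      using norm_triangle_ineq4[of "cis (q \<bullet> x)" "complex_of_real \<tau> * cis (q \<bullet> y)"] \<tau> by (simp add: norm_mult)
    have "ennreal (cmod (u x - complex_of_real \<tau> * u y))
        \<le> ennreal (cmod (complex_of_real ((2 * pi) ^ DIM('a)) * (u x - complex_of_real \<tau> * u y)))"
      using mult_right_mono[OF pi1, of "cmod (u x - complex_of_real \<tau> * u y)"]
      by (intro ennreal_leI) (simp add: norm_mult norm_power power_mult_distrib)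
    also have "\<dots> \<le> (\<integral>\<^sup>+q. ennreal (cmod (R.ft u q * (cis (q \<bullet> x) - complex_of_real \<tau> * cis (q \<bullet> y)))) \<partial>lborel)"
      unfolding dif by (rule integral_norm_bound_ennreal[OF dint])
    \<comment> \<open>Below the cutoff the oscillation bound \<open>\<eta>\<close> is used and the
      transform is replaced by the L1 norm of \<open>u\<close>; above it, the two phases are simply
      estimated by 2.\<close>
    also have "\<dots> \<le> (\<integral>\<^sup>+q. (ennreal \<eta> * ?n) * indicator (cball 0 a) q + 2 * (if a \<le> norm q then ennreal (cmod (R.ft u q)) else 0) \<partial>lborel)"
    proof (intro nn_integral_mono)
      fix q :: 'a
      show "ennreal (cmod (R.ft u q * (cis (q \<bullet> x) - complex_of_real \<tau> * cis (q \<bullet> y))))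
        \<le> (ennreal \<eta> * ?n) * indicator (cball 0 a) q + 2 * (if a \<le> norm q then ennreal (cmod (R.ft u q)) else 0)"
      proof (cases "a \<le> norm q")
        case True
        have "ennreal (cmod (R.ft u q * (cis (q \<bullet> x) - complex_of_real \<tau> * cis (q \<bullet> y)))) \<le> ennreal (2 * cmod (R.ft u q))"
          using mult_left_mono[OF two[of q], of "cmod (R.ft u q)"] by (intro ennreal_leI) (simp add: norm_mult mult.commute)
        also have "\<dots> = 2 * ennreal (cmod (R.ft u q))" by (simp add: ennreal_mult)
        finally show ?thesis using True by (simp add: add_increasing)
      next
        case False
        then have "cmod (cis (q \<bullet> x) - complex_of_real \<tau> * cis (q \<bullet> y)) \<le> \<eta>" using osc by (simp add: a_def)
        then have "ennreal (cmod (R.ft u q * (cis (q \<bullet> x) - complex_of_real \<tau> * cis (q \<bullet> y)))) \<le> ennreal (\<eta> * cmod (R.ft u q))"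
          by (intro ennreal_leI) (simp add: norm_mult mult.commute[of \<eta>] mult_left_mono)
        also have "\<dots> = ennreal \<eta> * ennreal (cmod (R.ft u q))" using \<eta> by (simp add: ennreal_mult)
        also have "\<dots> \<le> ennreal \<eta> * ?n" by (intro mult_left_mono ftle) simp
        finally show ?thesis using False by simp
      qed
    qed
    also have "\<dots> = (ennreal \<eta> * ?n) * emeasure lborel (cball (0::'a) a) + 2 * ?t"
      by (subst nn_integral_cball_add, measurable, subst nn_integral_cmult, measurable)
    also have "\<dots> = ennreal (\<eta> * (?w * a ^ DIM('a))) * ?n + 2 * ?t"
      using a \<eta> by (simp add: emeasure_cball ennreal_mult mult_ac)
    finally have "(ennreal (cmod (u x - complex_of_real \<tau> * u y)))\<^sup>2 \<le> (ennreal (\<eta> * (?w * a ^ DIM('a))) * ?n + 2 * ?t)\<^sup>2"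
      by (rule power_mono) simp
    \<comment> \<open>Squaring the sum costs a factor 2 and the crude phase bound another 4; their
      product is the leading 8 in \<open>C2\<close>.\<close>
    also have "\<dots> \<le> 2 * (ennreal (\<eta> * (?w * a ^ DIM('a))) * ?n)\<^sup>2 + 2 * (2 * ?t)\<^sup>2"
      by (rule ennreal_add_power2_le)
    also have "\<dots> = ennreal (2 * (\<eta> * (?w * a ^ DIM('a)))\<^sup>2) * ?n\<^sup>2 + 8 * ?t\<^sup>2"
      using a \<eta> by (simp add: power_mult_distrib ennreal_power ennreal_mult mult_ac)
    also have "\<dots> \<le> ennreal (2 * (\<eta> * (?w * a ^ DIM('a)))\<^sup>2) * (ennreal ((25 * pi * l) ^ DIM('a)) * ?Kf)
        + 8 * (ennreal (C2 / 8 * l powr (2 * sg - ?d)) * ?V)"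
      by (intro add_mono mult_left_mono nsq tsq) auto
    also have "ennreal (2 * (\<eta> * (?w * a ^ DIM('a)))\<^sup>2) * (ennreal ((25 * pi * l) ^ DIM('a)) * ?Kf)
        = ennreal (C1 * \<eta>\<^sup>2 / l ^ DIM('a)) * ?Kf"
    proof -
      have "2 * (\<eta> * (?w * a ^ DIM('a)))\<^sup>2 * (25 * pi * l) ^ DIM('a) = C1 * \<eta>\<^sup>2 / l ^ DIM('a)"
      proof -
        have *: "2 * (e * (v * (A / L)))\<^sup>2 * (P * L) = 2 * (v * A)\<^sup>2 * P * e\<^sup>2 / L" if "L > 0" for e v A L P :: real
          using that by (simp add: power2_eq_square)
        have "a ^ DIM('a) = (2 * ?d) ^ DIM('a) / l ^ DIM('a)" unfolding a_def by (rule power_divide)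
        moreover have "(25 * pi * l) ^ DIM('a) = (25 * pi) ^ DIM('a) * l ^ DIM('a)" by (rule power_mult_distrib)
        ultimately show ?thesis unfolding C1_def using l by (simp only: *[OF zero_less_power])
      qed
      then show ?thesis using l by (simp add: mult.assoc[symmetric] ennreal_mult[symmetric])
    qed
    also have "8 * (ennreal (C2 / 8 * l powr (2 * sg - ?d)) * ?V) = ennreal (C2 * l powr (2 * sg - ?d)) * ?V"
    proof -
      have "8 * ennreal (C2 / 8 * l powr (2 * sg - ?d)) = ennreal (8 * (C2 / 8 * l powr (2 * sg - ?d)))"
        using C2 by (subst ennreal_mult) auto
      then show ?thesis by (simp add: mult.assoc[symmetric])
    qed
    finally show ?thesis by (simp add: ennreal_power)
  qed
qed

subsection \<open>High frequencies\<close>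

definition others :: "nat \<Rightarrow> nat \<Rightarrow> (nat \<Rightarrow> real^'d) measure" where
  "others N i = PiM ({..<N} - {i}) (\<lambda>_. lborel)"

lemma sigma_finite_others: "sigma_finite_measure (others N i)"
  unfolding others_def by (rule lb.sigma_finite) simp

lemma space_others: "space (others N i) = PiE ({..<N} - {i}) (\<lambda>_. UNIV)"
  by (simp add: others_def space_PiM)

lemma insert_others: "i < N \<Longrightarrow> insert i ({..<N} - {i}) = {..<N}" by auto

lemma others_update_measurable:
  assumes i: "i < N" and g: "g \<in> measurable K (others N i)" and h: "h \<in> measurable K lborel"
  shows "(\<lambda>z. (g z)(i := h z)) \<in> measurable K (cfg N :: (nat \<Rightarrow> real^'d) measure)"
  unfolding cfg_def
proof (rule measurable_fun_upd)
  show "{..<N} = ({..<N} - {i}) \<union> {i}" using i by auto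
qed (use g h in \<open>simp_all add: others_def\<close>)

lemma others_update_space: "i < N \<Longrightarrow> X \<in> space (others N i) \<Longrightarrow> X(i := z) \<in> cfg_space N"
  by (auto simp: space_others PiE_def extensional_def)

lemma nn_integral_cfg_split:
  assumes i: "i < N" and f: "f \<in> borel_measurable (cfg N)"
  shows "(\<integral>\<^sup>+X. f X \<partial>cfg N) = (\<integral>\<^sup>+x. (\<integral>\<^sup>+X. f (X(i := x)) \<partial>others N i) \<partial>(lborel :: (real^'d) measure))"
  using lb.product_nn_integral_insert_rev[of "{..<N} - {i}" i f] f
  unfolding others_def cfg_def insert_others[OF i] by simp

text \<open>A windowed (short-time) Fourier transform of the slice in particle \<open>i\<close>. The
  entry \<open>X i\<close> is overwritten, so \<open>X\<close> may be a configuration of all the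
  particles or of the others only.\<close>

definition wave :: "nat \<Rightarrow> ((nat \<Rightarrow> real^'d) \<Rightarrow> complex) \<Rightarrow> real \<Rightarrow> real^'d \<Rightarrow> (nat \<Rightarrow> real^'d) \<Rightarrow> real^'d \<Rightarrow> complex" where
  "wave i f l x X q = R.ft (\<lambda>z. zeta ((z - x) /\<^sub>R l) * f (X(i := z))) q"

text \<open>Share of particle \<open>i\<close> in the density G of the overview. The weight has the
  exponent \<open>sg\<close>, not \<open>s\<close>; the missing power of the frequency is produced
  later by integrating over \<open>l\<close>.\<close>

definition gdens :: "real \<Rightarrow> nat \<Rightarrow> nat \<Rightarrow> ((nat \<Rightarrow> real^'d) \<Rightarrow> complex) \<Rightarrow> real \<Rightarrow> real^'d \<Rightarrow> ennreal" where
  "gdens sg N i f l x = (\<integral>\<^sup>+X. (\<integral>\<^sup>+q. (if 2 * real CARD('d) / l \<le> norm q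
      then ennreal (norm q powr (2 * sg) * (cmod (wave i f l x X q))\<^sup>2) else 0) \<partial>lborel) \<partial>others N i)"

text \<open>As a function of x = X i and the other particles, the localised transform at frequency q is, up to a
  phase, the convolution of f with this kernel in the i-th particle.\<close>
definition kap :: "real \<Rightarrow> real^'d \<Rightarrow> real^'d \<Rightarrow> complex" where
  "kap l q w = cis (q \<bullet> w) * zeta (- (w /\<^sub>R l))"

lemma integral_affine:
  fixes f :: "'a::euclidean_space \<Rightarrow> complex"
  assumes [measurable]: "f \<in> borel_measurable borel" and c: "c \<noteq> 0"
  shows "(\<integral>x. f x \<partial>lborel) = complex_of_real (\<bar>c\<bar> ^ DIM('a)) * (\<integral>x. f (t + c *\<^sub>R x) \<partial>lborel)"
proof -
  have "(\<integral>x. f x \<partial>lborel) = (\<integral>x. f x \<partial>density (distr lborel borel (\<lambda>x. t + c *\<^sub>R x)) (\<lambda>_. ennreal (\<bar>c\<bar> ^ DIM('a))))"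
    using lborel_affine[OF c, of t] by (simp add: ennreal_power)
  also have "\<dots> = (\<integral>x. (\<bar>c\<bar> ^ DIM('a)) *\<^sub>R f (t + c *\<^sub>R x) \<partial>lborel)"
    by (subst integral_density) (simp_all add: integral_distr)
  also have "\<dots> = (\<integral>x. complex_of_real (\<bar>c\<bar> ^ DIM('a)) * f (t + c *\<^sub>R x) \<partial>lborel)"
    by (simp add: scaleR_conv_of_real)
  finally show ?thesis by (simp only: Bochner_Integration.integral_mult_right_zero)
qed

lemma kap_measurable [measurable]: "kap l q \<in> borel_measurable borel"
  unfolding kap_def[abs_def] by measurable

lemma kap_integrable:
  assumes l: "l > 0" shows "integrable lborel (kap l q :: real^'d \<Rightarrow> complex)"
proof (rule integrableI_bounded)
  have "(\<integral>\<^sup>+w. ennreal (norm (kap l q w)) \<partial>lborel) \<le> (\<integral>\<^sup>+w. ennreal (5 ^ CARD('d)) * ennreal (KK ((w - 0) /\<^sub>R l)) \<partial>(lborel :: (real^'d) measure))"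
  proof (intro nn_integral_mono)
    fix w :: "real^'d"
    show "ennreal (norm (kap l q w)) \<le> ennreal (5 ^ CARD('d)) * ennreal (KK ((w - 0) /\<^sub>R l))"
      using norm_zeta_le[of "- (w /\<^sub>R l)"]
      by (simp add: kap_def norm_mult ennreal_mult[symmetric] ennreal_leI)
  qed
  also have "\<dots> < \<infinity>"
    using nn_integral_KK_scaled[OF l, of "0 :: real^'d"]
    by (subst nn_integral_cmult) (auto simp: ennreal_mult_less_top)
  finally show "(\<integral>\<^sup>+w. ennreal (norm (kap l q (w :: real^'d))) \<partial>lborel) < \<infinity>" .
qed (use kap_measurable in simp)

text \<open>The substitution \<open>w = - l * v\<close> reduces the claim to
  \<open>zeta_hat\<close>: modulation by \<open>q\<close> and dilation by \<open>l\<close> turn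
  \<open>Tri\<close> into a bump centred at \<open>q\<close> of width \<open>1 / l\<close>. This is
  where band limitation enters.\<close>

lemma ft_kap:
  assumes l: "l > 0"
  shows "R.ft (kap l q) p = complex_of_real ((2 * pi * l) ^ CARD('d) * Tri (l *\<^sub>R (p - q :: real^'d)))"
proof -
  have "R.ft (kap l q) p = complex_of_real (\<bar>- l\<bar> ^ DIM(real^'d)) * (\<integral>v. cis (- (p \<bullet> (0 + (- l) *\<^sub>R v))) * kap l q (0 + (- l) *\<^sub>R v) \<partial>lborel)"
    unfolding R.ft_def using l by (intro integral_affine) auto
  also have "(\<integral>v. cis (- (p \<bullet> (0 + (- l) *\<^sub>R v))) * kap l q (0 + (- l) *\<^sub>R v) \<partial>lborel) = (\<integral>v. zeta v * cis (v \<bullet> (l *\<^sub>R (p - q))) \<partial>lborel)"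
  proof (intro Bochner_Integration.integral_cong refl)
    fix v :: "real^'d"
    have k: "kap l q (0 + (- l) *\<^sub>R v) = cis (- (l * (q \<bullet> v))) * zeta v"
      using l unfolding kap_def by simp
    have e: "v \<bullet> (l *\<^sub>R (p - q)) = l * (p \<bullet> v) + - (l * (q \<bullet> v))"
      by (simp add: inner_diff_right inner_commute[of v] right_diff_distrib)
    show "cis (- (p \<bullet> (0 + (- l) *\<^sub>R v))) * kap l q (0 + (- l) *\<^sub>R v) = zeta v * cis (v \<bullet> (l *\<^sub>R (p - q)))"
      unfolding k e cis_mult[symmetric] by simp
  qed
  also have "complex_of_real (\<bar>- l\<bar> ^ DIM(real^'d)) * \<dots> = complex_of_real ((2 * pi * l) ^ CARD('d) * Tri (l *\<^sub>R (p - q)))"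
  proof -
    have "\<bar>- l\<bar> ^ DIM(real^'d) * ((2 * pi) ^ DIM(real^'d) * t) = (2 * pi * l) ^ CARD('d) * t" for t
      using l by (simp add: power_mult_distrib)
    then show ?thesis unfolding zeta_hat of_real_mult[symmetric] by (intro arg_cong[where f=complex_of_real])
  qed
  finally show ?thesis .
qed

lemma norm_ft_kap:
  assumes l: "l > 0"
  shows "(cmod (R.ft (kap l q) p))\<^sup>2 \<le> (if norm (p - q :: real^'d) < real CARD('d) / l then (2 * pi * l) ^ (2 * CARD('d)) else 0)"
proof (cases "norm (p - q) < real CARD('d) / l")
  case True
  have "\<bar>Tri (l *\<^sub>R (p - q))\<bar> \<le> 1" using Tri_nonneg[of "l *\<^sub>R (p - q)"] Tri_le1[of "l *\<^sub>R (p - q)"] by simp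
  then have "cmod (R.ft (kap l q) p) \<le> (2 * pi * l) ^ CARD('d)"
    using l unfolding ft_kap[OF l] norm_of_real abs_mult by (simp add: mult_left_le)
  then have "(cmod (R.ft (kap l q) p))\<^sup>2 \<le> ((2 * pi * l) ^ CARD('d))\<^sup>2" by (rule power_mono) simp
  then show ?thesis using True by (simp add: power_mult[symmetric] mult.commute)
next
  case False
  then have "real CARD('d) \<le> l * norm (p - q)" using l by (simp add: field_simps)
  also have "\<dots> = norm (l *\<^sub>R (p - q))" using l by (subst norm_scaleR) simp
  finally have "Tri (l *\<^sub>R (p - q)) = 0" by (intro Tri_support) simp
  then show ?thesis using False by (simp add: ft_kap[OF l])
qed

context
  fixes N i :: nat and f :: "(nat \<Rightarrow> real^'d) \<Rightarrow> complex" and R sg :: real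
  assumes i: "i < N" and f: "cont_cfg N f" "supp_in N R f" and sg: "2 * sg > real CARD('d)"
begin

lemma f_update_measurable [measurable (raw)]:
  "g \<in> measurable K (others N i) \<Longrightarrow> h \<in> measurable K lborel \<Longrightarrow> (\<lambda>z. f ((g z)(i := h z))) \<in> borel_measurable K"
  by (rule measurable_compose[OF others_update_measurable[OF i] cont_cfg_measurable[OF f(1)]])

lemma wave_measurable:
  "(\<lambda>(l, x, X, q). wave i f l x X q) \<in> borel_measurable (borel \<Otimes>\<^sub>M borel \<Otimes>\<^sub>M others N i \<Otimes>\<^sub>M borel)"
  unfolding wave_def R.ft_def case_prod_beta by measurable

lemma wave_measurable' [measurable (raw)]:
  assumes "a \<in> borel_measurable K" "b \<in> borel_measurable K" "c \<in> measurable K (others N i)" "d \<in> borel_measurable K"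
  shows "(\<lambda>z. wave i f (a z) (b z) (c z) (d z)) \<in> borel_measurable K"
  using measurable_compose[OF measurable_Pair[OF assms(1) measurable_Pair[OF assms(2) measurable_Pair[OF assms(3) assms(4)]]] wave_measurable]
  by simp

lemma wave_cconv:
  assumes l: "l > 0" and X: "X \<in> space (cfg N)"
  shows "cmod (cconv i (kap l q) f X) = cmod (wave i f l (X i) X q)"
proof -
  have [measurable]: "(\<lambda>w. f (X(i := X i - w))) \<in> borel_measurable lborel"
    using X by (intro cfg_update_compose[OF i cont_cfg_measurable[OF f(1)]]) auto
  have "cconv i (kap l q) f X = complex_of_real (\<bar>-1\<bar> ^ DIM(real^'d)) * (\<integral>z. kap l q (X i + (-1) *\<^sub>R z) * f (X(i := X i - (X i + (-1) *\<^sub>R z))) \<partial>lborel)"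
    unfolding cconv_def by (intro integral_affine) auto
  also have "\<dots> = (\<integral>z. cis (q \<bullet> X i) * (cis (- (q \<bullet> z)) * (zeta ((z - X i) /\<^sub>R l) * f (X(i := z)))) \<partial>lborel)"
    by (simp add: kap_def inner_diff_right cis_mult mult.assoc[symmetric] scaleR_minus_right[symmetric] del: scaleR_minus_right)
  also have "\<dots> = cis (q \<bullet> X i) * wave i f l (X i) X q"
    unfolding wave_def R.ft_def by (rule Bochner_Integration.integral_mult_right_zero)
  finally show ?thesis by (simp add: norm_mult)
qed

lemma wave_update: "wave i f l x (X(i := y)) q = wave i f l x X q"
  unfolding wave_def by simp

text \<open>Twice the exponent in \<open>FT_eq\<close> is minus the dimension, so the factor of the
  unnormalised Plancherel identity cancels the squared normalisation of \<open>FT\<close>.\<close>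

lemma FT_norm: "ennreal ((2 * pi) ^ (CARD('d) * N)) * ennreal (c * (cmod (FT N f p))\<^sup>2) = ennreal (c * (cmod (C.ft N f p))\<^sup>2)" if "c \<ge> 0"
proof -
  let ?n = "CARD('d) * N" and ?r = "(2 * pi) powr (- real (CARD('d) * N) / 2)"
  have r: "?r\<^sup>2 = (2 * pi) powr (- real ?n)"
    unfolding powr_power2 by simp
  have "(2 * pi) ^ ?n = (2 * pi) powr real ?n" by (rule powr_realpow[symmetric]) simp
  then have one: "(2 * pi) ^ ?n * ?r\<^sup>2 = 1"
    unfolding r by (simp only: powr_add[symmetric]) simp
  have "(cmod (FT N f p))\<^sup>2 = ?r\<^sup>2 * (cmod (C.ft N f p))\<^sup>2"
    unfolding FT_eq norm_mult power_mult_distrib by simp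
  moreover have "a * (c * (b * t)) = (a * b) * (c * t)" for a b t :: real by simp
  ultimately have "(2 * pi) ^ ?n * (c * (cmod (FT N f p))\<^sup>2) = c * (cmod (C.ft N f p))\<^sup>2"
    using one by (simp only: mult_1_left)
  moreover have "ennreal ((2 * pi) ^ ?n) * ennreal (c * (cmod (FT N f p))\<^sup>2) = ennreal ((2 * pi) ^ ?n * (c * (cmod (FT N f p))\<^sup>2))"
    using that by (intro ennreal_mult[symmetric]) simp_all
  ultimately show ?thesis by (simp only:)
qed

lemma FT_measurable [measurable]: "FT N f \<in> borel_measurable (cfg N)"
proof -
  note [measurable] = cont_cfg_measurable[OF f(1)]
  show ?thesis unfolding FT_eq[abs_def] by measurable
qed

text \<open>Integrating over the window centre \<open>x\<close> together with the other particles
  restores an integral over all configurations with \<open>x = X i\<close>. There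
  \<open>wave\<close> is, up to a phase, a convolution, and Plancherel leaves only the momenta with
  \<open>p i\<close> within \<open>d / l\<close> of \<open>q\<close>.\<close>

lemma wave_plancherel:
  assumes l: "l > 0"
  shows "(\<integral>\<^sup>+x. (\<integral>\<^sup>+X. ennreal ((cmod (wave i f l x X q))\<^sup>2) \<partial>others N i) \<partial>lborel)
     \<le> (\<integral>\<^sup>+p. (if norm (p i - q) < real CARD('d) / l then ennreal ((2 * pi * l) ^ (2 * CARD('d)) * (cmod (FT N f p))\<^sup>2) else 0) \<partial>cfg N)"
    (is "?L \<le> ?Rt")
proof -
  note [measurable] = cont_cfg_measurable[OF f(1)] i
  let ?c = "(2 * pi) ^ (CARD('d) * N)"
  have [measurable]: "cconv i (kap l q) f \<in> borel_measurable (cfg N)"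
    using cconv_integrable[OF i kap_integrable[OF l] f] by auto
  have "?L = (\<integral>\<^sup>+x. (\<integral>\<^sup>+X. ennreal ((cmod (cconv i (kap l q) f (X(i := x))))\<^sup>2) \<partial>others N i) \<partial>lborel)"
  proof (intro nn_integral_cong)
    fix x and X :: "nat \<Rightarrow> real^'d" assume "X \<in> space (others N i)"
    then have "X(i := x) \<in> space (cfg N)" unfolding space_cfg by (rule others_update_space[OF i])
    from wave_cconv[OF l this, of q]
    show "ennreal ((cmod (wave i f l x X q))\<^sup>2) = ennreal ((cmod (cconv i (kap l q) f (X(i := x))))\<^sup>2)"
      by (simp add: wave_update)
  qed
  also have "\<dots> = (\<integral>\<^sup>+X. ennreal ((cmod (cconv i (kap l q) f X))\<^sup>2) \<partial>cfg N)"
    by (rule nn_integral_cfg_split[OF i, symmetric]) measurable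
  finally have "ennreal ?c * ?L = (\<integral>\<^sup>+p. ennreal ((cmod (R.ft (kap l q) (p i)))\<^sup>2 * (cmod (C.ft N f p))\<^sup>2) \<partial>cfg N)"
    using cconv_plancherel[OF i kap_integrable[OF l] f] by simp
  also have "\<dots> = (\<integral>\<^sup>+p. ennreal ?c * ennreal ((cmod (R.ft (kap l q) (p i)))\<^sup>2 * (cmod (FT N f p))\<^sup>2) \<partial>cfg N)"
    by (intro nn_integral_cong FT_norm[symmetric]) simp
  also have "\<dots> \<le> (\<integral>\<^sup>+p. ennreal ?c * (if norm (p i - q) < real CARD('d) / l then ennreal ((2 * pi * l) ^ (2 * CARD('d)) * (cmod (FT N f p))\<^sup>2) else 0) \<partial>cfg N)"
  proof (intro nn_integral_mono mult_left_mono)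
    fix p :: "nat \<Rightarrow> real^'d"
    show "ennreal ((cmod (R.ft (kap l q) (p i)))\<^sup>2 * (cmod (FT N f p))\<^sup>2)
       \<le> (if norm (p i - q) < real CARD('d) / l then ennreal ((2 * pi * l) ^ (2 * CARD('d)) * (cmod (FT N f p))\<^sup>2) else 0)"
      using norm_ft_kap[OF l, of q "p i"] by (auto intro!: ennreal_leI mult_right_mono split: if_splits)
  qed simp
  also have "\<dots> = ennreal ?c * ?Rt"
    by (rule nn_integral_cmult) measurable
  finally have "ennreal ?c * ?L \<le> ennreal ?c * ?Rt" .
  then show ?thesis
    by (subst (asm) ennreal_mult_le_mult_iff) auto
qed

text \<open>If \<open>norm q \<ge> 2 * d / l\<close> and \<open>norm (p i - q) < d / l\<close>, then
  \<open>norm (p i) \<ge> d / l\<close> and \<open>norm q \<le> 2 * norm (p i)\<close>; the factor 2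
  in the cutoff is chosen for this. The weight in \<open>q\<close> then becomes one in
  \<open>p i\<close>, and \<open>q\<close> runs over a ball of radius \<open>d / l\<close>. Its
  volume against \<open>(2 * pi * l) ^ (2 * d)\<close> leaves the power
  \<open>l ^ d\<close>.\<close>

lemma nn_integral_gdens:
  assumes l: "l > 0"
  shows "(\<integral>\<^sup>+x. gdens sg N i f l x \<partial>lborel)
    \<le> ennreal ((2 * pi) ^ (2 * CARD('d)) * 2 powr (2 * sg) * unit_ball_vol CARD('d) * real CARD('d) ^ CARD('d) * l ^ CARD('d)) *
      (\<integral>\<^sup>+p. (if real CARD('d) / l \<le> norm (p i) then ennreal (norm (p i) powr (2 * sg) * (cmod (FT N f p))\<^sup>2) else 0) \<partial>cfg N)"
    (is "_ \<le> ennreal ?C * _")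
proof -
  let ?d = "real CARD('d)"
  note [measurable] = i
  interpret o: sigma_finite_measure "others N i" by (rule sigma_finite_others)
  interpret oq: pair_sigma_finite "others N i" "lborel :: (real^'d) measure" ..
  interpret cq: pair_sigma_finite "cfg N :: (nat \<Rightarrow> real^'d) measure" "lborel :: (real^'d) measure"
    by (intro pair_sigma_finite.intro sigma_finite_cfg lborel.sigma_finite_measure_axioms)
  have sg0: "sg > 0" using sg by (simp add: order_le_less_trans[of 0])
  let ?F = "\<lambda>x X q. if 2 * ?d / l \<le> norm q then ennreal (norm q powr (2 * sg) * (cmod (wave i f l x X q))\<^sup>2) else 0"
  let ?H = "\<lambda>p q. if norm (p i - q) < ?d / l then ennreal ((2 * pi * l) ^ (2 * CARD('d)) * (cmod (FT N f p))\<^sup>2) else 0"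
  have "(\<integral>\<^sup>+x. gdens sg N i f l x \<partial>lborel) = (\<integral>\<^sup>+x. (\<integral>\<^sup>+q. (\<integral>\<^sup>+X. ?F x X q \<partial>others N i) \<partial>lborel) \<partial>lborel)"
    unfolding gdens_def by (intro nn_integral_cong oq.Fubini'[symmetric]) measurable
  also have "\<dots> = (\<integral>\<^sup>+q. (\<integral>\<^sup>+x. (\<integral>\<^sup>+X. ?F x X q \<partial>others N i) \<partial>lborel) \<partial>lborel)"
    by (rule lborel_pair.Fubini'[symmetric]) measurable
  also have "\<dots> = (\<integral>\<^sup>+q. (if 2 * ?d / l \<le> norm q then ennreal (norm q powr (2 * sg)) else 0) *
      (\<integral>\<^sup>+x. (\<integral>\<^sup>+X. ennreal ((cmod (wave i f l x X q))\<^sup>2) \<partial>others N i) \<partial>lborel) \<partial>lborel)"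
  proof (intro nn_integral_cong)
    fix q :: "real^'d"
    show "(\<integral>\<^sup>+x. (\<integral>\<^sup>+X. ?F x X q \<partial>others N i) \<partial>lborel) = (if 2 * ?d / l \<le> norm q then ennreal (norm q powr (2 * sg)) else 0) *
      (\<integral>\<^sup>+x. (\<integral>\<^sup>+X. ennreal ((cmod (wave i f l x X q))\<^sup>2) \<partial>others N i) \<partial>lborel)"
    proof (cases "2 * ?d / l \<le> norm q")
      case True
      then have "(\<integral>\<^sup>+x. (\<integral>\<^sup>+X. ?F x X q \<partial>others N i) \<partial>lborel)
         = (\<integral>\<^sup>+x. (\<integral>\<^sup>+X. ennreal (norm q powr (2 * sg)) * ennreal ((cmod (wave i f l x X q))\<^sup>2) \<partial>others N i) \<partial>lborel)"
        by (simp add: ennreal_mult)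
      also have "\<dots> = (\<integral>\<^sup>+x. ennreal (norm q powr (2 * sg)) * (\<integral>\<^sup>+X. ennreal ((cmod (wave i f l x X q))\<^sup>2) \<partial>others N i) \<partial>lborel)"
        by (intro nn_integral_cong nn_integral_cmult) measurable
      also have "\<dots> = ennreal (norm q powr (2 * sg)) * (\<integral>\<^sup>+x. (\<integral>\<^sup>+X. ennreal ((cmod (wave i f l x X q))\<^sup>2) \<partial>others N i) \<partial>lborel)"
        by (rule nn_integral_cmult) measurable
      finally show ?thesis using True by simp
    qed simp
  qed
  also have "\<dots> \<le> (\<integral>\<^sup>+q. (if 2 * ?d / l \<le> norm q then ennreal (norm q powr (2 * sg)) else 0) * (\<integral>\<^sup>+p. ?H p q \<partial>cfg N) \<partial>lborel)"
    by (intro nn_integral_mono mult_left_mono wave_plancherel[OF l]) simp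
  also have "\<dots> = (\<integral>\<^sup>+q. (\<integral>\<^sup>+p. (if 2 * ?d / l \<le> norm q then ennreal (norm q powr (2 * sg)) else 0) * ?H p q \<partial>cfg N) \<partial>lborel)"
    by (intro nn_integral_cong nn_integral_cmult[symmetric]) measurable
  also have "\<dots> = (\<integral>\<^sup>+p. (\<integral>\<^sup>+q. (if 2 * ?d / l \<le> norm q then ennreal (norm q powr (2 * sg)) else 0) * ?H p q \<partial>lborel) \<partial>cfg N)"
    by (rule cq.Fubini') measurable
  also have "\<dots> \<le> (\<integral>\<^sup>+p. ennreal ?C * (if ?d / l \<le> norm (p i) then ennreal (norm (p i) powr (2 * sg) * (cmod (FT N f p))\<^sup>2) else 0) \<partial>cfg N)"
  proof (intro nn_integral_mono)
    fix p :: "nat \<Rightarrow> real^'d"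
    let ?F2 = "(cmod (FT N f p))\<^sup>2"
    let ?b = "(2 * norm (p i)) powr (2 * sg) * ((2 * pi * l) ^ (2 * CARD('d)) * ?F2)"
    have geo: "?d / l \<le> norm (p i) \<and> norm q \<le> 2 * norm (p i)" if "2 * ?d / l \<le> norm q" "norm (p i - q) < ?d / l" for q
    proof -
      have "norm q - norm (p i) \<le> norm (p i - q)" using norm_triangle_ineq2[of q "p i"] by (simp add: norm_minus_commute)
      moreover have "2 * ?d / l = 2 * (?d / l)" by simp
      ultimately show ?thesis using that by linarith
    qed
    show "(\<integral>\<^sup>+q. (if 2 * ?d / l \<le> norm q then ennreal (norm q powr (2 * sg)) else 0) * ?H p q \<partial>lborel)
       \<le> ennreal ?C * (if ?d / l \<le> norm (p i) then ennreal (norm (p i) powr (2 * sg) * ?F2) else 0)"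
    proof (cases "?d / l \<le> norm (p i)")
      case True
      have "(\<integral>\<^sup>+q. (if 2 * ?d / l \<le> norm q then ennreal (norm q powr (2 * sg)) else 0) * ?H p q \<partial>lborel)
         \<le> (\<integral>\<^sup>+q. ennreal ?b * indicator (ball (p i) (?d / l)) q \<partial>lborel)"
      proof (intro nn_integral_mono)
        fix q :: "real^'d"
        show "(if 2 * ?d / l \<le> norm q then ennreal (norm q powr (2 * sg)) else 0) * ?H p q \<le> ennreal ?b * indicator (ball (p i) (?d / l)) q"
        proof (cases "2 * ?d / l \<le> norm q \<and> norm (p i - q) < ?d / l")
          case T: True
          have "norm q powr (2 * sg) \<le> (2 * norm (p i)) powr (2 * sg)"
            using geo[of q] T sg0 by (intro powr_mono2) auto
          then have "norm q powr (2 * sg) * ((2 * pi * l) ^ (2 * CARD('d)) * ?F2) \<le> ?b"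
            using l by (intro mult_right_mono) auto
          then show ?thesis using T l by (simp add: ennreal_mult[symmetric] ennreal_leI dist_norm indicator_def)
        qed auto
      qed
      also have "\<dots> = ennreal ?b * emeasure lborel (ball (p i) (?d / l))"
        by (rule nn_integral_cmult_indicator) simp
      also have "\<dots> = ennreal (?b * (unit_ball_vol ?d * (?d / l) ^ CARD('d)))"
        using l by (simp add: emeasure_ball ennreal_mult)
      also have "?b * (unit_ball_vol ?d * (?d / l) ^ CARD('d)) = ?C * (norm (p i) powr (2 * sg) * ?F2)"
      proof -
        have "(2 * norm (p i)) powr (2 * sg) = 2 powr (2 * sg) * norm (p i) powr (2 * sg)" by (rule powr_mult)
        moreover have "(2 * pi * l) ^ (2 * CARD('d)) = (2 * pi) ^ (2 * CARD('d)) * (l ^ CARD('d) * l ^ CARD('d))"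
          by (simp only: power_mult_distrib[of "2 * pi" l] power_add[symmetric] mult_2[of "CARD('d)"])
        moreover have "(?d / l) ^ CARD('d) = ?d ^ CARD('d) / l ^ CARD('d)" by (rule power_divide)
        moreover have "(a * b) * ((e * (L * L)) * F) * (w * (D / L)) = e * a * w * D * L * (b * F)"
          if "L > 0" for a b e L F w D :: real using that by simp
        ultimately show ?thesis using l by (simp only: zero_less_power)
      qed
      finally show ?thesis using True l by (simp add: ennreal_mult)
    next
      case False
      then have "(if 2 * ?d / l \<le> norm q then ennreal (norm q powr (2 * sg)) else 0) * ?H p q = 0" for q
        using geo[of q] by auto
      then have "(\<integral>\<^sup>+q. (if 2 * ?d / l \<le> norm q then ennreal (norm q powr (2 * sg)) else 0) * ?H p q \<partial>lborel) = (\<integral>\<^sup>+q. 0 \<partial>(lborel :: (real^'d) measure))"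
        by (rule nn_integral_cong)
      then show ?thesis by (simp only: nn_integral_const mult_zero_left zero_le)
    qed
  qed
  also have "\<dots> = ennreal ?C * (\<integral>\<^sup>+p. (if ?d / l \<le> norm (p i) then ennreal (norm (p i) powr (2 * sg) * (cmod (FT N f p))\<^sup>2) else 0) \<partial>cfg N)"
    by (rule nn_integral_cmult) measurable
  finally show ?thesis .
qed

end

declare measurable_cfg_coord [measurable del]

subsection \<open>Isolated particles and the pointwise density bound\<close>

text \<open>Balls of radius \<open>\<epsilon> * l / 2\<close> around isolated particles are
  disjoint, and on each of them \<open>KK_harnack\<close> compares the weight with its value at the
  centre. The sum is thus at most a multiple of the total mass of the weight divided by the volume
  of one ball: \<open>l\<close> cancels and \<open>N\<close> does not enter.\<close>

lemma KK_packing: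
  fixes X :: "nat \<Rightarrow> real^'d" and w :: "real^'d" and l \<epsilon> :: real
  assumes l: "l > 0" and \<epsilon>: "0 < \<epsilon>" "\<epsilon> \<le> 1"
  shows "(\<Sum>i<N. if (\<forall>j<N. j \<noteq> i \<longrightarrow> \<epsilon> * l < norm (X j - X i)) then ennreal (KK ((X i - w) /\<^sub>R l)) else 0)
     \<le> ennreal ((3 * pi) ^ CARD('d) / (unit_ball_vol CARD('d) * (\<epsilon> / 2) ^ CARD('d)))"
proof -
  let ?d = "CARD('d)"
  define S where "S = {i. i < N \<and> (\<forall>j<N. j \<noteq> i \<longrightarrow> \<epsilon> * l < norm (X j - X i))}"
  have S: "finite S" unfolding S_def by simp
  define r where "r = \<epsilon> * l / 2"
  have r: "r > 0" "2 * r = \<epsilon> * l" using l \<epsilon> by (auto simp: r_def)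
  define v where "v = unit_ball_vol (real ?d) * r ^ ?d"
  have v: "v > 0" unfolding v_def using r by simp
  let ?k = "\<lambda>i. KK ((X i - w) /\<^sub>R l)"
  have "ennreal v * (\<Sum>i\<in>S. ennreal (?k i)) = (\<Sum>i\<in>S. (\<integral>\<^sup>+y. ennreal (?k i) * indicator (ball (X i) r) y \<partial>lborel))"
    unfolding sum_distrib_left
  proof (intro sum.cong refl)
    fix i
    have "(\<integral>\<^sup>+y. ennreal (?k i) * indicator (ball (X i) r) y \<partial>lborel) = ennreal (?k i) * emeasure lborel (ball (X i) r)"
      by (rule nn_integral_cmult_indicator) simp
    then show "ennreal v * ennreal (?k i) = (\<integral>\<^sup>+y. ennreal (?k i) * indicator (ball (X i) r) y \<partial>lborel)"
      using r by (simp add: emeasure_ball v_def mult.commute)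
  qed
  also have "\<dots> \<le> (\<Sum>i\<in>S. (\<integral>\<^sup>+y. ennreal (3 ^ ?d * KK ((y - w) /\<^sub>R l)) * indicator (ball (X i) r) y \<partial>lborel))"
  proof (intro sum_mono nn_integral_mono)
    fix i y
    show "ennreal (?k i) * indicator (ball (X i) r) y \<le> ennreal (3 ^ ?d * KK ((y - w) /\<^sub>R l)) * indicator (ball (X i) r) y"
    proof (cases "y \<in> ball (X i) r")
      case True
      then have "norm (X i - y) < r" by (simp add: dist_norm)
      moreover have "\<epsilon> * l \<le> l" using \<epsilon> l by (simp add: mult_le_cancel_right1)
      then have "r \<le> l" using r by linarith
      moreover have "norm ((X i - y) /\<^sub>R l) = norm (X i - y) / l"
        using l by (subst norm_scaleR) (simp add: divide_inverse mult.commute)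
      ultimately have "norm ((X i - y) /\<^sub>R l) \<le> 1" using l by simp
      moreover have "(X i - w) /\<^sub>R l - (y - w) /\<^sub>R l = (X i - y) /\<^sub>R l"
        by (simp add: scaleR_diff_right)
      ultimately have "?k i \<le> 3 ^ DIM(real^'d) * KK ((y - w) /\<^sub>R l)" by (intro KK_harnack) simp
      then show ?thesis using True by (simp add: ennreal_leI)
    qed simp
  qed
  also have "\<dots> = (\<integral>\<^sup>+y. (\<Sum>i\<in>S. ennreal (3 ^ ?d * KK ((y - w) /\<^sub>R l)) * indicator (ball (X i) r) y) \<partial>lborel)"
    by (intro nn_integral_sum[symmetric] borel_measurable_times_ennreal borel_measurable_indicator) auto
  also have "\<dots> \<le> (\<integral>\<^sup>+y. ennreal (3 ^ ?d) * ennreal (KK ((y - w) /\<^sub>R l)) \<partial>lborel)"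
  proof (intro nn_integral_mono)
    fix y
    have "(\<Sum>i\<in>S. indicator (ball (X i) r) y) \<le> (1 :: ennreal)"
    proof (cases "\<exists>i\<in>S. y \<in> ball (X i) r")
      case True
      then obtain i where i: "i \<in> S" "y \<in> ball (X i) r" by auto
      have "y \<notin> ball (X j) r" if "j \<in> S" "j \<noteq> i" for j
      proof
        assume "y \<in> ball (X j) r"
        then have "norm (X j - y) < r" "norm (X i - y) < r" using i(2) by (auto simp: dist_norm)
        then have "norm (X j - X i) < 2 * r"
          using norm_triangle_ineq4[of "X j - y" "X i - y"] by simp
        moreover have "\<epsilon> * l < norm (X j - X i)" using i(1) that unfolding S_def by auto
        ultimately show False using r by simp
      qed
      then have "(\<Sum>j\<in>S. indicator (ball (X j) r) y) = (\<Sum>j\<in>{i}. indicator (ball (X j) r) y :: ennreal)"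
        using S i(1) by (intro sum.mono_neutral_right) (auto simp: indicator_def)
      then show ?thesis using i(2) by (simp only: sum.insert finite.emptyI sum.empty) simp
    next
      case False
      then have "(\<Sum>i\<in>S. indicator (ball (X i) r) y) = (0 :: ennreal)" by (intro sum.neutral) (auto simp: indicator_def)
      then show ?thesis by simp
    qed
    then have "ennreal (3 ^ ?d * KK ((y - w) /\<^sub>R l)) * (\<Sum>i\<in>S. indicator (ball (X i) r) y) \<le> ennreal (3 ^ ?d * KK ((y - w) /\<^sub>R l)) * 1"
      by (rule mult_left_mono) simp
    then show "(\<Sum>i\<in>S. ennreal (3 ^ ?d * KK ((y - w) /\<^sub>R l)) * indicator (ball (X i) r) y) \<le> ennreal (3 ^ ?d) * ennreal (KK ((y - w) /\<^sub>R l))"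
      by (simp add: sum_distrib_left[symmetric] ennreal_mult[symmetric])
  qed
  also have "\<dots> = ennreal (3 ^ ?d) * ennreal ((pi * l) ^ ?d)"
    using nn_integral_KK_scaled[OF l, of w] by (subst nn_integral_cmult) simp_all
  also have "\<dots> = ennreal (3 ^ ?d * (pi * l) ^ ?d)"
    using l by (intro ennreal_mult[symmetric]) simp_all
  finally have *: "ennreal v * (\<Sum>i\<in>S. ennreal (?k i)) \<le> ennreal (3 ^ ?d * (pi * l) ^ ?d)" .
  have "(\<Sum>i\<in>S. ennreal (?k i)) = ennreal (\<Sum>i\<in>S. ?k i)" by (intro sum_ennreal) simp
  with * have "ennreal (v * (\<Sum>i\<in>S. ?k i)) \<le> ennreal (3 ^ ?d * (pi * l) ^ ?d)"
    using v by (simp add: ennreal_mult sum_nonneg)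
  then have "v * (\<Sum>i\<in>S. ?k i) \<le> 3 ^ ?d * (pi * l) ^ ?d"
    using l by (subst (asm) ennreal_le_iff) auto
  then have "(\<Sum>i\<in>S. ?k i) \<le> 3 ^ ?d * (pi * l) ^ ?d / v"
    using v by (simp add: pos_le_divide_eq mult.commute)
  also have "\<dots> = (3 * pi) ^ ?d / (unit_ball_vol ?d * (\<epsilon> / 2) ^ ?d)"
  proof -
    have "r ^ ?d = (\<epsilon> / 2) ^ ?d * l ^ ?d" unfolding r_def by (simp add: power_mult_distrib[symmetric])
    moreover have "3 ^ ?d * (pi * l) ^ ?d = (3 * pi) ^ ?d * l ^ ?d" by (simp add: power_mult_distrib)
    ultimately show ?thesis using l unfolding v_def by simp
  qed
  finally have "ennreal (\<Sum>i\<in>S. ?k i) \<le> ennreal ((3 * pi) ^ ?d / (unit_ball_vol ?d * (\<epsilon> / 2) ^ ?d))"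
    by (rule ennreal_leI)
  moreover have "(\<Sum>i<N. if (\<forall>j<N. j \<noteq> i \<longrightarrow> \<epsilon> * l < norm (X j - X i)) then ennreal (?k i) else 0) = (\<Sum>i\<in>S. ennreal (?k i))"
    unfolding S_def by (intro sum.mono_neutral_cong_right) auto
  ultimately show ?thesis using \<open>(\<Sum>i\<in>S. ennreal (?k i)) = ennreal (\<Sum>i\<in>S. ?k i)\<close> by simp
qed

text \<open>Unlike rho, which is a sum of Bochner integrals and drops a divergent term as 0, this is infinite
  where one of the integrals diverges.\<close>
definition rhoN :: "nat \<Rightarrow> ((nat \<Rightarrow> real^'d) \<Rightarrow> complex) \<Rightarrow> real^'d \<Rightarrow> ennreal" where
  "rhoN N f x = (\<Sum>i<N. \<integral>\<^sup>+X. ennreal ((cmod (f (X(i := x))))\<^sup>2) \<partial>others N i)"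

text \<open>Share of the density carried by isolated particles, the test being made with particle
  \<open>i\<close> at \<open>x\<close>. For a single particle the test is void, and everything
  counts as isolated.\<close>

definition rhofar :: "nat \<Rightarrow> ((nat \<Rightarrow> real^'d) \<Rightarrow> complex) \<Rightarrow> real \<Rightarrow> real^'d \<Rightarrow> ennreal" where
  "rhofar N f e x = (\<Sum>i<N. \<integral>\<^sup>+X. (if (\<forall>j<N. j \<noteq> i \<longrightarrow> e < norm (X j - x))
      then ennreal ((cmod (f (X(i := x))))\<^sup>2) else 0) \<partial>others N i)"

definition gsum :: "real \<Rightarrow> nat \<Rightarrow> ((nat \<Rightarrow> real^'d) \<Rightarrow> complex) \<Rightarrow> real \<Rightarrow> real^'d \<Rightarrow> ennreal" where
  "gsum sg N f l x = (\<Sum>i<N. gdens sg N i f l x)"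

text \<open>Averaging at scale \<open>l\<close>, left unnormalised: the weight has total mass
  \<open>(pi * l) ^ CARD('d)\<close>. The matching factors \<open>1 / l ^ CARD('d)\<close> stand
  explicitly in the bounds below.\<close>

definition smear :: "real \<Rightarrow> (real^'d \<Rightarrow> ennreal) \<Rightarrow> real^'d \<Rightarrow> ennreal" where
  "smear l h w = (\<integral>\<^sup>+x. ennreal (KK ((x - w) /\<^sub>R l)) * h x \<partial>lborel)"

lemma smear_mono: "(\<And>x. h x \<le> k x) \<Longrightarrow> smear l h w \<le> smear l k w"
  unfolding smear_def by (intro nn_integral_mono mult_left_mono) auto

lemma smear_add: "h \<in> borel_measurable borel \<Longrightarrow> k \<in> borel_measurable borel \<Longrightarrow> smear l (\<lambda>x. h x + k x) w = smear l h w + smear l k w"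
  unfolding smear_def by (simp add: distrib_left nn_integral_add)

lemma smear_cmult: "h \<in> borel_measurable borel \<Longrightarrow> smear l (\<lambda>x. c * h x) w = c * smear l h w"
  unfolding smear_def by (simp add: nn_integral_cmult[symmetric] mult.left_commute)

lemma smear_measurable [measurable]:
  assumes [measurable]: "h \<in> borel_measurable borel"
  shows "smear l h \<in> borel_measurable borel"
  unfolding smear_def[abs_def] by measurable

lemma smear_sum: "(\<And>i. i \<in> I \<Longrightarrow> h i \<in> borel_measurable borel) \<Longrightarrow> smear l (\<lambda>x. \<Sum>i\<in>I. h i x) w = (\<Sum>i\<in>I. smear l (h i) w)"
  unfolding smear_def by (simp add: sum_distrib_left nn_integral_sum)

text \<open>By \<open>KK_conv_scaled\<close> averaging twice costs only a factor and does not widen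
  the weight. Hence the low-frequency term can be compared with the very quantity being estimated,
  as the absorption demands.\<close>

lemma smear_smear:
  fixes h :: "real^'d \<Rightarrow> ennreal"
  assumes l: "l > 0" and [measurable]: "h \<in> borel_measurable borel"
  shows "smear l (smear l h) w \<le> ennreal ((4 * pi * l) ^ CARD('d)) * smear l h w"
proof -
  have hm: "(\<lambda>z. ennreal (KK ((z - x) /\<^sub>R l)) * h z) \<in> borel_measurable lborel" for x by measurable
  have "smear l (smear l h) w = (\<integral>\<^sup>+x. (\<integral>\<^sup>+z. ennreal (KK ((x - w) /\<^sub>R l)) * (ennreal (KK ((z - x) /\<^sub>R l)) * h z) \<partial>lborel) \<partial>lborel)"
    unfolding smear_def by (intro nn_integral_cong nn_integral_cmult[symmetric] hm)
  also have "\<dots> = (\<integral>\<^sup>+z. (\<integral>\<^sup>+x. ennreal (KK ((x - w) /\<^sub>R l)) * (ennreal (KK ((z - x) /\<^sub>R l)) * h z) \<partial>lborel) \<partial>lborel)"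
    by (rule lborel_pair.Fubini'[symmetric]) measurable
  also have "\<dots> = (\<integral>\<^sup>+z. (\<integral>\<^sup>+x. ennreal (KK ((x - w) /\<^sub>R l) * KK ((z - x) /\<^sub>R l)) * h z \<partial>lborel) \<partial>lborel)"
    by (simp add: ennreal_mult mult.assoc)
  also have "\<dots> = (\<integral>\<^sup>+z. (\<integral>\<^sup>+x. ennreal (KK ((x - w) /\<^sub>R l) * KK ((z - x) /\<^sub>R l)) \<partial>lborel) * h z \<partial>lborel)"
    by (intro nn_integral_cong nn_integral_multc) measurable
  also have "\<dots> \<le> (\<integral>\<^sup>+z. ennreal ((4 * pi * l) ^ CARD('d) * KK ((z - w) /\<^sub>R l)) * h z \<partial>lborel)"
    using KK_conv_scaled[OF l, where 'a="real^'d"] by (intro nn_integral_mono mult_right_mono) auto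
  also have "\<dots> = (\<integral>\<^sup>+z. ennreal ((4 * pi * l) ^ CARD('d)) * (ennreal (KK ((z - w) /\<^sub>R l)) * h z) \<partial>lborel)"
    using l by (simp add: ennreal_mult mult.assoc)
  also have "\<dots> = ennreal ((4 * pi * l) ^ CARD('d)) * smear l h w"
    unfolding smear_def by (rule nn_integral_cmult) measurable
  finally show ?thesis .
qed

lemma nn_integral_smear:
  fixes h :: "real^'d \<Rightarrow> ennreal"
  assumes l: "l > 0" and [measurable]: "h \<in> borel_measurable borel"
  shows "(\<integral>\<^sup>+w. smear l h w \<partial>lborel) = ennreal ((pi * l) ^ CARD('d)) * (\<integral>\<^sup>+x. h x \<partial>lborel)"
proof -
  have "(\<integral>\<^sup>+w. smear l h w \<partial>lborel) = (\<integral>\<^sup>+x. (\<integral>\<^sup>+w. ennreal (KK ((x - w) /\<^sub>R l)) * h x \<partial>lborel) \<partial>lborel)"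
    unfolding smear_def by (rule lborel_pair.Fubini'[symmetric]) measurable
  also have "\<dots> = (\<integral>\<^sup>+x. (\<integral>\<^sup>+w. ennreal (KK ((w - x) /\<^sub>R l)) \<partial>lborel) * h x \<partial>lborel)"
  proof (intro nn_integral_cong)
    fix x :: "real^'d"
    have "KK ((x - w) /\<^sub>R l) = KK ((w - x) /\<^sub>R l)" for w
      using KK_minus[of "(w - x) /\<^sub>R l"] by (simp add: scaleR_minus_right[symmetric] del: scaleR_minus_right KK_minus)
    then show "(\<integral>\<^sup>+w. ennreal (KK ((x - w) /\<^sub>R l)) * h x \<partial>lborel) = (\<integral>\<^sup>+w. ennreal (KK ((w - x) /\<^sub>R l)) \<partial>lborel) * h x"
      by (subst nn_integral_multc[symmetric]) simp_all
  qed
  also have "\<dots> = ennreal ((pi * l) ^ CARD('d)) * (\<integral>\<^sup>+x. h x \<partial>lborel)"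
    using nn_integral_KK_scaled[OF l, where 'a="real^'d"] by (simp add: nn_integral_cmult)
  finally show ?thesis .
qed

text \<open>\<open>cLow\<close> and \<open>cHigh\<close> are the constants \<open>C1\<close> and
  \<open>C2\<close> of \<open>local_frequency_bound\<close> in dimension \<open>d\<close>;
  \<open>cPack\<close> is the constant of \<open>KK_packing\<close>.\<close>

definition cLow :: "nat \<Rightarrow> real" where
  "cLow d = 2 * (unit_ball_vol (real d) * (2 * real d) ^ d)\<^sup>2 * (25 * pi) ^ d"

definition cHigh :: "nat \<Rightarrow> real \<Rightarrow> real" where
  "cHigh d sg = 8 * (2 * sg * unit_ball_vol (real d) / (2 * sg - real d) * (2 * real d) powr (real d - 2 * sg))"

definition cPack :: "nat \<Rightarrow> real \<Rightarrow> real" where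
  "cPack d \<epsilon> = (3 * pi) ^ d / (unit_ball_vol (real d) * (\<epsilon> / 2) ^ d)"

lemma cLow_nonneg: "cLow d \<ge> 0" unfolding cLow_def by simp
lemma cHigh_nonneg: "real d < 2 * sg \<Longrightarrow> cHigh d sg \<ge> 0" unfolding cHigh_def by (simp add: order_trans[OF of_nat_0_le_iff])
lemma cPack_nonneg: "\<epsilon> > 0 \<Longrightarrow> cPack d \<epsilon> \<ge> 0" unfolding cPack_def by simp

lemma norm_cis_diff_le: "cmod (cis a - cis b) \<le> \<bar>a - b\<bar>"
proof -
  have "cis a - cis b = cis b * (cis (a - b) - 1)" by (simp add: right_diff_distrib cis_mult)
  then have "cmod (cis a - cis b) = cmod (cis (a - b) - 1)" by (simp add: norm_mult)
  also have "\<dots> \<le> \<bar>a - b\<bar>" using iexp_approx1[of "a - b" 0] by (simp add: cis_conv_exp)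
  finally show ?thesis .
qed

section \<open>Densities of a test function and their pointwise bounds\<close>

lemma slice_measurable:
  fixes f :: "(nat \<Rightarrow> real^'d) \<Rightarrow> complex"
  assumes i: "i < N" and f: "f \<in> borel_measurable (cfg N)"
  shows "(\<lambda>(x, X). f (X(i := x))) \<in> borel_measurable (lborel \<Otimes>\<^sub>M others N i)"
  unfolding case_prod_beta
  by (rule measurable_compose[OF others_update_measurable[OF i measurable_snd measurable_fst] f])

lemma slice_section_measurable:
  fixes f :: "(nat \<Rightarrow> real^'d) \<Rightarrow> complex"
  assumes i: "i < N" and f: "f \<in> borel_measurable (cfg N)"
  shows "(\<lambda>X. f (X(i := x))) \<in> borel_measurable (others N i)"
  by (rule measurable_compose[OF others_update_measurable[OF i measurable_ident_sets[OF refl] measurable_const] f]) simp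

lemma rhoN_component_measurable:
  fixes f :: "(nat \<Rightarrow> real^'d) \<Rightarrow> complex"
  assumes i: "i < N" and f: "f \<in> borel_measurable (cfg N)"
  shows "(\<lambda>x. \<integral>\<^sup>+X. ennreal ((cmod (f (X(i := x))))\<^sup>2) \<partial>others N i) \<in> borel_measurable borel"
proof -
  interpret o: sigma_finite_measure "others N i" by (rule sigma_finite_others)
  note [measurable] = slice_measurable[OF i f]
  have "(\<lambda>(x, X). ennreal ((cmod (f (X(i := x))))\<^sup>2)) \<in> borel_measurable (lborel \<Otimes>\<^sub>M others N i)"
    using measurable_compose[OF slice_measurable[OF i f], of "\<lambda>c. ennreal ((cmod c)\<^sup>2)" borel]
    by (simp add: case_prod_beta)
  from o.borel_measurable_nn_integral[OF this] show ?thesis by simp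
qed

lemma rhoN_measurable:
  fixes f :: "(nat \<Rightarrow> real^'d) \<Rightarrow> complex"
  assumes f: "f \<in> borel_measurable (cfg N)"
  shows "rhoN N f \<in> borel_measurable borel"
  unfolding rhoN_def[abs_def] by (intro borel_measurable_sum rhoN_component_measurable f) simp

lemma nn_integral_rhoN:
  fixes f :: "(nat \<Rightarrow> real^'d) \<Rightarrow> complex"
  assumes f: "f \<in> borel_measurable (cfg N)"
  shows "(\<integral>\<^sup>+x. rhoN N f x \<partial>lborel) = of_nat N * (\<integral>\<^sup>+X. ennreal ((cmod (f X))\<^sup>2) \<partial>cfg N)"
proof -
  note [measurable] = f
  have "(\<integral>\<^sup>+x. rhoN N f x \<partial>lborel) = (\<Sum>i<N. \<integral>\<^sup>+x. (\<integral>\<^sup>+X. ennreal ((cmod (f (X(i := x))))\<^sup>2) \<partial>others N i) \<partial>lborel)"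
    unfolding rhoN_def using rhoN_component_measurable[OF _ f] by (intro nn_integral_sum) simp
  also have "\<dots> = (\<Sum>i<N. \<integral>\<^sup>+X. ennreal ((cmod (f X))\<^sup>2) \<partial>cfg N)"
  proof (intro sum.cong refl nn_integral_cfg_split[symmetric])
    show "(\<lambda>X. ennreal ((cmod (f X))\<^sup>2)) \<in> borel_measurable (cfg N)" by measurable
  qed simp
  finally show ?thesis by simp
qed

lemma pred_far:
  fixes g :: "'z \<Rightarrow> nat \<Rightarrow> real^'d"
  assumes g: "\<And>j. j < N \<Longrightarrow> j \<noteq> i \<Longrightarrow> (\<lambda>z. g z j) \<in> borel_measurable K" and h: "h \<in> borel_measurable K"
  shows "Measurable.pred K (\<lambda>z. \<forall>j<N. j \<noteq> i \<longrightarrow> e < norm (g z j - h z))"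
proof -
  have "Measurable.pred K (\<lambda>z. \<forall>j\<in>{j. j < N \<and> j \<noteq> i}. e < norm (g z j - h z))"
  proof (rule pred_intros_finite)
    fix j assume "j \<in> {j. j < N \<and> j \<noteq> i}"
    then have "(\<lambda>z. g z j - h z) \<in> borel_measurable K" by (intro borel_measurable_diff g h) auto
    then have "(\<lambda>z. norm (g z j - h z)) \<in> borel_measurable K" by (rule measurable_compose) measurable
    then show "Measurable.pred K (\<lambda>z. e < norm (g z j - h z))"
      by (intro borel_measurable_pred_less borel_measurable_const)
  qed simp
  then show ?thesis by (rule measurable_cong[THEN iffD1, rotated]) auto
qed

context
  fixes N :: nat and f :: "(nat \<Rightarrow> real^'d) \<Rightarrow> complex" and R sg :: real
  assumes f: "cont_cfg N f" "supp_in N R f" and sg: "2 * sg > real CARD('d)"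
begin

lemma slice_isCont:
  assumes i: "i < N" and X: "X \<in> space (others N i)"
  shows "isCont (\<lambda>z. f (X(i := z))) z"
  unfolding continuous_at_sequentially comp_def
proof (intro allI impI)
  fix y assume y: "y \<longlonglongrightarrow> z"
  show "(\<lambda>n. f (X(i := y n))) \<longlonglongrightarrow> f (X(i := z))"
  proof (rule cfg_radial_tendsto[OF f(1)])
    show "(\<lambda>n. (X(i := y n)) j) \<longlonglongrightarrow> (X(i := z)) j" for j
      using y by (cases "j = i") auto
  qed (rule others_update_space[OF i X])+
qed

text \<open>Since \<open>zeta 0 = 1\<close>, the localised slice has its true value at
  \<open>x\<close>; the subtracted term is 0, either through \<open>\<tau>\<close> or through the
  zero of the slice at \<open>y\<close>. So the left side is exactly the slice at \<open>x\<close>,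
  and the only effect of the subtraction is the smaller \<open>\<eta>\<close>.\<close>

lemma slice_bound:
  assumes i: "i < N" and X: "X \<in> space (others N i)" and l: "l > 0"
    and \<tau>: "\<bar>\<tau>\<bar> \<le> 1" and \<eta>: "\<eta> \<ge> 0"
    and osc: "\<And>q. norm q < 2 * real CARD('d) / l \<Longrightarrow> cmod (cis (q \<bullet> x) - complex_of_real \<tau> * cis (q \<bullet> y)) \<le> \<eta>"
    and zero: "\<tau> = 0 \<or> f (X(i := y)) = 0"
  shows "ennreal ((cmod (f (X(i := x))))\<^sup>2)
    \<le> ennreal (cLow CARD('d) * \<eta>\<^sup>2 / l ^ CARD('d)) * (\<integral>\<^sup>+z. ennreal (KK ((z - x) /\<^sub>R l)) * ennreal ((cmod (f (X(i := z))))\<^sup>2) \<partial>lborel)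
      + ennreal (cHigh CARD('d) sg * l powr (2 * sg - CARD('d))) *
        (\<integral>\<^sup>+q. (if 2 * real CARD('d) / l \<le> norm q then ennreal (norm q powr (2 * sg) * (cmod (wave i f l x X q))\<^sup>2) else 0) \<partial>lborel)"
proof -
  obtain b where b: "\<And>x. x \<in> cfg_space N \<Longrightarrow> cmod (f x) \<le> b"
    using cont_supp_bounded[OF f] by blast
  have bd: "cmod (f (X(i := z))) \<le> b" for z
    by (rule b[OF others_update_space[OF i X]])
  have z: "complex_of_real \<tau> * (zeta ((y - x) /\<^sub>R l) * f (X(i := y))) = 0" using zero by auto
  show ?thesis
    using local_frequency_bound[where f="\<lambda>z. f (X(i := z))" and sg=sg and x=x and y=y and 'a="real^'d", OF _ l slice_isCont[OF i X] bd \<tau> \<eta> osc]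
    using sg by (simp only: z diff_zero diff_self scaleR_zero_right zeta_0 mult_1_left ennreal_mult[symmetric] KK_nonneg zero_le_power2 DIM_cart DIM_real mult_1_right cLow_def cHigh_def wave_def)
qed

text \<open>Passes from slices to densities: integrate over the other particles, exchange, sum over
  \<open>i\<close>. The term \<open>E\<close> holds what the frequency bound leaves out: 0 in
  \<open>rhoN_le_smear\<close>, the isolated configurations in \<open>rhoN_le_far\<close>.\<close>

lemma rhoN_le:
  assumes l: "l > 0" and E: "\<And>i. i < N \<Longrightarrow> E i \<in> borel_measurable (others N i)"
    and pt: "\<And>i X. i < N \<Longrightarrow> X \<in> space (others N i) \<Longrightarrow> ennreal ((cmod (f (X(i := x))))\<^sup>2)
    \<le> E i X + (A * (\<integral>\<^sup>+z. ennreal (KK ((z - x) /\<^sub>R l)) * ennreal ((cmod (f (X(i := z))))\<^sup>2) \<partial>lborel)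
      + D * (\<integral>\<^sup>+q. (if 2 * real CARD('d) / l \<le> norm q then ennreal (norm q powr (2 * sg) * (cmod (wave i f l x X q))\<^sup>2) else 0) \<partial>lborel))"
  shows "rhoN N f x \<le> (\<Sum>i<N. \<integral>\<^sup>+X. E i X \<partial>others N i) + (A * smear l (rhoN N f) x + D * gsum sg N f l x)"
proof -
  let ?r = "\<lambda>i x. \<integral>\<^sup>+X. ennreal ((cmod (f (X(i := x))))\<^sup>2) \<partial>others N i"
  have "?r i x \<le> (\<integral>\<^sup>+X. E i X \<partial>others N i) + (A * smear l (?r i) x + D * gdens sg N i f l x)" if i: "i < N" for i
  proof -
    interpret o: sigma_finite_measure "others N i" by (rule sigma_finite_others)
    interpret oq: pair_sigma_finite "others N i" "lborel :: (real^'d) measure" ..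
    note [measurable (raw)] = f_update_measurable[OF i f sg] wave_measurable'[OF i f sg]
    note [measurable] = E[OF i]
    let ?P = "\<lambda>X. \<integral>\<^sup>+z. ennreal (KK ((z - x) /\<^sub>R l)) * ennreal ((cmod (f (X(i := z))))\<^sup>2) \<partial>lborel"
    let ?W = "\<lambda>X. \<integral>\<^sup>+q. (if 2 * real CARD('d) / l \<le> norm q then ennreal (norm q powr (2 * sg) * (cmod (wave i f l x X q))\<^sup>2) else 0) \<partial>lborel"
    have Pm: "?P \<in> borel_measurable (others N i)" by measurable
    have Wm: "?W \<in> borel_measurable (others N i)" by measurable
    have "?r i x \<le> (\<integral>\<^sup>+X. E i X + (A * ?P X + D * ?W X) \<partial>others N i)"
      by (intro nn_integral_mono pt[OF i])
    also have "\<dots> = (\<integral>\<^sup>+X. E i X \<partial>others N i) + (A * (\<integral>\<^sup>+X. ?P X \<partial>others N i) + D * gdens sg N i f l x)"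
      using Pm Wm E[OF i] unfolding gdens_def by (simp add: nn_integral_add nn_integral_cmult)
    also have "(\<integral>\<^sup>+X. ?P X \<partial>others N i) = (\<integral>\<^sup>+z. (\<integral>\<^sup>+X. ennreal (KK ((z - x) /\<^sub>R l)) * ennreal ((cmod (f (X(i := z))))\<^sup>2) \<partial>others N i) \<partial>lborel)"
      by (rule oq.Fubini'[symmetric]) measurable
    also have "\<dots> = smear l (?r i) x"
      unfolding smear_def by (intro nn_integral_cong nn_integral_cmult) measurable
    finally show ?thesis .
  qed
  then have "rhoN N f x \<le> (\<Sum>i<N. (\<integral>\<^sup>+X. E i X \<partial>others N i) + (A * smear l (?r i) x + D * gdens sg N i f l x))"
    unfolding rhoN_def by (intro sum_mono) auto
  also have "\<dots> = (\<Sum>i<N. \<integral>\<^sup>+X. E i X \<partial>others N i) + (A * (\<Sum>i<N. smear l (?r i) x) + D * gsum sg N f l x)"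
    by (simp add: sum.distrib sum_distrib_left gsum_def)
  also have "(\<Sum>i<N. smear l (?r i) x) = smear l (rhoN N f) x"
  proof -
    have "?r i \<in> borel_measurable borel" if "i < N" for i
    proof -
      interpret o: sigma_finite_measure "others N i" by (rule sigma_finite_others)
      note [measurable (raw)] = f_update_measurable[OF that f sg]
      show ?thesis by measurable
    qed
    then show ?thesis unfolding rhoN_def[abs_def] by (subst smear_sum) auto
  qed
  finally show ?thesis .
qed

lemma gsum_measurable': "(\<lambda>(l, x). gsum sg N f l x) \<in> borel_measurable (borel \<Otimes>\<^sub>M borel)"
  unfolding gsum_def case_prod_beta
proof (rule borel_measurable_sum)
  fix i assume "i \<in> {..<N}"
  then have i: "i < N" by simp
  interpret o: sigma_finite_measure "others N i" by (rule sigma_finite_others)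
  note [measurable (raw)] = wave_measurable'[OF i f sg]
  show "(\<lambda>z. gdens sg N i f (fst z) (snd z)) \<in> borel_measurable (borel \<Otimes>\<^sub>M borel)"
    unfolding gdens_def by measurable
qed

lemma gsum_measurable [measurable (raw)]:
  assumes "a \<in> borel_measurable K" "b \<in> borel_measurable K"
  shows "(\<lambda>z. gsum sg N f (a z) (b z)) \<in> borel_measurable K"
  using measurable_compose[OF measurable_Pair[OF assms] gsum_measurable'] by simp

text \<open>The case without subtraction. No smallness is gained, but the bound returns from the
  averaged density to its value at a point.\<close>

lemma rhoN_le_smear:
  assumes l: "l > 0"
  shows "rhoN N f x \<le> ennreal (cLow CARD('d) / l ^ CARD('d)) * smear l (rhoN N f) x
     + ennreal (cHigh CARD('d) sg * l powr (2 * sg - CARD('d))) * gsum sg N f l x"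
proof -
  have "rhoN N f x \<le> (\<Sum>i<N. \<integral>\<^sup>+X. 0 \<partial>(others N i :: (nat \<Rightarrow> real^'d) measure)) + (ennreal (cLow CARD('d) / l ^ CARD('d)) * smear l (rhoN N f) x
     + ennreal (cHigh CARD('d) sg * l powr (2 * sg - CARD('d))) * gsum sg N f l x)"
  proof (rule rhoN_le[where E="\<lambda>_ _. 0", OF l])
    fix i and X :: "nat \<Rightarrow> real^'d" assume "i < N" "X \<in> space (others N i)"
    from slice_bound[OF this l, of 0 1 x x]
    show "ennreal ((cmod (f (X(i := x))))\<^sup>2) \<le> 0 + (ennreal (cLow CARD('d) / l ^ CARD('d)) *
        (\<integral>\<^sup>+z. ennreal (KK ((z - x) /\<^sub>R l)) * ennreal ((cmod (f (X(i := z))))\<^sup>2) \<partial>lborel)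
      + ennreal (cHigh CARD('d) sg * l powr (2 * sg - CARD('d))) *
        (\<integral>\<^sup>+q. (if 2 * real CARD('d) / l \<le> norm q then ennreal (norm q powr (2 * sg) * (cmod (wave i f l x X q))\<^sup>2) else 0) \<partial>lborel))"
      by simp
  qed simp
  then show ?thesis by simp
qed

text \<open>Unless particle \<open>i\<close> is isolated, some \<open>X j\<close> lies within
  \<open>\<epsilon> * l\<close> of \<open>x\<close>, and moving particle \<open>i\<close> there
  lands on the diagonal, where \<open>f\<close> is 0. For frequencies below \<open>2 * d / l\<close>
  the phases at \<open>x\<close> and \<open>X j\<close> differ by at most
  \<open>2 * d * \<epsilon>\<close>, which is the \<open>\<eta>\<close> of
  \<open>slice_bound\<close>.\<close>

lemma rhoN_le_far:
  fixes \<epsilon> :: real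
  assumes l: "l > 0" and \<epsilon>: "\<epsilon> > 0"
    and diag: "\<And>x. x \<in> cfg_space N \<Longrightarrow> (\<exists>i<N. \<exists>j<N. i \<noteq> j \<and> x i = x j) \<Longrightarrow> f x = 0"
  shows "rhoN N f x \<le> rhofar N f (\<epsilon> * l) x + (ennreal (cLow CARD('d) * (2 * real CARD('d) * \<epsilon>)\<^sup>2 / l ^ CARD('d)) * smear l (rhoN N f) x
     + ennreal (cHigh CARD('d) sg * l powr (2 * sg - CARD('d))) * gsum sg N f l x)"
  unfolding rhofar_def
proof (rule rhoN_le[OF l])
  fix i assume i: "i < N"
  have "(\<lambda>X. X j) \<in> borel_measurable (others N i :: (nat \<Rightarrow> real^'d) measure)" if "j < N" "j \<noteq> i" for j
    using measurable_component_singleton[of j "{..<N} - {i}" "\<lambda>_. lborel :: (real^'d) measure"] that by (simp add: others_def)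
  then have far: "Measurable.pred (others N i) (\<lambda>X. \<forall>j<N. j \<noteq> i \<longrightarrow> \<epsilon> * l < norm (X j - x))"
    by (rule pred_far[where g="\<lambda>X. X" and h="\<lambda>_. x"]) (assumption, assumption, rule borel_measurable_const)
  note [measurable (raw)] = f_update_measurable[OF i f sg]
  have "(\<lambda>X. ennreal ((cmod (f (X(i := x))))\<^sup>2)) \<in> borel_measurable (others N i)" by measurable
  then show "(\<lambda>X. if \<forall>j<N. j \<noteq> i \<longrightarrow> \<epsilon> * l < norm (X j - x) then ennreal ((cmod (f (X(i := x))))\<^sup>2) else 0) \<in> borel_measurable (others N i)"
    by (rule measurable_If[OF _ borel_measurable_const predE[OF far]])
next
  fix i and X :: "nat \<Rightarrow> real^'d" assume i: "i < N" and X: "X \<in> space (others N i)"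
  let ?T = "ennreal (cLow CARD('d) * (2 * real CARD('d) * \<epsilon>)\<^sup>2 / l ^ CARD('d)) *
        (\<integral>\<^sup>+z. ennreal (KK ((z - x) /\<^sub>R l)) * ennreal ((cmod (f (X(i := z))))\<^sup>2) \<partial>lborel)
      + ennreal (cHigh CARD('d) sg * l powr (2 * sg - CARD('d))) *
        (\<integral>\<^sup>+q. (if 2 * real CARD('d) / l \<le> norm q then ennreal (norm q powr (2 * sg) * (cmod (wave i f l x X q))\<^sup>2) else 0) \<partial>lborel)"
  show "ennreal ((cmod (f (X(i := x))))\<^sup>2) \<le> (if \<forall>j<N. j \<noteq> i \<longrightarrow> \<epsilon> * l < norm (X j - x) then ennreal ((cmod (f (X(i := x))))\<^sup>2) else 0) + ?T"
  proof (cases "\<forall>j<N. j \<noteq> i \<longrightarrow> \<epsilon> * l < norm (X j - x)")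
    case True
    show ?thesis unfolding if_P[OF True] by (rule add_increasing2) auto
  next
    case False
    then obtain j where j: "j < N" "j \<noteq> i" "norm (X j - x) \<le> \<epsilon> * l" by (auto simp: not_less)
    have "f (X(i := X j)) = 0"
    proof (rule diag[OF others_update_space[OF i X]])
      show "\<exists>i'<N. \<exists>j'<N. i' \<noteq> j' \<and> (X(i := X j)) i' = (X(i := X j)) j'"
        using i j by (intro exI[of _ i] conjI exI[of _ j]) auto
    qed
    moreover have "cmod (cis (q \<bullet> x) - complex_of_real 1 * cis (q \<bullet> X j)) \<le> 2 * real CARD('d) * \<epsilon>"
      if q: "norm q < 2 * real CARD('d) / l" for q
    proof -
      have "cmod (cis (q \<bullet> x) - cis (q \<bullet> X j)) \<le> \<bar>q \<bullet> (X j - x)\<bar>"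
        using norm_cis_diff_le[of "q \<bullet> x" "q \<bullet> X j"] by (simp add: inner_diff_right abs_minus_commute)
      also have "\<dots> \<le> norm q * norm (X j - x)" by (rule Cauchy_Schwarz_ineq2)
      also have "\<dots> \<le> (2 * real CARD('d) / l) * (\<epsilon> * l)" using q j(3) l by (intro mult_mono) auto
      also have "\<dots> = 2 * real CARD('d) * \<epsilon>" using l by simp
      finally show ?thesis by simp
    qed
    ultimately have "ennreal ((cmod (f (X(i := x))))\<^sup>2) \<le> ?T"
      using \<epsilon> by (intro slice_bound[OF i X l, of 1]) auto
    then show ?thesis unfolding if_not_P[OF False] add_0_left .
  qed
qed

lemma far_pair_measurable:
  assumes i: "i < N"
  shows "(\<lambda>(X, x). if \<forall>j<N. j \<noteq> i \<longrightarrow> e < norm (X j - x) then ennreal ((cmod (f (X(i := x))))\<^sup>2) else 0) \<in> borel_measurable (others N i \<Otimes>\<^sub>M lborel)"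
proof -
    have "(\<lambda>X. fst X j) \<in> borel_measurable ((others N i :: (nat \<Rightarrow> real^'d) measure) \<Otimes>\<^sub>M (lborel :: (real^'d) measure))" if "j < N" "j \<noteq> i" for j
    proof -
      have "(\<lambda>X. X j) \<in> borel_measurable (others N i :: (nat \<Rightarrow> real^'d) measure)"
        using measurable_component_singleton[of j "{..<N} - {i}" "\<lambda>_. lborel :: (real^'d) measure"] that by (simp add: others_def)
      then show ?thesis by (rule measurable_compose[OF measurable_fst])
    qed
    then have far: "Measurable.pred ((others N i :: (nat \<Rightarrow> real^'d) measure) \<Otimes>\<^sub>M lborel) (\<lambda>X. \<forall>j<N. j \<noteq> i \<longrightarrow> e < norm (fst X j - snd X))"
      by (rule pred_far[where g=fst and h=snd]) (assumption, assumption, simp)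
    note [measurable (raw)] = f_update_measurable[OF i f sg]
    have "(\<lambda>z. ennreal ((cmod (f ((fst z)(i := snd z))))\<^sup>2)) \<in> borel_measurable (others N i \<Otimes>\<^sub>M lborel)"
      by measurable
    from measurable_If[OF this borel_measurable_const predE[OF far]]
    show ?thesis unfolding case_prod_beta .
  qed

lemma far_slice_measurable:
  assumes i: "i < N"
  shows "(\<lambda>x. \<integral>\<^sup>+X. (if \<forall>j<N. j \<noteq> i \<longrightarrow> e < norm (X j - x) then ennreal ((cmod (f (X(i := x))))\<^sup>2) else 0) \<partial>others N i) \<in> borel_measurable borel"
proof -
    interpret o: sigma_finite_measure "others N i" by (rule sigma_finite_others)
    have "(\<lambda>(x, X). if \<forall>j<N. j \<noteq> i \<longrightarrow> e < norm (X j - x) then ennreal ((cmod (f (X(i := x))))\<^sup>2) else 0) \<in> borel_measurable (lborel \<Otimes>\<^sub>M others N i)"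
      using measurable_pair_swap[OF far_pair_measurable[OF i]] by (simp only: prod.case)
    from o.borel_measurable_nn_integral[OF this] show ?thesis by simp
  qed

lemma rhofar_measurable: "rhofar N f e \<in> borel_measurable borel"
  unfolding rhofar_def[abs_def] by (intro borel_measurable_sum far_slice_measurable) simp

text \<open>The integral over \<open>x\<close> and that over the other particles recombine into one
  over configurations with \<open>x = X i\<close>. The sum over \<open>i\<close> can then be taken
  inside, where \<open>KK_packing\<close> bounds it in each configuration.\<close>

lemma smear_rhofar:
  assumes l: "l > 0" and \<epsilon>: "0 < \<epsilon>" "\<epsilon> \<le> 1"
  shows "smear l (rhofar N f (\<epsilon> * l)) w \<le> ennreal (cPack CARD('d) \<epsilon>) * (\<integral>\<^sup>+X. ennreal ((cmod (f X))\<^sup>2) \<partial>cfg N)"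
proof -
  note [measurable] = cont_cfg_measurable[OF f(1)]
  let ?iso = "\<lambda>i (X :: nat \<Rightarrow> real^'d). \<forall>j<N. j \<noteq> i \<longrightarrow> \<epsilon> * l < norm (X j - X i)"
  let ?h = "\<lambda>i X. (if ?iso i X then ennreal (KK ((X i - w) /\<^sub>R l)) else 0) * ennreal ((cmod (f X))\<^sup>2)"
  have hm: "?h i \<in> borel_measurable (cfg N)" if "i < N" for i
  proof -
    have c: "(\<lambda>X. X i) \<in> borel_measurable (cfg N :: (nat \<Rightarrow> real^'d) measure)"
      by (rule measurable_cfg_coord[OF that])
    have iso: "Measurable.pred (cfg N :: (nat \<Rightarrow> real^'d) measure) (\<lambda>X. ?iso i X)"
      by (rule pred_far[where g="\<lambda>X. X" and h="\<lambda>X. X i"]) (rule measurable_cfg_coord, assumption, rule c)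
    have "(\<lambda>X. ennreal (KK ((X i - w) /\<^sub>R l))) \<in> borel_measurable (cfg N)"
      by (rule measurable_compose[OF c, where g="\<lambda>y. ennreal (KK ((y - w) /\<^sub>R l))"]) measurable
    from measurable_If[OF this borel_measurable_const predE[OF iso]]
    have "(\<lambda>X. if ?iso i X then ennreal (KK ((X i - w) /\<^sub>R l)) else 0) \<in> borel_measurable (cfg N)" .
    moreover have "(\<lambda>X. ennreal ((cmod (f X))\<^sup>2)) \<in> borel_measurable (cfg N)" by measurable
    ultimately show ?thesis by (rule borel_measurable_times_ennreal)
  qed
  note mm = far_pair_measurable[of _ "\<epsilon> * l"]
  let ?F = "\<lambda>i x. \<integral>\<^sup>+X. (if \<forall>j<N. j \<noteq> i \<longrightarrow> \<epsilon> * l < norm (X j - x) then ennreal ((cmod (f (X(i := x))))\<^sup>2) else 0) \<partial>others N i"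
  note Fm = far_slice_measurable[of _ "\<epsilon> * l"]
  have "smear l (rhofar N f (\<epsilon> * l)) w = (\<Sum>i<N. smear l (?F i) w)"
    unfolding rhofar_def[abs_def] by (rule smear_sum) (use Fm in auto)
  also have "\<dots> = (\<Sum>i<N. \<integral>\<^sup>+X. ?h i X \<partial>cfg N)"
  proof (intro sum.cong refl)
    fix i assume "i \<in> {..<N}"
    then have i: "i < N" by simp
    have "smear l (?F i) w = (\<integral>\<^sup>+x. (\<integral>\<^sup>+X. ennreal (KK ((x - w) /\<^sub>R l)) * (if \<forall>j<N. j \<noteq> i \<longrightarrow> \<epsilon> * l < norm (X j - x) then ennreal ((cmod (f (X(i := x))))\<^sup>2) else 0) \<partial>others N i) \<partial>lborel)"
    proof -
      have "x \<in> space lborel" for x :: "real^'d" by simp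
      from measurable_compose[OF measurable_Pair2'[OF this] mm[OF i]]
      have "(\<lambda>X. if \<forall>j<N. j \<noteq> i \<longrightarrow> \<epsilon> * l < norm (X j - x) then ennreal ((cmod (f (X(i := x))))\<^sup>2) else 0)
          \<in> borel_measurable (others N i)" for x
        by (simp only: prod.case)
      then show ?thesis unfolding smear_def by (intro nn_integral_cong nn_integral_cmult[symmetric])
    qed
    also have "\<dots> = (\<integral>\<^sup>+x. (\<integral>\<^sup>+X. ?h i (X(i := x)) \<partial>others N i) \<partial>lborel)"
      by (intro nn_integral_cong) auto
    also have "\<dots> = (\<integral>\<^sup>+X. ?h i X \<partial>cfg N)"
      by (rule nn_integral_cfg_split[OF i hm[OF i], symmetric])
    finally show "smear l (?F i) w = (\<integral>\<^sup>+X. ?h i X \<partial>cfg N)" .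
  qed
  also have "\<dots> = (\<integral>\<^sup>+X. (\<Sum>i<N. ?h i X) \<partial>cfg N)"
    using hm by (intro nn_integral_sum[symmetric]) auto
  also have "\<dots> \<le> (\<integral>\<^sup>+X. ennreal (cPack CARD('d) \<epsilon>) * ennreal ((cmod (f X))\<^sup>2) \<partial>cfg N)"
    unfolding sum_distrib_right[symmetric] cPack_def
    by (intro nn_integral_mono mult_right_mono KK_packing[OF l \<epsilon>]) simp
  also have "\<dots> = ennreal (cPack CARD('d) \<epsilon>) * (\<integral>\<^sup>+X. ennreal ((cmod (f X))\<^sup>2) \<partial>cfg N)"
    by (rule nn_integral_cmult) measurable
  finally show ?thesis .
qed

end

section \<open>Absorption of the low frequencies and integration over the scale\<close>

lemma ennreal_absorb_half:
  fixes x b :: ennreal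
  assumes le: "x \<le> b + ennreal (1/2) * x" and fin: "x < \<infinity>"
  shows "x \<le> 2 * b"
proof (cases b)
  case (real r)
  obtain y where y: "y \<ge> 0" "x = ennreal y" using fin by (cases x) auto
  have "ennreal (r + 1/2 * y) = ennreal r + ennreal (1/2) * ennreal y"
    using real y by (subst ennreal_mult[symmetric]) (auto intro: ennreal_plus)
  then have "ennreal y \<le> ennreal (r + 1/2 * y)"
    using le unfolding real(2) y(2) by (simp only:)
  then have "y \<le> r + 1/2 * y" using real y by (subst (asm) ennreal_le_iff) auto
  then have "ennreal y \<le> ennreal (2 * r)" by (intro ennreal_leI) simp
  then show ?thesis using real y by (simp add: ennreal_mult)
next
  case top
  then show ?thesis by (simp add: ennreal_mult_top)
qed

text \<open>The H of the overview. Its two summands are the high-frequency errors of the two passes: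
  the averaged one from \<open>smear_rhoN_bound\<close>, carried back to a point, and the direct one
  from \<open>rhoN_le_smear\<close>.\<close>

definition Hh :: "real \<Rightarrow> nat \<Rightarrow> ((nat \<Rightarrow> real^'d) \<Rightarrow> complex) \<Rightarrow> real \<Rightarrow> real^'d \<Rightarrow> ennreal" where
  "Hh sg N f l x = ennreal (2 * cLow CARD('d) / l ^ CARD('d)) *
      (ennreal (cHigh CARD('d) sg * l powr (2 * sg - CARD('d))) * smear l (gsum sg N f l) x)
    + ennreal (cHigh CARD('d) sg * l powr (2 * sg - CARD('d))) * gsum sg N f l x"

definition Fint :: "real \<Rightarrow> real \<Rightarrow> nat \<Rightarrow> ((nat \<Rightarrow> real^'d) \<Rightarrow> complex) \<Rightarrow> real^'d \<Rightarrow> ennreal" where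
  "Fint s sg N f x = (\<integral>\<^sup>+l. (if 0 < l then ennreal (l powr (- 2 * s - 1)) * Hh sg N f l x else 0) \<partial>lborel)"

text \<open>The first factor compares the integral of \<open>Hh\<close> over space with that of
  \<open>gsum\<close>; the second is the constant of \<open>nn_integral_gdens\<close>.\<close>

definition cK2 :: "nat \<Rightarrow> real \<Rightarrow> real" where
  "cK2 d sg = (cHigh d sg * (2 * cLow d * pi ^ d + 1)) * ((2 * pi) ^ (2 * d) * 2 powr (2 * sg) * unit_ball_vol (real d) * real d ^ d)"

text \<open>The additional factor is the integral of \<open>l powr (2 * sg - 2 * s - 1)\<close> from
  \<open>d / norm (p i)\<close> to infinity, apart from its power of
  \<open>norm (p i)\<close>.\<close>

definition cK3 :: "nat \<Rightarrow> real \<Rightarrow> real \<Rightarrow> real" where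
  "cK3 d s sg = cK2 d sg * (real d powr (2 * sg - 2 * s) / (2 * s - 2 * sg))"

lemma cK2_nonneg: "real d < 2 * sg \<Longrightarrow> cK2 d sg \<ge> 0"
  unfolding cK2_def using cHigh_nonneg[of d sg] cLow_nonneg[of d] by simp

context
  fixes N :: nat and f :: "(nat \<Rightarrow> real^'d) \<Rightarrow> complex" and R sg :: real
  assumes f: "cont_cfg N f" "supp_in N R f" and sg: "2 * sg > real CARD('d)"
begin

text \<open>Averaging \<open>rhoN_le_far\<close> produces a doubly averaged density; by
  \<open>smear_smear\<close> its factor \<open>l ^ d\<close> cancels the \<open>1 / l ^ d\<close> in
  front, and \<open>small\<close> leaves at most half of the left side. The mass bound is 2 rather
  than 1 because the approximants of a normalised function need not be normalised.\<close>

lemma smear_rhoN_bound: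
  fixes \<epsilon> :: real
  assumes l: "l > 0" and \<epsilon>: "0 < \<epsilon>" "\<epsilon> \<le> 1"
    and small: "cLow CARD('d) * (2 * real CARD('d) * \<epsilon>)\<^sup>2 * (4 * pi) ^ CARD('d) \<le> 1/2"
    and diag: "\<And>x. x \<in> cfg_space N \<Longrightarrow> (\<exists>i<N. \<exists>j<N. i \<noteq> j \<and> x i = x j) \<Longrightarrow> f x = 0"
    and mass: "(\<integral>\<^sup>+X. ennreal ((cmod (f X))\<^sup>2) \<partial>cfg N) \<le> 2"
  shows "smear l (rhoN N f) w \<le> 2 * (ennreal (2 * cPack CARD('d) \<epsilon>)
     + ennreal (cHigh CARD('d) sg * l powr (2 * sg - CARD('d))) * smear l (gsum sg N f l) w)"
proof (rule ennreal_absorb_half)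
  let ?a = "cLow CARD('d) * (2 * real CARD('d) * \<epsilon>)\<^sup>2 / l ^ CARD('d)"
  let ?h = "ennreal (cHigh CARD('d) sg * l powr (2 * sg - CARD('d)))"
  note [measurable] = rhoN_measurable[OF cont_cfg_measurable[OF f(1)]] rhofar_measurable[OF f sg, of "\<epsilon> * l"]
  have [measurable]: "gsum sg N f l \<in> borel_measurable borel"
    using gsum_measurable[OF f sg, of "\<lambda>_. l" borel "\<lambda>x. x"] by simp
  have a: "?a \<ge> 0" using cLow_nonneg l by simp
  have "smear l (rhoN N f) w \<le> smear l (\<lambda>x. rhofar N f (\<epsilon> * l) x + (ennreal ?a * smear l (rhoN N f) x + ?h * gsum sg N f l x)) w"
    by (intro smear_mono rhoN_le_far[OF f sg l \<epsilon>(1) diag])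
  also have "\<dots> = smear l (rhofar N f (\<epsilon> * l)) w + smear l (\<lambda>x. ennreal ?a * smear l (rhoN N f) x + ?h * gsum sg N f l x) w"
    by (rule smear_add) measurable
  also have "smear l (\<lambda>x. ennreal ?a * smear l (rhoN N f) x + ?h * gsum sg N f l x) w
      = smear l (\<lambda>x. ennreal ?a * smear l (rhoN N f) x) w + smear l (\<lambda>x. ?h * gsum sg N f l x) w"
    by (rule smear_add) measurable
  also have "smear l (\<lambda>x. ennreal ?a * smear l (rhoN N f) x) w = ennreal ?a * smear l (smear l (rhoN N f)) w"
    by (rule smear_cmult) measurable
  also have "smear l (\<lambda>x. ?h * gsum sg N f l x) w = ?h * smear l (gsum sg N f l) w"
    by (rule smear_cmult) measurable
  also have "smear l (rhofar N f (\<epsilon> * l)) w + (ennreal ?a * smear l (smear l (rhoN N f)) w + ?h * smear l (gsum sg N f l) w)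
     \<le> ennreal (2 * cPack CARD('d) \<epsilon>) + (ennreal (1/2) * smear l (rhoN N f) w + ?h * smear l (gsum sg N f l) w)"
  proof (intro add_mono order_refl)
    have "smear l (rhofar N f (\<epsilon> * l)) w \<le> ennreal (cPack CARD('d) \<epsilon>) * (\<integral>\<^sup>+X. ennreal ((cmod (f X))\<^sup>2) \<partial>cfg N)"
      by (rule smear_rhofar[OF f sg l \<epsilon>])
    also have "\<dots> \<le> ennreal (cPack CARD('d) \<epsilon>) * 2" by (intro mult_left_mono mass) simp
    also have "\<dots> = ennreal (2 * cPack CARD('d) \<epsilon>)"
      using cPack_nonneg[OF \<epsilon>(1)] by (simp add: ennreal_mult mult.commute)
    finally show "smear l (rhofar N f (\<epsilon> * l)) w \<le> ennreal (2 * cPack CARD('d) \<epsilon>)" .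
    have "ennreal ?a * smear l (smear l (rhoN N f)) w \<le> ennreal ?a * (ennreal ((4 * pi * l) ^ CARD('d)) * smear l (rhoN N f) w)"
      by (intro mult_left_mono smear_smear[OF l]) simp_all
    also have "\<dots> = ennreal (?a * (4 * pi * l) ^ CARD('d)) * smear l (rhoN N f) w"
    proof -
      have "ennreal (?a * (4 * pi * l) ^ CARD('d)) = ennreal ?a * ennreal ((4 * pi * l) ^ CARD('d))"
        using a l by (intro ennreal_mult) auto
      then show ?thesis by (simp only: mult.assoc)
    qed
    also have "?a * (4 * pi * l) ^ CARD('d) = cLow CARD('d) * (2 * real CARD('d) * \<epsilon>)\<^sup>2 * (4 * pi) ^ CARD('d)"
      using l unfolding power_mult_distrib[of "4 * pi" l] by simp
    also have "ennreal \<dots> * smear l (rhoN N f) w \<le> ennreal (1/2) * smear l (rhoN N f) w"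
      by (intro mult_right_mono ennreal_leI small) simp
    finally show "ennreal ?a * smear l (smear l (rhoN N f)) w \<le> ennreal (1/2) * smear l (rhoN N f) w" .
  qed
  also have "\<dots> = ennreal (2 * cPack CARD('d) \<epsilon>) + ?h * smear l (gsum sg N f l) w + ennreal (1/2) * smear l (rhoN N f) w"
    by (simp add: add_ac)
  finally show "smear l (rhoN N f) w \<le> ennreal (2 * cPack CARD('d) \<epsilon>) + ?h * smear l (gsum sg N f l) w + ennreal (1/2) * smear l (rhoN N f) w" .
  \<comment> \<open>Absorption needs finiteness of the absorbed quantity. The bound here grows with
    \<open>N\<close>, but it is used only qualitatively and enters no constant.\<close>
  have "smear l (rhoN N f) w \<le> (\<integral>\<^sup>+x. 1 * rhoN N f x \<partial>lborel)"
    unfolding smear_def by (intro nn_integral_mono mult_right_mono) (simp_all add: KK_le1)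
  also have "\<dots> = of_nat N * (\<integral>\<^sup>+X. ennreal ((cmod (f X))\<^sup>2) \<partial>cfg N)"
    using nn_integral_rhoN[OF cont_cfg_measurable[OF f(1)]] by simp
  also have "\<dots> < \<infinity>"
  proof -
    have "(\<integral>\<^sup>+X. ennreal ((cmod (f X))\<^sup>2) \<partial>cfg N) < \<infinity>" by (rule le_less_trans[OF mass]) simp
    then show ?thesis by (simp add: ennreal_mult_less_top of_nat_less_top)
  qed
  finally show "smear l (rhoN N f) w < \<infinity>" .
qed

text \<open>The frequency bound at a point involves an average, so nothing can be absorbed at the
  point itself. The closed bound for the average is therefore inserted into
  \<open>rhoN_le_smear\<close>; 4 is the factor 2 of the absorption times the mass bound 2.\<close>

lemma rhoN_pointwise:
  fixes \<epsilon> :: real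
  assumes l: "l > 0" and \<epsilon>: "0 < \<epsilon>" "\<epsilon> \<le> 1"
    and small: "cLow CARD('d) * (2 * real CARD('d) * \<epsilon>)\<^sup>2 * (4 * pi) ^ CARD('d) \<le> 1/2"
    and diag: "\<And>x. x \<in> cfg_space N \<Longrightarrow> (\<exists>i<N. \<exists>j<N. i \<noteq> j \<and> x i = x j) \<Longrightarrow> f x = 0"
    and mass: "(\<integral>\<^sup>+X. ennreal ((cmod (f X))\<^sup>2) \<partial>cfg N) \<le> 2"
  shows "rhoN N f x \<le> ennreal (4 * cLow CARD('d) * cPack CARD('d) \<epsilon> / l ^ CARD('d)) + Hh sg N f l x"
proof -
  let ?h = "ennreal (cHigh CARD('d) sg * l powr (2 * sg - CARD('d)))"
  let ?c = "cLow CARD('d) / l ^ CARD('d)"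
  let ?S = "?h * smear l (gsum sg N f l) x"
  have c: "?c \<ge> 0" using cLow_nonneg l by simp
  have "rhoN N f x \<le> ennreal ?c * smear l (rhoN N f) x + ?h * gsum sg N f l x"
    by (rule rhoN_le_smear[OF f sg l])
  also have "\<dots> \<le> ennreal ?c * (2 * (ennreal (2 * cPack CARD('d) \<epsilon>) + ?S)) + ?h * gsum sg N f l x"
    by (intro add_mono mult_left_mono smear_rhoN_bound[OF l \<epsilon> small diag mass] order_refl) simp_all
  also have "ennreal ?c * (2 * (ennreal (2 * cPack CARD('d) \<epsilon>) + ?S))
      = ennreal (4 * cLow CARD('d) * cPack CARD('d) \<epsilon> / l ^ CARD('d)) + ennreal (2 * cLow CARD('d) / l ^ CARD('d)) * ?S"
  proof -
    have "ennreal ?c * (2 * (ennreal (2 * cPack CARD('d) \<epsilon>) + ?S))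
        = (ennreal ?c * 2) * ennreal (2 * cPack CARD('d) \<epsilon>) + (ennreal ?c * 2) * ?S"
      by (simp only: distrib_left mult.assoc)
    moreover have two: "ennreal ?c * 2 = ennreal (2 * cLow CARD('d) / l ^ CARD('d))"
      using ennreal_mult[OF c, of 2] by (simp add: mult.commute)
    moreover have "ennreal (2 * cLow CARD('d) / l ^ CARD('d)) * ennreal (2 * cPack CARD('d) \<epsilon>) = ennreal (4 * cLow CARD('d) * cPack CARD('d) \<epsilon> / l ^ CARD('d))"
      using c cPack_nonneg[OF \<epsilon>(1)] cLow_nonneg[of "CARD('d)"] l by (subst ennreal_mult[symmetric]) simp_all
    ultimately show ?thesis by (simp only:)
  qed
  finally show ?thesis unfolding Hh_def by (simp only: add.assoc)
qed

lemma Hh_measurable': "(\<lambda>(l, x). Hh sg N f l x) \<in> borel_measurable (borel \<Otimes>\<^sub>M borel)"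
proof -
  note [measurable (raw)] = gsum_measurable[OF f sg]
  show ?thesis unfolding Hh_def smear_def case_prod_beta by measurable
qed

lemma Hh_measurable [measurable (raw)]:
  assumes "a \<in> borel_measurable K" "b \<in> borel_measurable K"
  shows "(\<lambda>z. Hh sg N f (a z) (b z)) \<in> borel_measurable K"
  using measurable_compose[OF measurable_Pair[OF assms] Hh_measurable'] by simp

text \<open>Power counting in \<open>l\<close>: the average contributes \<open>(pi * l) ^ d\<close>
  against \<open>1 / l ^ d\<close>, so both summands of \<open>Hh\<close> scale alike, and
  \<open>l powr (2 * sg - d)\<close> meets the \<open>l ^ d\<close> of
  \<open>nn_integral_gdens\<close>.\<close>

lemma nn_integral_Hh:
  assumes l: "l > 0"
  shows "(\<integral>\<^sup>+x. Hh sg N f l x \<partial>lborel) \<le> ennreal (cK2 CARD('d) sg * l powr (2 * sg)) *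
    (\<Sum>i<N. \<integral>\<^sup>+p. (if real CARD('d) / l \<le> norm (p i) then ennreal (norm (p i) powr (2 * sg) * (cmod (FT N f p))\<^sup>2) else 0) \<partial>cfg N)"
    (is "_ \<le> _ * (\<Sum>i<N. ?P i)")
proof -
  let ?d = "CARD('d)"
  let ?h = "cHigh ?d sg * l powr (2 * sg - ?d)"
  let ?K = "(2 * pi) ^ (2 * ?d) * 2 powr (2 * sg) * unit_ball_vol ?d * real ?d ^ ?d"
  have h: "?h \<ge> 0" using cHigh_nonneg[OF sg] by simp
  have cl: "2 * cLow ?d / l ^ ?d \<ge> 0" using cLow_nonneg[of ?d] l by simp
  have gm[measurable]: "gsum sg N f l \<in> borel_measurable borel"
    using gsum_measurable[OF f sg, of "\<lambda>_. l" borel "\<lambda>x. x"] by simp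
  have "(\<integral>\<^sup>+x. Hh sg N f l x \<partial>lborel) = ennreal (2 * cLow ?d / l ^ ?d) * (ennreal ?h * (\<integral>\<^sup>+x. smear l (gsum sg N f l) x \<partial>lborel))
      + ennreal ?h * (\<integral>\<^sup>+x. gsum sg N f l x \<partial>lborel)"
    unfolding Hh_def by (simp add: nn_integral_add nn_integral_cmult)
  also have "\<dots> = ennreal (2 * cLow ?d / l ^ ?d * (?h * (pi * l) ^ ?d) + ?h) * (\<integral>\<^sup>+x. gsum sg N f l x \<partial>lborel)"
  proof -
    have "ennreal A * (ennreal B * (ennreal D * G)) + ennreal B * G = ennreal (A * (B * D) + B) * G"
      if "A \<ge> 0" "B \<ge> 0" "D \<ge> 0" for A B D :: real and G :: ennreal
      using that by (simp add: ennreal_mult ennreal_plus distrib_right mult.assoc)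
    from this[OF cl h, of "(pi * l) ^ ?d"] show ?thesis
      unfolding nn_integral_smear[OF l gm] using l by simp
  qed
  also have "2 * cLow ?d / l ^ ?d * (?h * (pi * l) ^ ?d) + ?h = ?h * (2 * cLow ?d * pi ^ ?d + 1)"
    using l unfolding power_mult_distrib[of pi l] by (simp add: field_simps)
  also have "(\<integral>\<^sup>+x. gsum sg N f l x \<partial>lborel) = (\<Sum>i<N. \<integral>\<^sup>+x. gdens sg N i f l x \<partial>lborel)"
    unfolding gsum_def
  proof (rule nn_integral_sum)
    fix i assume "i \<in> {..<N}"
    then have i: "i < N" by simp
    interpret o: sigma_finite_measure "others N i" by (rule sigma_finite_others)
    note [measurable (raw)] = wave_measurable'[OF i f sg]
    show "gdens sg N i f l \<in> borel_measurable lborel"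
      unfolding gdens_def[abs_def] by measurable
  qed
  also have "ennreal (?h * (2 * cLow ?d * pi ^ ?d + 1)) * (\<Sum>i<N. \<integral>\<^sup>+x. gdens sg N i f l x \<partial>lborel)
      \<le> ennreal (?h * (2 * cLow ?d * pi ^ ?d + 1)) * (\<Sum>i<N. ennreal (?K * l ^ ?d) * ?P i)"
    using nn_integral_gdens[OF _ f sg l] by (intro mult_left_mono sum_mono) auto
  also have "\<dots> = ennreal (?h * (2 * cLow ?d * pi ^ ?d + 1)) * ennreal (?K * l ^ ?d) * (\<Sum>i<N. ?P i)"
    by (simp only: sum_distrib_left[symmetric] mult.assoc)
  also have "ennreal (?h * (2 * cLow ?d * pi ^ ?d + 1)) * ennreal (?K * l ^ ?d) = ennreal (cK2 ?d sg * l powr (2 * sg))"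
  proof -
    have "l powr (2 * sg - ?d) * l ^ ?d = l powr (2 * sg)"
      using l by (simp add: powr_realpow[symmetric] powr_add[symmetric])
    moreover have "(a * b * c) * (k * L) = (a * c * k) * M" if "b * L = M" for a b c k L M :: real
      using that by auto
    ultimately have "(?h * (2 * cLow ?d * pi ^ ?d + 1)) * (?K * l ^ ?d) = cK2 ?d sg * l powr (2 * sg)"
      unfolding cK2_def by blast
    moreover have "?h * (2 * cLow ?d * pi ^ ?d + 1) \<ge> 0" by (rule mult_nonneg_nonneg[OF h]) (use cLow_nonneg[of ?d] in simp)
    ultimately show ?thesis using l by (subst ennreal_mult[symmetric]) simp_all
  qed
  finally show ?thesis .
qed

lemma Fint_measurable: "Fint s sg N f \<in> borel_measurable borel"
  unfolding Fint_def[abs_def] by measurable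

text \<open>With \<open>p\<close> fixed, the cutoff \<open>d / l \<le> norm (p i)\<close> restricts
  \<open>l\<close> to a half-line starting at \<open>d / norm (p i)\<close>. As
  \<open>sg < s\<close>, the power \<open>l powr (2 * sg - 2 * s - 1)\<close> is integrable there
  and supplies \<open>norm (p i) powr (2 * s - 2 * sg)\<close>, which completes the kinetic
  weight.\<close>

lemma nn_integral_Fint:
  assumes s: "sg < s"
  shows "(\<integral>\<^sup>+x. Fint s sg N f x \<partial>lborel) \<le> ennreal (cK3 CARD('d) s sg) *
    (\<Sum>i<N. \<integral>\<^sup>+p. ennreal (norm (p i) powr (2 * s) * (cmod (FT N f p))\<^sup>2) \<partial>cfg N)"
proof -
  let ?d = "CARD('d)"
  let ?b = "2 * s - 2 * sg"
  let ?P = "\<lambda>i l p. if real ?d / l \<le> norm (p i) then ennreal (norm (p i) powr (2 * sg) * (cmod (FT N f p))\<^sup>2) else 0"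
  have b: "?b > 0" using s by simp
  have K: "cK2 ?d sg \<ge> 0" by (rule cK2_nonneg[OF sg])
  interpret cl: pair_sigma_finite "cfg N :: (nat \<Rightarrow> real^'d) measure" "lborel :: real measure"
    by (intro pair_sigma_finite.intro sigma_finite_cfg lborel.sigma_finite_measure_axioms)
  have [measurable]: "FT N f \<in> borel_measurable (cfg N)"
    unfolding FT_eq[abs_def] using cont_cfg_measurable[OF f(1)] by measurable
  have Pm: "(\<lambda>(p, l). if 0 < l then ennreal (cK2 ?d sg * l powr (- ?b - 1)) * ?P i l p else 0) \<in> borel_measurable (cfg N \<Otimes>\<^sub>M lborel)" if "i < N" for i
  proof -
    have [measurable]: "(\<lambda>z. fst z i) \<in> borel_measurable ((cfg N :: (nat \<Rightarrow> real^'d) measure) \<Otimes>\<^sub>M (lborel :: real measure))"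
      by (rule measurable_compose[OF measurable_fst measurable_cfg_coord[OF that]])
    show ?thesis unfolding case_prod_beta by measurable
  qed
  have Pp: "(\<integral>\<^sup>+l. (if 0 < l then ennreal (cK2 ?d sg * l powr (- ?b - 1)) * ?P i l p else 0) \<partial>lborel)
      \<le> ennreal (cK3 ?d s sg) * ennreal (norm (p i) powr (2 * s) * (cmod (FT N f p))\<^sup>2)" for i and p :: "nat \<Rightarrow> real^'d"
  \<comment> \<open>At zero momentum the cutoff is met for no positive \<open>l\<close>, so the
    integrand vanishes; the half-line of the other case would have no starting point.\<close>
  proof (cases "p i = 0")
    case True
    then have "(if 0 < l then ennreal (cK2 ?d sg * l powr (- ?b - 1)) * ?P i l p else 0) = 0" for l by (simp add: divide_le_0_iff)
    then have "(\<integral>\<^sup>+l. (if 0 < l then ennreal (cK2 ?d sg * l powr (- ?b - 1)) * ?P i l p else 0) \<partial>lborel) = (\<integral>\<^sup>+l. 0 \<partial>(lborel :: real measure))"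
      by (intro nn_integral_cong)
    then show ?thesis by (simp only: nn_integral_const mult_zero_left zero_le)
  next
    case False
    let ?a = "real ?d / norm (p i)"
    let ?m = "cK2 ?d sg * (norm (p i) powr (2 * sg) * (cmod (FT N f p))\<^sup>2)"
    have a: "?a > 0" using False by simp
    have "(\<integral>\<^sup>+l. (if 0 < l then ennreal (cK2 ?d sg * l powr (- ?b - 1)) * ?P i l p else 0) \<partial>lborel)
        \<le> (\<integral>\<^sup>+l. ennreal ?m * (ennreal (l powr (- ?b - 1)) * indicator {?a..} l) \<partial>lborel)"
    proof (intro nn_integral_mono)
      fix l :: real
      show "(if 0 < l then ennreal (cK2 ?d sg * l powr (- ?b - 1)) * ?P i l p else 0) \<le> ennreal ?m * (ennreal (l powr (- ?b - 1)) * indicator {?a..} l)"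
      proof (cases "0 < l \<and> real ?d / l \<le> norm (p i)")
        case True
        then have "real ?d \<le> norm (p i) * l" using pos_divide_le_eq[of l "real ?d" "norm (p i)"] by blast
        then have "?a \<le> l" using False by (simp add: pos_divide_le_eq mult.commute)
        then show ?thesis using True K by (simp add: ennreal_mult[symmetric] mult_ac)
      qed auto
    qed
    also have "\<dots> = ennreal ?m * ennreal (?a powr (- ?b) / ?b)"
      using nn_integral_powr_tail[OF a b] by (subst nn_integral_cmult) simp_all
    also have "\<dots> = ennreal (?m * (?a powr (- ?b) / ?b))"
      using K b by (intro ennreal_mult[symmetric]) auto
    also have "?m * (?a powr (- ?b) / ?b) = cK3 ?d s sg * (norm (p i) powr (2 * s) * (cmod (FT N f p))\<^sup>2)"
    proof -
      have "?a powr (- ?b) = real ?d powr (- ?b) * norm (p i) powr ?b"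
        using False by (subst powr_divide) (simp_all add: powr_minus divide_inverse del: minus_diff_eq)
      moreover have "norm (p i) powr (2 * sg) * norm (p i) powr ?b = norm (p i) powr (2 * s)"
        by (simp add: powr_add[symmetric])
      moreover have "(k * (u * F)) * ((D * v) / B) = (k * (D / B)) * ((u * v) * F)" for k u F D v B :: real by simp
      ultimately show ?thesis unfolding cK3_def by (simp only: minus_diff_eq)
    qed
    also have "ennreal \<dots> = ennreal (cK3 ?d s sg) * ennreal (norm (p i) powr (2 * s) * (cmod (FT N f p))\<^sup>2)"
      using K b unfolding cK3_def by (intro ennreal_mult) auto
    finally show ?thesis .
  qed
  have "(\<integral>\<^sup>+x. Fint s sg N f x \<partial>lborel) = (\<integral>\<^sup>+l. (\<integral>\<^sup>+x. (if 0 < l then ennreal (l powr (- 2 * s - 1)) * Hh sg N f l x else 0) \<partial>lborel) \<partial>lborel)"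
    unfolding Fint_def by (rule lborel_pair.Fubini'[symmetric]) measurable
  also have "\<dots> \<le> (\<integral>\<^sup>+l. (\<Sum>i<N. \<integral>\<^sup>+p. (if 0 < l then ennreal (cK2 ?d sg * l powr (- ?b - 1)) * ?P i l p else 0) \<partial>cfg N) \<partial>lborel)"
  proof (intro nn_integral_mono)
    fix l :: real
    show "(\<integral>\<^sup>+x. (if 0 < l then ennreal (l powr (- 2 * s - 1)) * Hh sg N f l x else 0) \<partial>lborel)
      \<le> (\<Sum>i<N. \<integral>\<^sup>+p. (if 0 < l then ennreal (cK2 ?d sg * l powr (- ?b - 1)) * ?P i l p else 0) \<partial>cfg N)"
    proof (cases "0 < l")
      case l: True
      have "(\<integral>\<^sup>+x. ennreal (l powr (- 2 * s - 1)) * Hh sg N f l x \<partial>lborel) = ennreal (l powr (- 2 * s - 1)) * (\<integral>\<^sup>+x. Hh sg N f l x \<partial>lborel)"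
        by (rule nn_integral_cmult) measurable
      also have "\<dots> \<le> ennreal (l powr (- 2 * s - 1)) * (ennreal (cK2 ?d sg * l powr (2 * sg)) * (\<Sum>i<N. \<integral>\<^sup>+p. ?P i l p \<partial>cfg N))"
        by (intro mult_left_mono nn_integral_Hh l) simp
      also have "\<dots> = ennreal (cK2 ?d sg * l powr (- ?b - 1)) * (\<Sum>i<N. \<integral>\<^sup>+p. ?P i l p \<partial>cfg N)"
      proof -
        have "l powr (- 2 * s - 1) * l powr (2 * sg) = l powr (- ?b - 1)" by (subst powr_add[symmetric]) (simp add: algebra_simps)
        then have "l powr (- 2 * s - 1) * (cK2 ?d sg * l powr (2 * sg)) = cK2 ?d sg * l powr (- ?b - 1)"
          by (simp only: mult.left_commute)
        then show ?thesis using K by (simp only: mult.assoc[symmetric] ennreal_mult[symmetric] powr_ge_zero mult_nonneg_nonneg)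
      qed
      also have "\<dots> = (\<Sum>i<N. \<integral>\<^sup>+p. ennreal (cK2 ?d sg * l powr (- ?b - 1)) * ?P i l p \<partial>cfg N)"
        unfolding sum_distrib_left
      proof (intro sum.cong refl nn_integral_cmult[symmetric])
        fix i assume "i \<in> {..<N}"
        then have [measurable]: "(\<lambda>p. p i) \<in> borel_measurable (cfg N :: (nat \<Rightarrow> real^'d) measure)" by (intro measurable_cfg_coord) simp
        show "(\<lambda>p. ?P i l p) \<in> borel_measurable (cfg N)" by measurable
      qed
      finally show ?thesis using l by (simp only: if_True)
    qed simp
  qed
  also have "\<dots> = (\<Sum>i<N. \<integral>\<^sup>+l. (\<integral>\<^sup>+p. (if 0 < l then ennreal (cK2 ?d sg * l powr (- ?b - 1)) * ?P i l p else 0) \<partial>cfg N) \<partial>lborel)"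
  proof (rule nn_integral_sum)
    fix i assume "i \<in> {..<N}"
    then have "i < N" by simp
    from measurable_pair_swap[OF Pm[OF this]]
    have "(\<lambda>(l, p). if 0 < l then ennreal (cK2 ?d sg * l powr (- ?b - 1)) * ?P i l p else 0) \<in> borel_measurable (lborel \<Otimes>\<^sub>M cfg N)"
      by (simp only: prod.case)
    from sigma_finite_measure.borel_measurable_nn_integral[OF sigma_finite_cfg this]
    show "(\<lambda>l. \<integral>\<^sup>+p. (if 0 < l then ennreal (cK2 ?d sg * l powr (- ?b - 1)) * ?P i l p else 0) \<partial>cfg N) \<in> borel_measurable lborel" .
  qed
  also have "\<dots> = (\<Sum>i<N. \<integral>\<^sup>+p. (\<integral>\<^sup>+l. (if 0 < l then ennreal (cK2 ?d sg * l powr (- ?b - 1)) * ?P i l p else 0) \<partial>lborel) \<partial>cfg N)"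
    by (intro sum.cong refl cl.Fubini'[OF Pm]) simp
  also have "\<dots> \<le> (\<Sum>i<N. \<integral>\<^sup>+p. ennreal (cK3 ?d s sg) * ennreal (norm (p i) powr (2 * s) * (cmod (FT N f p))\<^sup>2) \<partial>cfg N)"
    by (intro sum_mono nn_integral_mono Pp)
  also have "\<dots> = ennreal (cK3 ?d s sg) * (\<Sum>i<N. \<integral>\<^sup>+p. ennreal (norm (p i) powr (2 * s) * (cmod (FT N f p))\<^sup>2) \<partial>cfg N)"
    unfolding sum_distrib_left
  proof (intro sum.cong refl nn_integral_cmult)
    fix i assume "i \<in> {..<N}"
    then have [measurable]: "(\<lambda>p. p i) \<in> borel_measurable (cfg N :: (nat \<Rightarrow> real^'d) measure)" by (intro measurable_cfg_coord) simp
    show "(\<lambda>p. ennreal (norm (p i) powr (2 * s) * (cmod (FT N f p))\<^sup>2)) \<in> borel_measurable (cfg N)" by measurable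
  qed
  finally show ?thesis .
qed

text \<open>For large \<open>l\<close> the packing term is at most half of \<open>t\<close>, so
  \<open>Hh\<close> carries the other half. A real lower bound \<open>t\<close> is used instead of
  the density, which may be infinite and which, for the approximants, is only known to exceed a
  fraction of the density in the limit.\<close>

lemma Fint_lower:
  fixes \<epsilon> c :: real
  assumes s: "s > 0" and \<epsilon>: "0 < \<epsilon>" "\<epsilon> \<le> 1"
    and small: "cLow CARD('d) * (2 * real CARD('d) * \<epsilon>)\<^sup>2 * (4 * pi) ^ CARD('d) \<le> 1/2"
    and diag: "\<And>x. x \<in> cfg_space N \<Longrightarrow> (\<exists>i<N. \<exists>j<N. i \<noteq> j \<and> x i = x j) \<Longrightarrow> f x = 0"
    and mass: "(\<integral>\<^sup>+X. ennreal ((cmod (f X))\<^sup>2) \<partial>cfg N) \<le> 2"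
    and c: "c > 0" "4 * cLow CARD('d) * cPack CARD('d) \<epsilon> \<le> c"
    and t: "t \<ge> 0" "ennreal t \<le> rhoN N f x"
  shows "ennreal ((2 * c) powr (- 2 * s / CARD('d)) / (4 * s) * t powr (1 + 2 * s / CARD('d))) \<le> Fint s sg N f x"
proof (cases "t = 0")
  case False
  then have t0: "t > 0" using t by simp
  let ?d = "real CARD('d)"
  \<comment> \<open>The scale at which \<open>c / l ^ d\<close> equals \<open>t / 2\<close>;
    integrating the weight beyond it gives \<open>l0 powr (- (2 * s)) / (2 * s)\<close>, the source
    of the extra power \<open>2 * s / d\<close> of \<open>t\<close>.\<close>
  define l0 where "l0 = (2 * c / t) powr (1 / ?d)"
  have l0: "l0 > 0" using c t0 by (simp add: l0_def)
  have l0d: "l0 ^ CARD('d) = 2 * c / t"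
    using l0 c t0 unfolding powr_realpow[OF l0, symmetric] unfolding l0_def powr_powr by simp
  have H: "ennreal (t / 2) \<le> Hh sg N f l x" if l: "l0 \<le> l" for l
  proof -
    have lp: "l > 0" using l l0 by simp
    have "2 * c / t \<le> l ^ CARD('d)" unfolding l0d[symmetric] using l l0 by (intro power_mono) auto
    then have "c / l ^ CARD('d) \<le> t / 2" using t0 lp by (simp add: field_simps)
    moreover have "4 * cLow CARD('d) * cPack CARD('d) \<epsilon> / l ^ CARD('d) \<le> c / l ^ CARD('d)"
      using c lp by (intro divide_right_mono) auto
    ultimately have "4 * cLow CARD('d) * cPack CARD('d) \<epsilon> / l ^ CARD('d) \<le> t / 2" by linarith
    then have "ennreal t \<le> ennreal (t / 2) + Hh sg N f l x"
      using order_trans[OF t(2) rhoN_pointwise[OF lp \<epsilon> small diag mass, of x]]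
      by (meson add_right_mono ennreal_leI order_trans)
    moreover have "ennreal t = ennreal (t / 2) + ennreal (t / 2)"
      using t0 by (subst ennreal_plus[symmetric]) auto
    ultimately show ?thesis by simp
  qed
  have "(2 * c) powr (- 2 * s / ?d) / (4 * s) * t powr (1 + 2 * s / ?d) = t / 2 * (l0 powr (- (2 * s)) / (2 * s))"
  proof -
    have "l0 powr (- (2 * s)) = (2 * c / t) powr (- 2 * s / ?d)" unfolding l0_def powr_powr by simp
    also have "\<dots> = (2 * c) powr (- 2 * s / ?d) * t powr (2 * s / ?d)"
      using c t0 by (subst powr_divide) (simp_all add: powr_minus divide_inverse)
    finally have "t / 2 * (l0 powr (- (2 * s)) / (2 * s)) = (2 * c) powr (- 2 * s / ?d) / (4 * s) * (t * t powr (2 * s / ?d))"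
      by (simp only:) simp
    moreover have "t powr (1 + 2 * s / ?d) = t * t powr (2 * s / ?d)" using t0 by (subst powr_add) simp
    ultimately show ?thesis by (simp only:)
  qed
  then have "ennreal ((2 * c) powr (- 2 * s / ?d) / (4 * s) * t powr (1 + 2 * s / ?d)) = ennreal (t / 2) * ennreal (l0 powr (- (2 * s)) / (2 * s))"
    using s t0 by (simp only:) (rule ennreal_mult; simp)
  also have "\<dots> = (\<integral>\<^sup>+l. ennreal (t / 2) * (ennreal (l powr (- (2 * s) - 1)) * indicator {l0..} l) \<partial>lborel)"
    using nn_integral_powr_tail[OF l0, of "2 * s"] s by (subst nn_integral_cmult) simp_all
  also have "\<dots> \<le> Fint s sg N f x"
    unfolding Fint_def
  proof (intro nn_integral_mono)
    fix l
    show "ennreal (t / 2) * (ennreal (l powr (- (2 * s) - 1)) * indicator {l0..} l) \<le> (if 0 < l then ennreal (l powr (- 2 * s - 1)) * Hh sg N f l x else 0)"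
    proof (cases "l0 \<le> l")
      case True
      then show ?thesis using l0 mult_left_mono[OF H[OF True], of "ennreal (l powr (- 2 * s - 1))"]
        by (simp add: mult.commute)
    qed simp
  qed
  finally show ?thesis .
qed simp

end

subsection \<open>Passage to the closure\<close>

lemma norm_sq_young:
  fixes a b :: "'a::real_normed_vector"
  assumes "\<eta> > 0"
  shows "(norm a)\<^sup>2 \<le> (1 + \<eta>) * (norm b)\<^sup>2 + (1 + 1/\<eta>) * (norm (a - b))\<^sup>2"
proof -
  have "norm a \<le> norm b + norm (a - b)" using norm_triangle_ineq[of b "a - b"] by simp
  then have "(norm a)\<^sup>2 \<le> (norm b + norm (a - b))\<^sup>2" by (intro power_mono) auto
  moreover have "2 * norm b * norm (a - b) \<le> \<eta> * (norm b)\<^sup>2 + (norm (a - b))\<^sup>2 / \<eta>"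
  proof -
    have "0 \<le> (\<eta> * norm b - norm (a - b))\<^sup>2 / \<eta>" using assms by simp
    also have "\<dots> = \<eta> * (norm b)\<^sup>2 + (norm (a - b))\<^sup>2 / \<eta> - 2 * norm b * norm (a - b)"
      using assms by (simp add: power2_eq_square field_simps)
    finally show ?thesis by simp
  qed
  ultimately show ?thesis by (simp add: power2_sum algebra_simps)
qed

text \<open>Recovers a triangle inequality for square roots from the family of weighted
  inequalities, by optimising over \<open>\<eta>\<close>. This spares a Minkowski inequality for the
  weighted norms.\<close>

lemma sqrt_le_add_if_young:
  assumes nn: "a \<ge> 0" "b \<ge> 0" "c \<ge> (0::real)"
    and young: "\<And>\<eta>. \<eta> > 0 \<Longrightarrow> a \<le> (1 + \<eta>) * b + (1 + 1/\<eta>) * c"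
  shows "sqrt a \<le> sqrt b + sqrt c"
proof (rule field_le_epsilon)
  fix e :: real assume "e > 0"
  \<comment> \<open>The optimal weight is the ratio of the two roots; adding \<open>e / 2\<close>
    keeps both positive, so that \<open>v / u\<close> is admissible even if \<open>b\<close> or
    \<open>c\<close> is 0.\<close>
  define u v where "u = sqrt b + e / 2" and "v = sqrt c + e / 2"
  have uv: "u > 0" "v > 0" using \<open>e > 0\<close> nn by (auto simp: u_def v_def add_nonneg_pos)
  have "sqrt b \<le> u" "sqrt c \<le> v" using \<open>e > 0\<close> by (auto simp: u_def v_def)
  then have le: "b \<le> u\<^sup>2" "c \<le> v\<^sup>2" using nn by (auto simp: real_le_lsqrt sqrt_le_D)
  have "a \<le> (1 + v / u) * b + (1 + 1 / (v / u)) * c" using uv by (intro young) simp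
  also have "\<dots> \<le> (1 + v / u) * u\<^sup>2 + (1 + 1 / (v / u)) * v\<^sup>2"
    using uv le by (intro add_mono mult_left_mono) auto
  also have "\<dots> = (u + v)\<^sup>2" using uv by (simp add: power2_eq_square field_simps)
  finally have "sqrt a \<le> u + v" using uv by (intro real_le_lsqrt) (auto simp: nn)
  then show "sqrt a \<le> sqrt b + sqrt c + e" by (simp add: u_def v_def)
qed

lemma convergent_if_young:
  fixes a :: "nat \<Rightarrow> real"
  assumes nn: "\<And>n. a n \<ge> 0" "\<And>n m. D n m \<ge> 0"
    and young: "\<And>n m \<eta>. \<eta> > 0 \<Longrightarrow> a n \<le> (1 + \<eta>) * a m + (1 + 1/\<eta>) * D n m"
    and D: "\<And>e. e > 0 \<Longrightarrow> \<exists>M. \<forall>n\<ge>M. \<forall>m\<ge>M. D n m < e"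
  shows "convergent a"
proof -
  have tri: "sqrt (a n) \<le> sqrt (a m) + sqrt (D n m)" for n m
    by (rule sqrt_le_add_if_young[OF nn(1) nn(1) nn(2) young])
  have "Cauchy (\<lambda>n. sqrt (a n))"
  proof (rule CauchyI)
    fix e :: real assume e: "e > 0"
    then obtain M where M: "\<And>n m. n \<ge> M \<Longrightarrow> m \<ge> M \<Longrightarrow> D n m < e\<^sup>2" using D[of "e\<^sup>2"] by auto
    have "\<bar>sqrt (a n) - sqrt (a m)\<bar> < e" if "n \<ge> M" "m \<ge> M" for n m
    proof -
      have "sqrt (D n m) < e" "sqrt (D m n) < e"
        using M[OF that] M[OF that(2) that(1)] e by (auto intro: real_less_lsqrt)
      then show ?thesis using tri[of n m] tri[of m n] by linarith
    qed
    then show "\<exists>M. \<forall>m\<ge>M. \<forall>n\<ge>M. norm (sqrt (a m) - sqrt (a n)) < e" by auto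
  qed
  then obtain l where "(\<lambda>n. sqrt (a n)) \<longlonglongrightarrow> l" using Cauchy_convergent convergent_def by blast
  from tendsto_power[OF this, of 2] have "a \<longlonglongrightarrow> l\<^sup>2" using nn(1) by simp
  then show ?thesis by (auto simp: convergent_def)
qed

section \<open>The kinetic form along an approximating sequence\<close>

lemma FT_diff:
  fixes f g :: "(nat \<Rightarrow> real^'d) \<Rightarrow> complex"
  assumes "integrable (cfg N) f" "integrable (cfg N) g"
  shows "FT N (\<lambda>x. f x - g x) p = FT N f p - FT N g p"
proof -
  have int: "integrable (cfg N) (\<lambda>y. cis (- cB N p y) * h y)" if h: "integrable (cfg N) h" for h
  proof (rule Bochner_Integration.integrable_bound[OF h])
    have [measurable]: "h \<in> borel_measurable (cfg N)" using h by simp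
    have [measurable]: "(\<lambda>y. y i) \<in> borel_measurable (cfg N :: (nat \<Rightarrow> real^'d) measure)" if "i \<in> {..<N}" for i
      using that by (intro measurable_cfg_coord) simp
    show "(\<lambda>y. cis (- cB N p y) * h y) \<in> borel_measurable (cfg N)"
      unfolding cB_def by measurable
  qed (simp add: norm_mult)
  show ?thesis
    unfolding FT_eq C.ft_def right_diff_distrib Bochner_Integration.integral_diff[OF int[OF assms(1)] int[OF assms(2)]] ..
qed

text \<open>Every summand is bounded by the full Sobolev weight. The resulting factor
  \<open>N\<close> is harmless, as the estimate serves only to prove convergence of the kinetic
  form.\<close>

lemma kinetic_weight_le:
  fixes p :: "nat \<Rightarrow> real^'d"
  assumes "s \<ge> 0"
  shows "(\<Sum>i<N. norm (p i) powr (2 * s)) \<le> real N * (1 + (\<Sum>i<N. (norm (p i))\<^sup>2)) powr s"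
proof -
  have "norm (p i) powr (2 * s) \<le> (1 + (\<Sum>i<N. (norm (p i))\<^sup>2)) powr s" if "i < N" for i
  proof -
    have "norm (p i) powr (2 * s) = ((norm (p i))\<^sup>2) powr s"
      by (simp add: powr_powr[symmetric] powr_numeral[symmetric] del: powr_numeral powr_powr)
         (simp add: powr_numeral)?
    also have "\<dots> \<le> (1 + (\<Sum>i<N. (norm (p i))\<^sup>2)) powr s"
      using that assms member_le_sum[of i "{..<N}" "\<lambda>i. (norm (p i))\<^sup>2"] by (intro powr_mono2) auto
    finally show ?thesis .
  qed
  then have "(\<Sum>i<N. norm (p i) powr (2 * s)) \<le> (\<Sum>i<N. (1 + (\<Sum>i<N. (norm (p i))\<^sup>2)) powr s)"
    by (intro sum_mono) simp
  then show ?thesis by simp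
qed

lemma FT_measurable_cfg:
  fixes f :: "(nat \<Rightarrow> real^'d) \<Rightarrow> complex"
  assumes [measurable]: "f \<in> borel_measurable (cfg N)"
  shows "FT N f \<in> borel_measurable (cfg N)"
  unfolding FT_eq[abs_def] by measurable

lemma smooth_FT_hs_integrable:
  fixes f :: "(nat \<Rightarrow> real^'d) \<Rightarrow> complex"
  assumes "smooth_cfg N f" "supp_in N R f"
  shows "integrable (cfg N) (\<lambda>p. (1 + (\<Sum>i<N. (norm (p i))\<^sup>2)) powr s * (cmod (FT N f p))\<^sup>2)"
proof -
  have "(1 + (\<Sum>i<N. (norm (p i))\<^sup>2)) powr s * (cmod (FT N f p))\<^sup>2
      = ((2*pi) powr (- real (CARD('d) * N) / 2))\<^sup>2 * ((1 + (\<Sum>i<N. (norm (p i))\<^sup>2)) powr s * (cmod (C.ft N f p))\<^sup>2)" for p :: "nat \<Rightarrow> real^'d"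
    unfolding FT_eq norm_mult power_mult_distrib by simp
  then show ?thesis using integrable_mult_right[OF smooth_ft_hs_integrable[OF assms, of s]] by (simp only:)
qed

lemma kin_integrable_if_hs:
  fixes h :: "(nat \<Rightarrow> real^'d) \<Rightarrow> complex"
  assumes s: "s \<ge> 0" and "h \<in> borel_measurable (cfg N)"
    and int: "integrable (cfg N) (\<lambda>p. (1 + (\<Sum>i<N. (norm (p i))\<^sup>2)) powr s * (cmod (h p))\<^sup>2)"
  shows "integrable (cfg N) (\<lambda>p. (\<Sum>i<N. norm (p i) powr (2 * s)) * (cmod (h p))\<^sup>2)"
    and "(\<integral>p. (\<Sum>i<N. norm (p i) powr (2 * s)) * (cmod (h p))\<^sup>2 \<partial>cfg N)
      \<le> real N * (\<integral>p. (1 + (\<Sum>i<N. (norm (p i))\<^sup>2)) powr s * (cmod (h p))\<^sup>2 \<partial>cfg N)"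
proof -
  note [measurable] = assms(2)
  have [measurable]: "(\<lambda>y. y i) \<in> borel_measurable (cfg N :: (nat \<Rightarrow> real^'d) measure)" if "i \<in> {..<N}" for i
    using that by (intro measurable_cfg_coord) simp
  have le: "(\<Sum>i<N. norm (p i) powr (2 * s)) * (cmod (h p))\<^sup>2
      \<le> real N * ((1 + (\<Sum>i<N. (norm (p i))\<^sup>2)) powr s * (cmod (h p))\<^sup>2)" for p :: "nat \<Rightarrow> real^'d"
    unfolding mult.assoc[symmetric] by (intro mult_right_mono kinetic_weight_le s) simp
  have int': "integrable (cfg N) (\<lambda>p. real N * ((1 + (\<Sum>i<N. (norm (p i))\<^sup>2)) powr s * (cmod (h p))\<^sup>2))"
    by (intro integrable_mult_right int)
  show kint: "integrable (cfg N) (\<lambda>p. (\<Sum>i<N. norm (p i) powr (2 * s)) * (cmod (h p))\<^sup>2)"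
  proof (rule Bochner_Integration.integrable_bound[OF int'])
    show "(\<lambda>p. (\<Sum>i<N. norm (p i) powr (2 * s)) * (cmod (h p))\<^sup>2) \<in> borel_measurable (cfg N)" by measurable
    show "AE p in cfg N. norm ((\<Sum>i<N. norm (p i) powr (2 * s)) * (cmod (h p))\<^sup>2)
        \<le> norm (real N * ((1 + (\<Sum>i<N. (norm (p i))\<^sup>2)) powr s * (cmod (h p))\<^sup>2))"
    proof (intro AE_I2)
      fix p :: "nat \<Rightarrow> real^'d"
      have "0 \<le> (\<Sum>i<N. norm (p i) powr (2 * s)) * (cmod (h p))\<^sup>2" by (intro mult_nonneg_nonneg sum_nonneg) auto
      then show "norm ((\<Sum>i<N. norm (p i) powr (2 * s)) * (cmod (h p))\<^sup>2)
        \<le> norm (real N * ((1 + (\<Sum>i<N. (norm (p i))\<^sup>2)) powr s * (cmod (h p))\<^sup>2))"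
        using le[of p] by simp
    qed
  qed
  have "(\<integral>p. (\<Sum>i<N. norm (p i) powr (2 * s)) * (cmod (h p))\<^sup>2 \<partial>cfg N)
      \<le> (\<integral>p. real N * ((1 + (\<Sum>i<N. (norm (p i))\<^sup>2)) powr s * (cmod (h p))\<^sup>2) \<partial>cfg N)"
    by (intro integral_mono kint int' le)
  then show "(\<integral>p. (\<Sum>i<N. norm (p i) powr (2 * s)) * (cmod (h p))\<^sup>2 \<partial>cfg N)
      \<le> real N * (\<integral>p. (1 + (\<Sum>i<N. (norm (p i))\<^sup>2)) powr s * (cmod (h p))\<^sup>2 \<partial>cfg N)" by simp
qed

context
  fixes N :: nat and f g :: "(nat \<Rightarrow> real^'d) \<Rightarrow> complex" and Rf Rg s :: real
  assumes f: "smooth_cfg N f" "supp_in N Rf f" and g: "smooth_cfg N g" "supp_in N Rg g" and s: "s \<ge> 0"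
begin

lemma FT_smooth_diff: "FT N (\<lambda>x. f x - g x) p = FT N f p - FT N g p"
  by (intro FT_diff cont_supp_integrable(1)[OF smooth_cfg_cont[OF f(1)] f(2)]
      cont_supp_integrable(1)[OF smooth_cfg_cont[OF g(1)] g(2)])

lemma FT_diff_hs_integrable:
  "integrable (cfg N) (\<lambda>p. (1 + (\<Sum>i<N. (norm (p i))\<^sup>2)) powr s * (cmod (FT N f p - FT N g p))\<^sup>2)"
    (is "integrable _ (\<lambda>p. ?w p * _)")
proof (rule Bochner_Integration.integrable_bound)
  note [measurable] = FT_measurable_cfg[OF cont_cfg_measurable[OF smooth_cfg_cont[OF f(1)]]]
    FT_measurable_cfg[OF cont_cfg_measurable[OF smooth_cfg_cont[OF g(1)]]]
  have [measurable]: "(\<lambda>y. y i) \<in> borel_measurable (cfg N :: (nat \<Rightarrow> real^'d) measure)" if "i \<in> {..<N}" for i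
    using that by (intro measurable_cfg_coord) simp
  show "(\<lambda>p. ?w p * (cmod (FT N f p - FT N g p))\<^sup>2) \<in> borel_measurable (cfg N)" by measurable
  show "integrable (cfg N) (\<lambda>p. 2 * (?w p * (cmod (FT N f p))\<^sup>2) + 2 * (?w p * (cmod (FT N g p))\<^sup>2))"
    by (intro Bochner_Integration.integrable_add integrable_mult_right smooth_FT_hs_integrable[OF f] smooth_FT_hs_integrable[OF g])
  show "AE p in cfg N. norm (?w p * (cmod (FT N f p - FT N g p))\<^sup>2)
      \<le> norm (2 * (?w p * (cmod (FT N f p))\<^sup>2) + 2 * (?w p * (cmod (FT N g p))\<^sup>2))"
  proof (intro AE_I2)
    fix p :: "nat \<Rightarrow> real^'d"
    have "(cmod (FT N f p - FT N g p))\<^sup>2 \<le> 2 * (cmod (FT N f p))\<^sup>2 + 2 * (cmod (FT N g p))\<^sup>2"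
      using norm_sq_young[of 1 "FT N f p - FT N g p" "FT N f p"] by simp
    from mult_left_mono[OF this, of "?w p"]
    show "norm (?w p * (cmod (FT N f p - FT N g p))\<^sup>2)
      \<le> norm (2 * (?w p * (cmod (FT N f p))\<^sup>2) + 2 * (?w p * (cmod (FT N g p))\<^sup>2))"
      by (simp add: algebra_simps)
  qed
qed

lemma kin_form_young:
  assumes "\<eta> > 0"
  shows "kin_form s N f \<le> (1 + \<eta>) * kin_form s N g + (1 + 1/\<eta>) * (real N * hs_norm2 s N (\<lambda>x. f x - g x))"
proof -
  have mf: "FT N f \<in> borel_measurable (cfg N)" and mg: "FT N g \<in> borel_measurable (cfg N)"
    by (intro FT_measurable_cfg cont_cfg_measurable smooth_cfg_cont f g)+
  note kf = kin_integrable_if_hs(1)[OF s mf smooth_FT_hs_integrable[OF f]]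
  note kg = kin_integrable_if_hs(1)[OF s mg smooth_FT_hs_integrable[OF g]]
  note kd = kin_integrable_if_hs[OF s borel_measurable_diff[OF mf mg] FT_diff_hs_integrable]
  have pw: "(\<Sum>i<N. norm (p i) powr (2 * s)) * (cmod (FT N f p))\<^sup>2
     \<le> (1 + \<eta>) * ((\<Sum>i<N. norm (p i) powr (2 * s)) * (cmod (FT N g p))\<^sup>2)
      + (1 + 1/\<eta>) * ((\<Sum>i<N. norm (p i) powr (2 * s)) * (cmod (FT N f p - FT N g p))\<^sup>2)" for p :: "nat \<Rightarrow> real^'d"
  proof -
    have "w * F \<le> A * (w * G) + B * (w * D)" if "F \<le> A * G + B * D" "w \<ge> 0" for w F A G B D :: real
      using mult_left_mono[OF that] by (simp add: algebra_simps)
    note young = this[OF norm_sq_young[OF assms]]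
    show ?thesis by (intro young sum_nonneg powr_ge_zero)
  qed
  have "kin_form s N f \<le> (\<integral>p. (1 + \<eta>) * ((\<Sum>i<N. norm (p i) powr (2 * s)) * (cmod (FT N g p))\<^sup>2)
      + (1 + 1/\<eta>) * ((\<Sum>i<N. norm (p i) powr (2 * s)) * (cmod (FT N f p - FT N g p))\<^sup>2) \<partial>cfg N)"
    unfolding kin_form_def
    by (intro integral_mono kf pw Bochner_Integration.integrable_add integrable_mult_right kg kd(1))
  also have "\<dots> = (1 + \<eta>) * kin_form s N g + (1 + 1/\<eta>) * (\<integral>p. (\<Sum>i<N. norm (p i) powr (2 * s)) * (cmod (FT N f p - FT N g p))\<^sup>2 \<partial>cfg N)"
    unfolding kin_form_def
    by (subst Bochner_Integration.integral_add) (intro integrable_mult_right kg kd(1) refl, intro integrable_mult_right kg kd(1) refl, simp)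
  also have "\<dots> \<le> (1 + \<eta>) * kin_form s N g + (1 + 1/\<eta>) * (real N * hs_norm2 s N (\<lambda>x. f x - g x))"
    using kd(2) assms unfolding hs_norm2_def FT_smooth_diff by (intro add_mono mult_left_mono order_refl) auto
  finally show ?thesis .
qed

end

lemma nn_integral_kin_form:
  fixes f :: "(nat \<Rightarrow> real^'d) \<Rightarrow> complex"
  assumes f: "smooth_cfg N f" "supp_in N R f" and s: "s \<ge> 0"
  shows "(\<Sum>i<N. \<integral>\<^sup>+p. ennreal (norm (p i) powr (2 * s) * (cmod (FT N f p))\<^sup>2) \<partial>cfg N) = ennreal (kin_form s N f)"
proof -
  have mf[measurable]: "FT N f \<in> borel_measurable (cfg N)"
    by (intro FT_measurable_cfg cont_cfg_measurable smooth_cfg_cont f)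
  note kf = kin_integrable_if_hs(1)[OF s mf smooth_FT_hs_integrable[OF f]]
  have "(\<Sum>i<N. \<integral>\<^sup>+p. ennreal (norm (p i) powr (2 * s) * (cmod (FT N f p))\<^sup>2) \<partial>cfg N)
      = (\<integral>\<^sup>+p. (\<Sum>i<N. ennreal (norm (p i) powr (2 * s) * (cmod (FT N f p))\<^sup>2)) \<partial>cfg N)"
  proof (rule nn_integral_sum[symmetric])
    fix i assume "i \<in> {..<N}"
    then have [measurable]: "(\<lambda>p. p i) \<in> borel_measurable (cfg N :: (nat \<Rightarrow> real^'d) measure)" by (intro measurable_cfg_coord) simp
    show "(\<lambda>p. ennreal (norm (p i) powr (2 * s) * (cmod (FT N f p))\<^sup>2)) \<in> borel_measurable (cfg N)" by measurable
  qed
  also have "\<dots> = (\<integral>\<^sup>+p. ennreal ((\<Sum>i<N. norm (p i) powr (2 * s)) * (cmod (FT N f p))\<^sup>2) \<partial>cfg N)"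
    by (intro nn_integral_cong) (simp add: sum_distrib_right sum_nonneg del: sum_ennreal flip: sum_ennreal)
  also have "\<dots> = ennreal (kin_form s N f)"
    unfolding kin_form_def by (intro nn_integral_eq_integral kf AE_I2 mult_nonneg_nonneg sum_nonneg) auto
  finally show ?thesis .
qed

lemma kin_form_nonneg: "kin_form s N f \<ge> 0"
  unfolding kin_form_def by (intro integral_nonneg_AE AE_I2 mult_nonneg_nonneg sum_nonneg) auto

lemma hs_norm2_nonneg: "hs_norm2 s N f \<ge> 0"
  unfolding hs_norm2_def by (intro integral_nonneg_AE AE_I2) auto

lemma test_fnD:
  assumes "test_fn N f"
  obtains R where "smooth_cfg N f" "supp_in N R f" "\<And>x. x \<in> cfg_space N \<Longrightarrow> (\<exists>i<N. \<exists>j<N. i \<noteq> j \<and> x i = x j) \<Longrightarrow> f x = 0"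
proof -
  note t = assms[unfolded test_fn_def supp_in_def[symmetric]]
  from t[THEN conjunct2, THEN conjunct1] obtain R where "supp_in N R f" ..
  then show thesis by (rule that[OF t[THEN conjunct1]]) (use t[THEN conjunct2, THEN conjunct2] in simp)
qed

text \<open>\<open>kinetic\<close> is defined by \<open>lim\<close>, whose value means nothing
  without convergence. The sequence is Cauchy in the Sobolev norm, and the square root of the
  kinetic form is a seminorm controlled by it.\<close>

lemma kin_form_convergent:
  fixes \<Psi> :: "(nat \<Rightarrow> real^'d) \<Rightarrow> complex"
  assumes ap: "hs_approx s N \<Psi> \<phi>" and s: "s \<ge> 0"
  shows "convergent (\<lambda>n. kin_form s N (\<phi> n))"
proof (rule convergent_if_young[where D="\<lambda>n m. real N * hs_norm2 s N (\<lambda>x. \<phi> n x - \<phi> m x)"])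
  show "kin_form s N (\<phi> n) \<ge> 0" for n by (rule kin_form_nonneg)
  show "real N * hs_norm2 s N (\<lambda>x. \<phi> n x - \<phi> m x) \<ge> 0" for n m by (simp add: hs_norm2_nonneg)
  show "kin_form s N (\<phi> n) \<le> (1 + \<eta>) * kin_form s N (\<phi> m) + (1 + 1/\<eta>) * (real N * hs_norm2 s N (\<lambda>x. \<phi> n x - \<phi> m x))"
    if "\<eta> > 0" for n m \<eta>
  proof -
    have "test_fn N (\<phi> n)" "test_fn N (\<phi> m)" using ap by (auto simp: hs_approx_def)
    then obtain R R' where "smooth_cfg N (\<phi> n)" "supp_in N R (\<phi> n)" "smooth_cfg N (\<phi> m)" "supp_in N R' (\<phi> m)"
      by (elim test_fnD)
    then show ?thesis by (intro kin_form_young[OF _ _ _ _ s that])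
  qed
  fix e :: real assume e: "e > 0"
  \<comment> \<open>Dividing by \<open>N + 1\<close> instead of \<open>N\<close> covers
    \<open>N = 0\<close>.\<close>
  then have "e / (real N + 1) > 0" by simp
  then obtain M where M: "\<forall>n\<ge>M. \<forall>m\<ge>M. hs_norm2 s N (\<lambda>x. \<phi> n x - \<phi> m x) < e / (real N + 1)"
    using ap unfolding hs_approx_def by blast
  have "real N * hs_norm2 s N (\<lambda>x. \<phi> n x - \<phi> m x) < e" if "n \<ge> M" "m \<ge> M" for n m
  proof -
    have "hs_norm2 s N (\<lambda>x. \<phi> n x - \<phi> m x) < e / (real N + 1)" using M that by blast
    then have "(real N + 1) * hs_norm2 s N (\<lambda>x. \<phi> n x - \<phi> m x) < e" by (simp add: pos_less_divide_eq mult.commute)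
    then show ?thesis using hs_norm2_nonneg[of s N "\<lambda>x. \<phi> n x - \<phi> m x"] by (simp add: algebra_simps)
  qed
  then show "\<exists>M. \<forall>n\<ge>M. \<forall>m\<ge>M. real N * hs_norm2 s N (\<lambda>x. \<phi> n x - \<phi> m x) < e" by blast
qed

section \<open>Comparison of the densities of a function and its approximants\<close>

lemma rho_measurable:
  fixes \<Psi> :: "(nat \<Rightarrow> real^'d) \<Rightarrow> complex"
  assumes \<Psi>: "\<Psi> \<in> borel_measurable (cfg N)"
  shows "rho N \<Psi> \<in> borel_measurable borel"
  unfolding rho_def[abs_def] others_def[symmetric]
proof (intro borel_measurable_sum)
  fix j assume "j \<in> {..<N}"
  then have j: "j < N" by simp
  interpret o: sigma_finite_measure "others N j :: (nat \<Rightarrow> real^'d) measure" by (rule sigma_finite_others)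
  have "(\<lambda>(x, X). (cmod (\<Psi> (X(j := x))))\<^sup>2) \<in> borel_measurable (lborel \<Otimes>\<^sub>M others N j)"
    using measurable_compose[OF slice_measurable[OF j \<Psi>], of "\<lambda>c. (cmod c)\<^sup>2" borel]
    by (simp add: case_prod_beta)
  from o.borel_measurable_lebesgue_integral[OF this]
  show "(\<lambda>x. \<integral>y. (cmod (\<Psi> (y(j := x))))\<^sup>2 \<partial>others N j) \<in> borel_measurable borel" by simp
qed

lemma ennreal_integral_le_nn_integral:
  fixes f :: "'a \<Rightarrow> real"
  assumes "\<And>x. f x \<ge> 0"
  shows "ennreal (\<integral>x. f x \<partial>M) \<le> (\<integral>\<^sup>+x. ennreal (f x) \<partial>M)"
proof (cases "integrable M f")
  case True
  then show ?thesis using nn_integral_eq_integral[OF True] assms by simp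
qed (simp add: not_integrable_integral_eq)

lemma rho_nonneg: "rho N \<Psi> x \<ge> 0"
  unfolding rho_def by (intro sum_nonneg integral_nonneg_AE AE_I2) simp

text \<open>A divergent integral counts as 0 on the left and as infinity on the right. One direction
  is enough, since \<open>rho\<close> stands on the smaller side of the final inequality.\<close>

lemma rho_le_rhoN: "ennreal (rho N \<Psi> x) \<le> rhoN N \<Psi> x"
proof -
  have "ennreal (rho N \<Psi> x) = (\<Sum>j<N. ennreal (\<integral>X. (cmod (\<Psi> (X(j := x))))\<^sup>2 \<partial>others N j))"
    unfolding rho_def others_def[symmetric] by (intro sum_ennreal[symmetric] integral_nonneg_AE AE_I2) simp
  also have "\<dots> \<le> rhoN N \<Psi> x"
    unfolding rhoN_def by (intro sum_mono ennreal_integral_le_nn_integral) simp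
  finally show ?thesis .
qed

lemma ennreal_norm_sq_young:
  fixes a b :: "'a::real_normed_vector"
  assumes "\<eta> > 0"
  shows "ennreal ((norm a)\<^sup>2) \<le> ennreal (1 + \<eta>) * ennreal ((norm b)\<^sup>2) + ennreal (1 + 1/\<eta>) * ennreal ((norm (a - b))\<^sup>2)"
proof -
  have "ennreal ((norm a)\<^sup>2) \<le> ennreal ((1 + \<eta>) * (norm b)\<^sup>2 + (1 + 1/\<eta>) * (norm (a - b))\<^sup>2)"
    by (intro ennreal_leI norm_sq_young assms)
  also have "\<dots> = ennreal ((1 + \<eta>) * (norm b)\<^sup>2) + ennreal ((1 + 1/\<eta>) * (norm (a - b))\<^sup>2)"
    using assms by (intro ennreal_plus mult_nonneg_nonneg) auto
  also have "\<dots> = ennreal (1 + \<eta>) * ennreal ((norm b)\<^sup>2) + ennreal (1 + 1/\<eta>) * ennreal ((norm (a - b))\<^sup>2)"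
    using assms by (intro arg_cong2[where f="(+)"] ennreal_mult) auto
  finally show ?thesis .
qed

text \<open>Where the error density is small, the density of the limit can exceed that of the
  approximant by little more than a factor 2. This transfers lower bounds at a point without
  convergence of the functions themselves.\<close>

lemma rhoN_young:
  fixes \<Psi> \<phi> :: "(nat \<Rightarrow> real^'d) \<Rightarrow> complex"
  assumes \<Psi>: "\<Psi> \<in> borel_measurable (cfg N)" and \<phi>: "\<phi> \<in> borel_measurable (cfg N)"
  shows "rhoN N \<Psi> x \<le> 2 * rhoN N \<phi> x + 2 * rhoN N (\<lambda>X. \<phi> X - \<Psi> X) x"
proof -
  have "(\<integral>\<^sup>+X. ennreal ((cmod (\<Psi> (X(i := x))))\<^sup>2) \<partial>others N i)
     \<le> 2 * (\<integral>\<^sup>+X. ennreal ((cmod (\<phi> (X(i := x))))\<^sup>2) \<partial>others N i) + 2 * (\<integral>\<^sup>+X. ennreal ((cmod (\<phi> (X(i := x)) - \<Psi> (X(i := x))))\<^sup>2) \<partial>others N i)"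
    if i: "i < N" for i
  proof -
    note [measurable] = slice_section_measurable[OF i \<Psi>] slice_section_measurable[OF i \<phi>]
    have "(\<integral>\<^sup>+X. ennreal ((cmod (\<Psi> (X(i := x))))\<^sup>2) \<partial>others N i)
      \<le> (\<integral>\<^sup>+X. 2 * ennreal ((cmod (\<phi> (X(i := x))))\<^sup>2) + 2 * ennreal ((cmod (\<phi> (X(i := x)) - \<Psi> (X(i := x))))\<^sup>2) \<partial>others N i)"
    proof (intro nn_integral_mono)
      fix X :: "nat \<Rightarrow> real^'d"
      show "ennreal ((cmod (\<Psi> (X(i := x))))\<^sup>2) \<le> 2 * ennreal ((cmod (\<phi> (X(i := x))))\<^sup>2) + 2 * ennreal ((cmod (\<phi> (X(i := x)) - \<Psi> (X(i := x))))\<^sup>2)"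
        using ennreal_norm_sq_young[of 1 "\<Psi> (X(i := x))" "\<phi> (X(i := x))"] by (simp add: norm_minus_commute)
    qed
    also have "\<dots> = 2 * (\<integral>\<^sup>+X. ennreal ((cmod (\<phi> (X(i := x))))\<^sup>2) \<partial>others N i) + 2 * (\<integral>\<^sup>+X. ennreal ((cmod (\<phi> (X(i := x)) - \<Psi> (X(i := x))))\<^sup>2) \<partial>others N i)"
      by (simp add: nn_integral_add nn_integral_cmult)
    finally show ?thesis .
  qed
  then have "rhoN N \<Psi> x \<le> (\<Sum>i<N. 2 * (\<integral>\<^sup>+X. ennreal ((cmod (\<phi> (X(i := x))))\<^sup>2) \<partial>others N i) + 2 * (\<integral>\<^sup>+X. ennreal ((cmod (\<phi> (X(i := x)) - \<Psi> (X(i := x))))\<^sup>2) \<partial>others N i))"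
    unfolding rhoN_def by (intro sum_mono) auto
  then show ?thesis unfolding rhoN_def by (simp only: sum.distrib sum_distrib_left)
qed

lemma ennreal_tendsto_zero_if_suminf_finite:
  fixes g :: "nat \<Rightarrow> ennreal"
  assumes "(\<Sum>k. g k) \<noteq> \<infinity>" and e: "(e::real) > 0"
  shows "eventually (\<lambda>k. g k \<le> ennreal e) sequentially"
proof -
  have fin: "g k \<noteq> top" for k
  proof
    assume "g k = top"
    moreover have "g k \<le> (\<Sum>k. g k)" using sum_le_suminf[OF summableI, of "{k}" g] by simp
    ultimately show False using assms(1) by (simp add: top_unique)
  qed
  then have g: "g k = ennreal (enn2real (g k))" for k by (simp add: top.not_eq_extremum)
  have "summable (\<lambda>k. enn2real (g k))"
    using assms(1) g by (intro summable_suminf_not_top) auto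
  from order_tendstoD(2)[OF summable_LIMSEQ_zero[OF this] e]
  show ?thesis
  proof eventually_elim
    case (elim k)
    then show ?case by (subst g) (intro ennreal_leI less_imp_le)
  qed
qed

text \<open>The geometric rate makes the error densities summable, which will give convergence at
  almost every point. The factor \<open>N\<close> is the total mass of a one-body density by
  \<open>nn_integral_rhoN\<close>. The indices need only tend to infinity, so
  \<open>r k \<ge> k\<close> suffices.\<close>

lemma L2_approx_subsequence:
  fixes \<Psi> :: "(nat \<Rightarrow> real^'d) \<Rightarrow> complex"
  assumes \<Psi>: "L2_cfg N \<Psi>" "(\<integral>X. (cmod (\<Psi> X))\<^sup>2 \<partial>cfg N) = 1"
    and \<phi>: "\<And>n. L2_cfg N (\<phi> n)" and lim: "(\<lambda>n. \<integral>X. (cmod (\<phi> n X - \<Psi> X))\<^sup>2 \<partial>cfg N) \<longlonglongrightarrow> 0"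
  obtains r :: "nat \<Rightarrow> nat" where "filterlim r at_top sequentially"
    "\<And>k. (\<integral>\<^sup>+X. ennreal ((cmod (\<phi> (r k) X))\<^sup>2) \<partial>cfg N) \<le> 2"
    "\<And>k. of_nat N * (\<integral>\<^sup>+X. ennreal ((cmod (\<phi> (r k) X - \<Psi> X))\<^sup>2) \<partial>cfg N) \<le> ennreal ((1/2) ^ k)"
proof -
  let ?D = "\<lambda>n. \<integral>X. (cmod (\<phi> n X - \<Psi> X))\<^sup>2 \<partial>cfg N"
  have m[measurable]: "\<Psi> \<in> borel_measurable (cfg N)" "\<phi> n \<in> borel_measurable (cfg N)" for n
    using \<Psi>(1) \<phi>[of n] by (auto simp: L2_cfg_def)
  have D: "(\<integral>\<^sup>+X. ennreal ((cmod (\<phi> n X - \<Psi> X))\<^sup>2) \<partial>cfg N) = ennreal (?D n)" for n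
  proof (rule nn_integral_eq_integral)
    show "integrable (cfg N) (\<lambda>X. (cmod (\<phi> n X - \<Psi> X))\<^sup>2)"
    proof (rule Bochner_Integration.integrable_bound)
      show "integrable (cfg N) (\<lambda>X. 2 * (cmod (\<phi> n X))\<^sup>2 + 2 * (cmod (\<Psi> X))\<^sup>2)"
        using \<Psi>(1) \<phi>[of n] unfolding L2_cfg_def by (intro Bochner_Integration.integrable_add integrable_mult_right) auto
      show "AE X in cfg N. norm ((cmod (\<phi> n X - \<Psi> X))\<^sup>2) \<le> norm (2 * (cmod (\<phi> n X))\<^sup>2 + 2 * (cmod (\<Psi> X))\<^sup>2)"
      proof (intro AE_I2)
        fix X :: "nat \<Rightarrow> real^'d"
        show "norm ((cmod (\<phi> n X - \<Psi> X))\<^sup>2) \<le> norm (2 * (cmod (\<phi> n X))\<^sup>2 + 2 * (cmod (\<Psi> X))\<^sup>2)"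
          using norm_sq_young[of 1 "\<phi> n X - \<Psi> X" "\<phi> n X"] by simp
      qed
    qed measurable
  qed simp
  have "\<exists>n\<ge>k. ?D n < min (1/6) ((1/2) ^ k / (real N + 1))" for k
  proof -
    \<comment> \<open>With weight 1/2 in the quadratic inequality the mass of an approximant is at
      most 3/2 plus 3 times the error; an error below 1/6 keeps it within 2.\<close>
    have "min (1/6) ((1/2) ^ k / (real N + 1)) > (0::real)" by simp
    from order_tendstoD(2)[OF lim this] eventually_ge_at_top[of k]
    have "eventually (\<lambda>n. n \<ge> k \<and> ?D n < min (1/6) ((1/2) ^ k / (real N + 1))) sequentially"
      by eventually_elim simp
    then show ?thesis by (auto dest: eventually_happens)
  qed
  then have "\<forall>k. \<exists>n. n \<ge> k \<and> ?D n < min (1/6) ((1/2) ^ k / (real N + 1))" by blast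
  from choice[OF this] obtain r where "\<forall>k. r k \<ge> k \<and> ?D (r k) < min (1/6) ((1/2) ^ k / (real N + 1))" ..
  then have r: "r k \<ge> k" "?D (r k) < min (1/6) ((1/2) ^ k / (real N + 1))" for k by blast+
  show thesis
  proof (rule that[of r])
    show "filterlim r at_top sequentially"
      unfolding filterlim_at_top eventually_sequentially using r(1) by (blast intro: order_trans)
    fix k
    have D0: "?D (r k) \<ge> 0" by simp
    have "(\<integral>\<^sup>+X. ennreal ((cmod (\<phi> (r k) X))\<^sup>2) \<partial>cfg N)
       \<le> (\<integral>\<^sup>+X. ennreal (1 + 1/2) * ennreal ((cmod (\<Psi> X))\<^sup>2) + ennreal (1 + 1 / (1/2)) * ennreal ((cmod (\<phi> (r k) X - \<Psi> X))\<^sup>2) \<partial>cfg N)"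
      by (intro nn_integral_mono ennreal_norm_sq_young) simp
    also have "\<dots> = ennreal (1 + 1/2) * (\<integral>\<^sup>+X. ennreal ((cmod (\<Psi> X))\<^sup>2) \<partial>cfg N) + ennreal (1 + 1 / (1/2)) * ennreal (?D (r k))"
    proof -
      have "(\<integral>\<^sup>+X. a * ennreal ((cmod (\<Psi> X))\<^sup>2) + b * ennreal ((cmod (\<phi> (r k) X - \<Psi> X))\<^sup>2) \<partial>cfg N)
        = a * (\<integral>\<^sup>+X. ennreal ((cmod (\<Psi> X))\<^sup>2) \<partial>cfg N) + b * ennreal (?D (r k))" for a b
        unfolding D[of "r k", symmetric] by (simp add: nn_integral_add nn_integral_cmult)
      then show ?thesis .
    qed
    also have "(\<integral>\<^sup>+X. ennreal ((cmod (\<Psi> X))\<^sup>2) \<partial>cfg N) = ennreal 1"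
      using \<Psi> unfolding L2_cfg_def by (subst nn_integral_eq_integral) auto
    also have "ennreal (1 + 1/2) * ennreal 1 + ennreal (1 + 1 / (1/2)) * ennreal (?D (r k)) = ennreal ((1 + 1/2) * 1 + (1 + 1 / (1/2)) * ?D (r k))"
      using D0 by (subst ennreal_plus) (auto simp: ennreal_mult simp del: ennreal_plus)
    also have "\<dots> \<le> ennreal 2" using r(2)[of k] by (intro ennreal_leI) simp
    finally show "(\<integral>\<^sup>+X. ennreal ((cmod (\<phi> (r k) X))\<^sup>2) \<partial>cfg N) \<le> 2" by simp
    have "?D (r k) < (1/2) ^ k / (real N + 1)" using r(2)[of k] by simp
    then have "(real N + 1) * ?D (r k) < (1/2) ^ k" by (simp add: pos_less_divide_eq mult.commute)
    moreover have "real N * D \<le> e" if "(real N + 1) * D < e" "D \<ge> 0" for D e :: real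
      using that by (simp only: distrib_right mult_1_left)
    ultimately have "real N * ?D (r k) \<le> (1/2) ^ k" using D0 by blast
    then have "ennreal (real N * ?D (r k)) \<le> ennreal ((1/2) ^ k)" by (rule ennreal_leI)
    then show "of_nat N * (\<integral>\<^sup>+X. ennreal ((cmod (\<phi> (r k) X - \<Psi> X))\<^sup>2) \<partial>cfg N) \<le> ennreal ((1/2) ^ k)"
      unfolding D ennreal_of_nat_eq_real_of_nat using D0 by (subst ennreal_mult[symmetric]) simp_all
  qed
qed

text \<open>The inequality with its auxiliary parameters still free. Only a one-sided comparison
  survives the limit: the density of the approximants is eventually at least a quarter of
  \<open>rho\<close>, almost everywhere, and Fatou's lemma carries the resulting lower bound for
  \<open>Fint\<close> through the integral.\<close>

lemma lieb_thirring_fixed: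
  fixes \<Psi> :: "(nat \<Rightarrow> real^'d) \<Rightarrow> complex" and \<epsilon> c s sg :: real
  assumes sg: "2 * sg > real CARD('d)" "sg < s" and \<epsilon>: "0 < \<epsilon>" "\<epsilon> \<le> 1"
    and small: "cLow CARD('d) * (2 * real CARD('d) * \<epsilon>)\<^sup>2 * (4 * pi) ^ CARD('d) \<le> 1/2"
    and c: "c > 0" "4 * cLow CARD('d) * cPack CARD('d) \<epsilon> \<le> c"
    and \<Psi>: "in_HsN s N \<Psi>" "(\<integral>X. (cmod (\<Psi> X))\<^sup>2 \<partial>cfg N) = 1"
  shows "(\<integral>\<^sup>+x. ennreal ((2 * c) powr (- 2 * s / CARD('d)) / (4 * s) * (rho N \<Psi> x / 4) powr (1 + 2 * s / CARD('d))) \<partial>lborel)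
    \<le> ennreal (cK3 CARD('d) s sg * kinetic s N \<Psi>)" and "kinetic s N \<Psi> \<ge> 0"
proof -
  have s: "s > 0" using sg by (simp add: order_le_less_trans[of 0])
  \<comment> \<open>\<open>kinetic\<close> refers to one chosen approximating sequence, so the
    argument has to use exactly that one; it then passes to a subsequence, which leaves the limit of
    the kinetic forms unchanged.\<close>
  define \<phi> where "\<phi> = (SOME \<phi>. hs_approx s N \<Psi> \<phi>)"
  have L2: "L2_cfg N \<Psi>" using \<Psi>(1) by (simp add: in_HsN_def)
  then have m[measurable]: "\<Psi> \<in> borel_measurable (cfg N)" by (simp add: L2_cfg_def)
  have ap: "hs_approx s N \<Psi> \<phi>"
  proof -
    have "\<exists>\<phi>. hs_approx s N \<Psi> \<phi>" using \<Psi>(1) unfolding in_HsN_def by (rule conjunct2)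
    then show ?thesis unfolding \<phi>_def by (rule someI_ex)
  qed
  then have test: "test_fn N (\<phi> n)" for n by (simp add: hs_approx_def)
  have "\<exists>R. smooth_cfg N (\<phi> n) \<and> supp_in N R (\<phi> n)" for n using test_fnD[OF test[of n]] by metis
  then have "\<forall>n. \<exists>R. smooth_cfg N (\<phi> n) \<and> supp_in N R (\<phi> n)" ..
  from choice[OF this] obtain R where "\<forall>n. smooth_cfg N (\<phi> n) \<and> supp_in N (R n) (\<phi> n)" ..
  then have \<phi>: "smooth_cfg N (\<phi> n)" "supp_in N (R n) (\<phi> n)" for n by blast+
  have diag: "\<phi> n x = 0" if "x \<in> cfg_space N" "\<exists>i<N. \<exists>j<N. i \<noteq> j \<and> x i = x j" for n x
    by (rule test_fnD[OF test[of n]]) (use that in blast)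
  note cont = smooth_cfg_cont[OF \<phi>(1)]
  note mphi[measurable] = cont_cfg_measurable[OF cont]
  have kin: "(\<lambda>n. kin_form s N (\<phi> n)) \<longlonglongrightarrow> kinetic s N \<Psi>"
    using kin_form_convergent[OF ap] s unfolding kinetic_def \<phi>_def[symmetric] by (simp add: convergent_LIMSEQ_iff)
  show kin0: "kinetic s N \<Psi> \<ge> 0" by (rule LIMSEQ_le_const[OF kin]) (simp add: kin_form_nonneg)
  have "L2_cfg N (\<phi> n)" for n
    unfolding L2_cfg_def using cont_supp_integrable(2)[OF cont \<phi>(2)] mphi by blast
  moreover have "(\<lambda>n. \<integral>X. (cmod (\<phi> n X - \<Psi> X))\<^sup>2 \<partial>cfg N) \<longlonglongrightarrow> 0" using ap by (simp add: hs_approx_def)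
  ultimately obtain r where r: "filterlim r at_top sequentially"
    "\<And>k. (\<integral>\<^sup>+X. ennreal ((cmod (\<phi> (r k) X))\<^sup>2) \<partial>cfg N) \<le> 2"
    "\<And>k. of_nat N * (\<integral>\<^sup>+X. ennreal ((cmod (\<phi> (r k) X - \<Psi> X))\<^sup>2) \<partial>cfg N) \<le> ennreal ((1/2) ^ k)"
    using L2_approx_subsequence[OF L2 \<Psi>(2)] by blast
  let ?dl = "\<lambda>k. rhoN N (\<lambda>X. \<phi> (r k) X - \<Psi> X)"
  have mdl[measurable]: "?dl k \<in> borel_measurable borel" for k
    by (rule rhoN_measurable) measurable
  have "(\<integral>\<^sup>+x. (\<Sum>k. ?dl k x) \<partial>lborel) = (\<Sum>k. \<integral>\<^sup>+x. ?dl k x \<partial>lborel)"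
    by (rule nn_integral_suminf) measurable
  also have "\<dots> \<le> (\<Sum>k. ennreal ((1/2) ^ k))"
  proof (intro suminf_le summableI)
    fix k
    have "(\<integral>\<^sup>+x. ?dl k x \<partial>lborel) = of_nat N * (\<integral>\<^sup>+X. ennreal ((cmod (\<phi> (r k) X - \<Psi> X))\<^sup>2) \<partial>cfg N)"
      by (rule nn_integral_rhoN) measurable
    then show "(\<integral>\<^sup>+x. ?dl k x \<partial>lborel) \<le> ennreal ((1/2) ^ k)" using r(3)[of k] by simp
  qed
  also have "\<dots> = ennreal (\<Sum>k. (1/2) ^ k)"
    by (rule suminf_ennreal2) (auto intro: summable_geometric)
  finally have "(\<integral>\<^sup>+x. (\<Sum>k. ?dl k x) \<partial>lborel) \<noteq> \<infinity>" by (auto simp: top_unique)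
  \<comment> \<open>The error densities have summable integrals, so their sum is finite at almost
    every \<open>x\<close> and its terms tend to 0 there: the usual fast-subsequence argument,
    applied to densities.\<close>
  then have ae: "AE x in lborel. (\<Sum>k. ?dl k x) \<noteq> \<infinity>"
    by (intro nn_integral_PInf_AE) measurable
  let ?G = "\<lambda>t. (2 * c) powr (- 2 * s / CARD('d)) / (4 * s) * t powr (1 + 2 * s / CARD('d))"
  have low: "ennreal (?G (rho N \<Psi> x / 4)) \<le> liminf (\<lambda>k. Fint s sg N (\<phi> (r k)) x)"
    if fin: "(\<Sum>k. ?dl k x) \<noteq> \<infinity>" for x
  proof (cases "rho N \<Psi> x = 0")
    case False
    then have t: "rho N \<Psi> x > 0" using rho_nonneg[of N \<Psi> x] by simp
    then have "rho N \<Psi> x / 4 > 0" by simp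
    from ennreal_tendsto_zero_if_suminf_finite[OF fin this]
    have "eventually (\<lambda>k. ennreal (?G (rho N \<Psi> x / 4)) \<le> Fint s sg N (\<phi> (r k)) x) sequentially"
    proof eventually_elim
      case (elim k)
      have "ennreal (rho N \<Psi> x) \<le> 2 * rhoN N (\<phi> (r k)) x + 2 * ?dl k x"
        by (rule order_trans[OF rho_le_rhoN rhoN_young[OF m mphi]])
      also have "\<dots> \<le> 2 * rhoN N (\<phi> (r k)) x + 2 * ennreal (rho N \<Psi> x / 4)"
        by (intro add_mono mult_left_mono elim) auto
      finally have le: "ennreal (rho N \<Psi> x) \<le> 2 * rhoN N (\<phi> (r k)) x + 2 * ennreal (rho N \<Psi> x / 4)" .
      \<comment> \<open>Once the error is at most \<open>rho / 4\<close>, the inequality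
        \<open>rho \<le> 2 * q + rho / 2\<close> gives \<open>q \<ge> rho / 4\<close>; this is the
        origin of the 4.\<close>
      have "ennreal (rho N \<Psi> x / 4) \<le> rhoN N (\<phi> (r k)) x"
      proof (cases "rhoN N (\<phi> (r k)) x")
        case (real q)
        have "2 * ennreal a + 2 * ennreal b = ennreal (2 * a + 2 * b)" if "a \<ge> 0" "b \<ge> 0" for a b
          using that by (simp add: ennreal_mult ennreal_plus)
        from this[OF real(1), of "rho N \<Psi> x / 4"] t
        have "2 * ennreal q + 2 * ennreal (rho N \<Psi> x / 4) = ennreal (2 * q + 2 * (rho N \<Psi> x / 4))" by (meson less_imp_le zero_le_divide_iff zero_le_numeral)
        then have "rho N \<Psi> x \<le> 2 * q + 2 * (rho N \<Psi> x / 4)"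
          using le real t by (simp only: real(2)) (subst (asm) ennreal_le_iff; simp)
        then show ?thesis unfolding real(2) by (intro ennreal_leI) simp
      qed simp
      then show ?case
        using t by (intro Fint_lower[OF cont \<phi>(2) sg(1) s \<epsilon> small diag r(2) c]) auto
    qed
    then show ?thesis by (rule Liminf_bounded)
  qed simp
  have "(\<integral>\<^sup>+x. ennreal (?G (rho N \<Psi> x / 4)) \<partial>lborel) \<le> (\<integral>\<^sup>+x. liminf (\<lambda>k. Fint s sg N (\<phi> (r k)) x) \<partial>lborel)"
    by (rule nn_integral_mono_AE) (use ae in eventually_elim, rule low)
  also have "\<dots> \<le> liminf (\<lambda>k. \<integral>\<^sup>+x. Fint s sg N (\<phi> (r k)) x \<partial>lborel)"
    by (rule nn_integral_liminf) (simp add: Fint_measurable[OF cont \<phi>(2) sg(1)])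
  also have "\<dots> \<le> liminf (\<lambda>k. ennreal (cK3 CARD('d) s sg * kin_form s N (\<phi> (r k))))"
  proof (intro Liminf_mono always_eventually allI)
    fix k
    have "cK3 CARD('d) s sg \<ge> 0" unfolding cK3_def using cK2_nonneg[OF sg(1)] sg(2) by simp
    then have "ennreal (cK3 CARD('d) s sg * kin_form s N (\<phi> (r k))) = ennreal (cK3 CARD('d) s sg) * ennreal (kin_form s N (\<phi> (r k)))"
      by (intro ennreal_mult kin_form_nonneg)
    then show "(\<integral>\<^sup>+x. Fint s sg N (\<phi> (r k)) x \<partial>lborel) \<le> ennreal (cK3 CARD('d) s sg * kin_form s N (\<phi> (r k)))"
      using nn_integral_Fint[OF cont \<phi>(2) sg, of "r k"]
      unfolding nn_integral_kin_form[OF \<phi> less_imp_le[OF s]] by simp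
  qed
  also have "\<dots> = ennreal (cK3 CARD('d) s sg * kinetic s N \<Psi>)"
    by (intro lim_imp_Liminf trivial_limit_sequentially tendsto_ennrealI tendsto_mult tendsto_const filterlim_compose[OF kin r(1)])
  finally show "(\<integral>\<^sup>+x. ennreal (?G (rho N \<Psi> x / 4)) \<partial>lborel) \<le> ennreal (cK3 CARD('d) s sg * kinetic s N \<Psi>)" .
qed

theorem theorem1:
  fixes s :: real
  assumes "s > 0" and "2 * s > real CARD('d::finite)"
  shows "\<exists>C>0. \<forall>N\<ge>1. \<forall>\<Psi> :: (nat \<Rightarrow> real^'d) \<Rightarrow> complex.
           in_HsN s N \<Psi> \<and> (\<integral>x. (cmod (\<Psi> x))\<^sup>2 \<partial>cfg N) = 1 \<longrightarrow>
           ennreal C * (\<integral>\<^sup>+ x. ennreal (rho N \<Psi> x powr (1 + 2 * s / real CARD('d))) \<partial>lborel)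
             \<le> ennreal (kinetic s N \<Psi>)"
proof -
  let ?d = "CARD('d)"
  let ?q = "1 + 2 * s / real ?d"
  \<comment> \<open>The midpoint of \<open>d / 2\<close> and \<open>s\<close>, which lies strictly
    between them because \<open>2 * s > d\<close>.\<close>
  define sg where "sg = (s + real ?d / 2) / 2"
  have sg: "2 * sg > real ?d" "sg < s" using assms(2) by (auto simp: sg_def)
  define B where "B = cLow ?d * (2 * real ?d)\<^sup>2 * (4 * pi) ^ ?d"
  have B: "B \<ge> 0" using cLow_nonneg[of ?d] by (simp add: B_def)
  \<comment> \<open>\<open>B\<close> is the absorption coefficient at \<open>\<epsilon> = 1\<close>
    and scales with the square of \<open>\<epsilon>\<close>. This choice gives
    \<open>B * \<epsilon> \<le> 1/2\<close> and \<open>\<epsilon> \<le> 1\<close>, hence the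
    required half, also when \<open>B = 0\<close>.\<close>
  define \<epsilon> where "\<epsilon> = 1 / (1 + 2 * B)"
  have \<epsilon>: "0 < \<epsilon>" "\<epsilon> \<le> 1" using B by (auto simp: \<epsilon>_def)
  have small: "cLow ?d * (2 * real ?d * \<epsilon>)\<^sup>2 * (4 * pi) ^ ?d \<le> 1/2"
  proof -
    have "cLow ?d * (2 * real ?d * \<epsilon>)\<^sup>2 * (4 * pi) ^ ?d = B * \<epsilon> * \<epsilon>"
      unfolding B_def by (simp add: power2_eq_square)
    also have "\<dots> \<le> B * \<epsilon> * 1" using B \<epsilon> by (intro mult_left_mono) auto
    also have "\<dots> \<le> 1/2" using B by (simp add: \<epsilon>_def field_simps)
    finally show ?thesis .
  qed
  \<comment> \<open>The summand 1 makes \<open>c\<close> positive from the nonnegativity of the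
    other constants alone, as the choice of \<open>l0\<close> requires.\<close>
  define c where "c = 4 * cLow ?d * cPack ?d \<epsilon> + 1"
  have c: "c > 0" "4 * cLow ?d * cPack ?d \<epsilon> \<le> c"
    using cLow_nonneg[of ?d] cPack_nonneg[OF \<epsilon>(1), of ?d] by (auto simp: c_def add_nonneg_pos)
  \<comment> \<open>The constant of \<open>Fint_lower\<close>, with the quarter in
    \<open>rho / 4\<close> extracted as \<open>4 powr ?q\<close>.\<close>
  define A where "A = (2 * c) powr (- 2 * s / real ?d) / (4 * s) / 4 powr ?q"
  have A: "A > 0" using c assms(1) by (simp add: A_def)
  define K where "K = cK3 ?d s sg"
  have K: "K \<ge> 0" unfolding K_def cK3_def using cK2_nonneg[OF sg(1)] sg(2) by simp
  show ?thesis
  \<comment> \<open>Dividing by \<open>K + 1\<close> works with \<open>K \<ge> 0\<close> alone, and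
    \<open>K / (K + 1) \<le> 1\<close> absorbs the factor in front of the kinetic energy.\<close>
  proof (intro exI[of _ "A / (K + 1)"] conjI allI impI)
    show "A / (K + 1) > 0" using A K by simp
    fix N :: nat and \<Psi> :: "(nat \<Rightarrow> real^'d) \<Rightarrow> complex"
    assume *: "in_HsN s N \<Psi> \<and> (\<integral>x. (cmod (\<Psi> x))\<^sup>2 \<partial>cfg N) = 1"
    note LT = lieb_thirring_fixed[OF sg \<epsilon> small c conjunct1[OF *] conjunct2[OF *]]
    have [measurable]: "rho N \<Psi> \<in> borel_measurable borel"
      using * by (intro rho_measurable) (simp add: in_HsN_def L2_cfg_def)
    have "ennreal (A / (K + 1)) * (\<integral>\<^sup>+x. ennreal (rho N \<Psi> x powr ?q) \<partial>lborel)
        = ennreal (1 / (K + 1)) * (ennreal A * (\<integral>\<^sup>+x. ennreal (rho N \<Psi> x powr ?q) \<partial>lborel))"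
      using A K by (subst mult.assoc[symmetric], subst ennreal_mult[symmetric]) auto
    also have "ennreal A * (\<integral>\<^sup>+x. ennreal (rho N \<Psi> x powr ?q) \<partial>lborel)
        = (\<integral>\<^sup>+x. ennreal A * ennreal (rho N \<Psi> x powr ?q) \<partial>lborel)"
      by (rule nn_integral_cmult[symmetric]) measurable
    also have "\<dots> = (\<integral>\<^sup>+x. ennreal ((2 * c) powr (- 2 * s / ?d) / (4 * s) * (rho N \<Psi> x / 4) powr ?q) \<partial>lborel)"
    proof (intro nn_integral_cong)
      fix x
      have "(2 * c) powr (- 2 * s / ?d) / (4 * s) * (rho N \<Psi> x / 4) powr ?q = A * rho N \<Psi> x powr ?q"
        unfolding A_def using rho_nonneg[of N \<Psi> x] by (subst powr_divide) auto
      then show "ennreal A * ennreal (rho N \<Psi> x powr ?q) = ennreal ((2 * c) powr (- 2 * s / ?d) / (4 * s) * (rho N \<Psi> x / 4) powr ?q)"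
        using A by (simp only:) (intro ennreal_mult[symmetric]; simp)
    qed
    also have "ennreal (1 / (K + 1)) * \<dots> \<le> ennreal (1 / (K + 1)) * ennreal (K * kinetic s N \<Psi>)"
      using LT(1) unfolding K_def by (intro mult_left_mono) simp_all
    also have "\<dots> = ennreal (K * kinetic s N \<Psi> / (K + 1))"
      using K LT(2) by (subst ennreal_mult[symmetric]) auto
    also have "\<dots> \<le> ennreal (kinetic s N \<Psi>)"
      using K LT(2) by (intro ennreal_leI) (simp add: field_simps)
    finally show "ennreal (A / (K + 1)) * (\<integral>\<^sup>+x. ennreal (rho N \<Psi> x powr ?q) \<partial>lborel) \<le> ennreal (kinetic s N \<Psi>)" .
  qed
qed

end
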